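(* Let $Af=a*f$ be the convolution operator with a known convolution filter $a$, and consider the Gaussian white noise model. Let $$\mathcal F=\Big\{\sum_{j_1=0,\dots,j_d=0}^\infty\ \sum_{k\in K_j}\theta_{jk}\phi_{jk}:\ (\theta_{jk})\in\Theta\Big\},\qquad \Theta=\Big\{\theta:\ \sum_{j_1=0,\dots,j_d=0}^\infty\ \sum_{k\in K_j}a_{jk}^2\theta_{jk}^2\le L^2\Big\},$$ where $(\phi_{jk})$, $j\in\{0,1,\dots\}^d$, $k\in K_j$, is the trigonometric basis given in the context. Assume that the coefficients of the ellipsoid $\Theta$ satisfy $$C_0|j|^s\le a_{jk}\le C_1|j|^s$$ for some $s>0$ and $C_0,C_1>0$. Assume that the convolution filter $a$ is a $1$-periodic function in $L_2([0,1]^d)$ and that its Fourier coefficients $b_{jk}$, defined by the expansion $a=\sum_{j_1=0,\dots,j_d=0}^\infty\sum_{k\in K_j}b_{jk}\phi_{jk}$, satisfy $$C_2|j|^{-q}\le b_{jk}\le C_3|j|^{-q}$$ for some $q\ge0$, $C_2,C_3>0$. Then $$\limsup_{n\to\infty}\ n^{2s/(2s+2q+d)}\sup_{f\in\mathcal F}E_f\|\hat f-f\|_2^2<\infty,$$ where $\hat f$ is the $\delta$-net estimator. Also, $$\liminf_{n\to\infty}\ n^{2s/(2s+2q+d)}\inf_{\hat g}\sup_{f\in\mathcal F}E_f\|\hat g-f\|_2^2>0,$$ where the infimum is taken over any estimators $\hat g$.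
   Context: $|j|=j_1+\cdots+j_d$. $K_j=\{k\in\{0,1\}^d:k_i=0\text{ when }j_i=0\}$, and for $x\in[0,1]^d$ $$\phi_{jk}(x)=\prod_{i=1}^d\sqrt2\,\big[(1-k_i)\cos(2\pi j_ix_i)+k_i\sin(2\pi j_ix_i)\big];$$ the collection $(\phi_{jk})$ is a basis for $1$-periodic functions on $L_2([0,1]^d)$. Gaussian white noise model: one observes $dY_n(y)=(Af)(y)\,dy+n^{-1/2}dW(y)$, where for square integrable $h_1,h_2$ the vector $(\int h_1dW,\int h_2dW)$ is centered Gaussian with variances $\|h_1\|_2^2,\|h_2\|_2^2$ and covariance $\int h_1h_2$. $E_f$ is expectation when $f$ is the true signal. $Q=(A^{-1})^*$ is the adjoint of the inverse of $A$: $\int(A^{-1}h)g=\int h\,(Qg)$. Empirical risk: $\gamma_n(g)=-2\int(Qg)\,dY_n+\|g\|_2^2$. $\delta$-net estimator: $\hat f=\operatorname{argmin}_{\phi\in\mathcal F_\delta}\gamma_n(\phi)$, where $\mathcal F_\delta$ is a finite $\delta$-net of $\mathcal F$ in $L_2$ (every $f\in\mathcal F$ is within $L_2$ distance $\delta$ of some $\phi\in\mathcal F_\delta$). The net used has elements whose basis coefficients vanish for $j\notin\{0,\dots,M\}^d$ with $M\asymp\delta^{-1/s}$, and satisfies $\log(\#\mathcal F_\delta)\le C\delta^{-d/s}$; $\delta$ is chosen of the order $n^{-s/(2s+2q+d)}$.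
   Formalization: The bounds on a_jk and b_jk are imposed for j≠0 only, with a_00, b_00 > 0 and L > 0; for d≥3 the upper bound also assumes that A has singular values at least c|j|^{-q} on span{φ_jk : k∈K_j}, j≠0, since the bounds on b_jk do not ensure this and the claim can then fail. *)

theory Defs
  imports "HOL-Probability.Probability" "HOL-Library.Landau_Symbols"
begin

section \<open>The space $L_2([0,1]^d)$\<close>

text \<open>The dimension $d$ is \<open>CARD('d)\<close>. Elements of $L_2$ are represented by functions on
  \<open>real^'d\<close>; only their values on the unit cube, up to null sets, matter.
  In \<open>cbox 0 1\<close> the corner \<open>1\<close> is the vector with all entries 1.\<close>

definition cube :: "(real^'d) measure" where
  "cube = restrict_space lborel (cbox 0 1)"

definition sq_int :: "(real^'d \<Rightarrow> real) set" where
  "sq_int = {f. f \<in> borel_measurable cube \<and> integrable cube (\<lambda>x. (f x)\<^sup>2)}"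

definition l2_inner :: "(real^'d \<Rightarrow> real) \<Rightarrow> (real^'d \<Rightarrow> real) \<Rightarrow> real" where
  "l2_inner f g = (LINT x|cube. f x * g x)"

definition l2_norm :: "(real^'d \<Rightarrow> real) \<Rightarrow> real" where
  "l2_norm f = sqrt (LINT x|cube. (f x)\<^sup>2)"

definition one_periodic :: "(real^'d \<Rightarrow> real) \<Rightarrow> bool" where
  "one_periodic f \<longleftrightarrow> (\<forall>x i. f (x + axis i 1) = f x)"


section \<open>Trigonometric basis and ellipsoids\<close>

definition deg :: "nat^'d \<Rightarrow> nat" where
  "deg j = (\<Sum>i\<in>UNIV. j $ i)"

definition K :: "nat^'d \<Rightarrow> (nat^'d) set" where
  "K j = {k. \<forall>i. k $ i \<in> {0, 1} \<and> (j $ i = 0 \<longrightarrow> k $ i = 0)}"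

definition idx :: "((nat^'d) \<times> (nat^'d)) set" where
  "idx = Sigma UNIV K"

text \<open>The factor $\sqrt 2$ is also present for coordinates with $j_i = 0$, so the system is
  orthogonal, but the elements with some $j_i = 0$ are not normalized.\<close>

definition trig :: "nat^'d \<Rightarrow> nat^'d \<Rightarrow> real^'d \<Rightarrow> real" where
  "trig j k x = (\<Prod>i\<in>UNIV. sqrt 2 *
     ((1 - real (k $ i)) * cos (2 * pi * real (j $ i) * x $ i)
      + real (k $ i) * sin (2 * pi * real (j $ i) * x $ i)))"

definition has_expansion :: "(nat^'d \<Rightarrow> nat^'d \<Rightarrow> real) \<Rightarrow> (real^'d \<Rightarrow> real) \<Rightarrow> bool" where
  "has_expansion \<theta> f \<longleftrightarrow> f \<in> sq_int \<and>
     ((\<lambda>S. l2_norm (\<lambda>x. f x - (\<Sum>(j, k)\<in>S. \<theta> j k * trig j k x))) \<longlongrightarrow> 0)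
       (finite_subsets_at_top idx)"

definition ellipsoid :: "(nat^'d \<Rightarrow> nat^'d \<Rightarrow> real) \<Rightarrow> real \<Rightarrow> (nat^'d \<Rightarrow> nat^'d \<Rightarrow> real) set" where
  "ellipsoid \<alpha> L = {\<theta>. (\<lambda>(j, k). (\<alpha> j k)\<^sup>2 * (\<theta> j k)\<^sup>2) summable_on idx \<and>
     (\<Sum>\<^sub>\<infinity>(j, k)\<in>idx. (\<alpha> j k)\<^sup>2 * (\<theta> j k)\<^sup>2) \<le> L\<^sup>2}"

definition fun_class :: "(nat^'d \<Rightarrow> nat^'d \<Rightarrow> real) \<Rightarrow> real \<Rightarrow> (real^'d \<Rightarrow> real) set" where
  "fun_class \<alpha> L = {f. \<exists>\<theta>\<in>ellipsoid \<alpha> L. has_expansion \<theta> f}"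


section \<open>Convolution operator and the adjoint of its inverse\<close>

definition conv :: "(real^'d \<Rightarrow> real) \<Rightarrow> (real^'d \<Rightarrow> real) \<Rightarrow> real^'d \<Rightarrow> real" where
  "conv a f x = (LINT y|cube. a (x - y) * f y)"

text \<open>The next two functions pick a representative of a class modulo null sets. The second one
  is the operator $Q = (A^{-1})^*$; it is unbounded in general, and only its values at functions
  in its domain are meaningful.\<close>

definition conv_inv :: "(real^'d \<Rightarrow> real) \<Rightarrow> (real^'d \<Rightarrow> real) \<Rightarrow> real^'d \<Rightarrow> real" where
  "conv_inv a h = (SOME f. f \<in> sq_int \<and> (AE x in cube. conv a f x = h x))"

definition adj_inv :: "(real^'d \<Rightarrow> real) \<Rightarrow> (real^'d \<Rightarrow> real) \<Rightarrow> real^'d \<Rightarrow> real" where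
  "adj_inv a g = (SOME u. u \<in> sq_int \<and>
     (\<forall>h \<in> conv a ` sq_int. l2_inner (conv_inv a h) g = l2_inner h u))"

text \<open>For each $j \<noteq> 0$, the convolution operator maps the span of the $\phi_{jk}$, $k \in K_j$,
  to itself. The following says that its singular values there are at least of the order
  $|j|^{-q}$. If $d \<le> 2$, this is a consequence of $C_2 |j|^{-q} \<le> b_{jk}$. If $d \<ge> 3$, it is
  not: the complex Fourier coefficient of $a$ at $(\sigma_1 j_1, \dots, \sigma_d j_d)$ is, when all
  $j_i \<noteq> 0$, a constant times $\sum_k b_{jk} \prod_{i : k_i = 1} (-\mathrm{i}\, \sigma_i)$, which can
  vanish (for $d = 3$ and all signs $+1$, take $b_{jk}$ proportional to 3 for $k = (0,0,0)$ and
  $k = (1,1,1)$, and to 1 otherwise).\<close>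

definition singular_values_ge :: "(real^'d \<Rightarrow> real) \<Rightarrow> real \<Rightarrow> bool" where
  "singular_values_ge a q \<longleftrightarrow> (\<exists>c>0. \<forall>j t. j \<noteq> 0 \<longrightarrow>
     c * real (deg j) powr (-q) * l2_norm (\<lambda>x. \<Sum>k\<in>K j. t k * trig j k x)
       \<le> l2_norm (conv a (\<lambda>x. \<Sum>k\<in>K j. t k * trig j k x)))"


section \<open>Gaussian white noise model\<close>

definition centered_gaussian :: "'w measure \<Rightarrow> ('w \<Rightarrow> real) \<Rightarrow> real \<Rightarrow> bool" where
  "centered_gaussian P X v \<longleftrightarrow> X \<in> borel_measurable P \<and>
     (if v = 0 then AE \<omega> in P. X \<omega> = 0
      else distributed P lborel X (\<lambda>x. ennreal (normal_density 0 (sqrt v) x)))"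

text \<open>A pair is Gaussian iff all linear combinations of its components are
  (possibly degenerate) Gaussian.\<close>

definition centered_gaussian_pair ::
    "'w measure \<Rightarrow> ('w \<Rightarrow> real) \<Rightarrow> ('w \<Rightarrow> real) \<Rightarrow> real \<Rightarrow> real \<Rightarrow> real \<Rightarrow> bool" where
  "centered_gaussian_pair P X1 X2 v1 v2 c \<longleftrightarrow>
     (\<forall>r1 r2. centered_gaussian P (\<lambda>\<omega>. r1 * X1 \<omega> + r2 * X2 \<omega>)
        (r1\<^sup>2 * v1 + 2 * r1 * r2 * c + r2\<^sup>2 * v2))"

text \<open>\<open>W h\<close> is the stochastic integral $\int h\,dW$.\<close>

definition white_noise :: "'w measure \<Rightarrow> ((real^'d \<Rightarrow> real) \<Rightarrow> 'w \<Rightarrow> real) \<Rightarrow> bool" where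
  "white_noise P W \<longleftrightarrow> prob_space P \<and>
     (\<forall>h1\<in>sq_int. \<forall>h2\<in>sq_int. centered_gaussian_pair P (W h1) (W h2)
        ((l2_norm h1)\<^sup>2) ((l2_norm h2)\<^sup>2) (l2_inner h1 h2))"

text \<open>An observation is the family of all integrals $\int h\,dY_n$, $h \in L_2$.\<close>

definition data_space :: "((real^'d \<Rightarrow> real) \<Rightarrow> real) measure" where
  "data_space = PiM sq_int (\<lambda>_. borel)"

definition observation :: "(real^'d \<Rightarrow> real) \<Rightarrow> ((real^'d \<Rightarrow> real) \<Rightarrow> 'w \<Rightarrow> real) \<Rightarrow> nat
    \<Rightarrow> (real^'d \<Rightarrow> real) \<Rightarrow> 'w \<Rightarrow> (real^'d \<Rightarrow> real) \<Rightarrow> real" where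
  "observation a W n f \<omega> =
     (\<lambda>h\<in>sq_int. l2_inner h (conv a f) + real n powr (-1/2) * W h \<omega>)"

text \<open>Estimators are the $L_2$-valued functions of the data that are measurable for the Borel
  sets of $L_2$. As $L_2$ is separable, these are generated by the balls.\<close>

definition estimators :: "(((real^'d \<Rightarrow> real) \<Rightarrow> real) \<Rightarrow> (real^'d \<Rightarrow> real)) set" where
  "estimators = {T. (\<forall>y\<in>space data_space. T y \<in> sq_int) \<and>
     (\<forall>g\<in>sq_int. (\<lambda>y. l2_norm (\<lambda>x. T y x - g x)) \<in> borel_measurable data_space)}"

text \<open>The risk $E_f \| T - f \|_2^2$, possibly infinite.\<close>

definition risk :: "'w measure \<Rightarrow> ((real^'d \<Rightarrow> real) \<Rightarrow> 'w \<Rightarrow> real) \<Rightarrow> (real^'d \<Rightarrow> real) \<Rightarrow> nat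
    \<Rightarrow> (((real^'d \<Rightarrow> real) \<Rightarrow> real) \<Rightarrow> (real^'d \<Rightarrow> real)) \<Rightarrow> (real^'d \<Rightarrow> real) \<Rightarrow> ennreal" where
  "risk P W a n T f =
     (\<integral>\<^sup>+\<omega>. ennreal ((l2_norm (\<lambda>x. T (observation a W n f \<omega>) x - f x))\<^sup>2) \<partial>P)"


section \<open>Delta-net estimator\<close>

definition emp_risk ::
    "(real^'d \<Rightarrow> real) \<Rightarrow> ((real^'d \<Rightarrow> real) \<Rightarrow> real) \<Rightarrow> (real^'d \<Rightarrow> real) \<Rightarrow> real" where
  "emp_risk a y g = -2 * y (adj_inv a g) + (l2_norm g)\<^sup>2"

definition delta_net :: "real \<Rightarrow> (real^'d \<Rightarrow> real) set \<Rightarrow> (real^'d \<Rightarrow> real) set \<Rightarrow> bool" where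
  "delta_net \<delta> F N \<longleftrightarrow> finite N \<and> N \<subseteq> sq_int \<and>
     (\<forall>f\<in>F. \<exists>g\<in>N. l2_norm (\<lambda>x. f x - g x) \<le> \<delta>)"

definition band_limited :: "nat \<Rightarrow> (real^'d \<Rightarrow> real) \<Rightarrow> bool" where
  "band_limited m g \<longleftrightarrow> (\<exists>\<theta>. has_expansion \<theta> g \<and>
     (\<forall>(j, k)\<in>idx. (\<exists>i. j $ i > m) \<longrightarrow> \<theta> j k = 0))"

definition admissible_nets :: "(nat^'d \<Rightarrow> nat^'d \<Rightarrow> real) \<Rightarrow> real \<Rightarrow> real \<Rightarrow> real
    \<Rightarrow> (nat \<Rightarrow> real) \<Rightarrow> (nat \<Rightarrow> (real^'d \<Rightarrow> real) set) \<Rightarrow> bool" where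
  "admissible_nets \<alpha> L s q \<delta> N \<longleftrightarrow>
     (\<forall>n\<ge>1. \<delta> n > 0) \<and>
     \<delta> \<in> \<Theta>(\<lambda>n. real n powr (- s / (2 * s + 2 * q + real CARD('d)))) \<and>
     (\<forall>n\<ge>1. delta_net (\<delta> n) (fun_class \<alpha> L) (N n)) \<and>
     (\<exists>m :: nat \<Rightarrow> nat. (\<lambda>n. real (m n)) \<in> \<Theta>(\<lambda>n. \<delta> n powr (- 1 / s)) \<and>
        (\<forall>n\<ge>1. \<forall>g\<in>N n. band_limited (m n) g)) \<and>
     (\<exists>C. \<forall>n\<ge>1. ln (real (card (N n))) \<le> C * \<delta> n powr (- real CARD('d) / s))"

definition delta_net_estimator :: "(real^'d \<Rightarrow> real) \<Rightarrow> (real^'d \<Rightarrow> real) set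
    \<Rightarrow> (((real^'d \<Rightarrow> real) \<Rightarrow> real) \<Rightarrow> (real^'d \<Rightarrow> real)) \<Rightarrow> bool" where
  "delta_net_estimator a N T \<longleftrightarrow> T \<in> estimators \<and>
     (\<forall>y\<in>space data_space. is_arg_min (emp_risk a y) (\<lambda>g. g \<in> N) (T y))"

end

theory Submission
  imports Defs
begin

text \<open>
  Upper bound. On band-limited functions \<open>Q\<close> divides the Fourier coefficients of its argument by
  those of the filter, so it enlarges the norm at most by the factor \<open>\<kappa>\<close> of order
  $\delta^{-q/s}$. Comparing the estimator $\hat f$ with a net element $g_0$ that is closest to
  \<open>f\<close> gives $\|\hat f - f\|^2 \le \delta^2 + 2 n^{-1/2} W (Q \hat f - Q g_0)$, and the exponential
  moments of the Gaussian increments turn this into a risk of order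
  $\delta^2 + \kappa^2 \log(\#\mathcal F_\delta) / n$.

  Lower bound. Assouad's lemma is applied to the sums $\sum_m \pm \epsilon \psi_m$ of cosine waves
  with all frequencies in $(M, 2M]$, where $M$ is of order $n^{1/(2s+2q+d)}$ and $\epsilon^2$ of
  order $M^{-2s-d}$. Flipping one sign shifts the mean of the data by $O(1)$ noise standard
  deviations. The laws of the data are compared by the Cameron-Martin formula, which is derived
  from Levy's uniqueness theorem, since measures on the data space are determined by the cosine
  transforms of finite linear combinations of the coordinates.
\<close>

section \<open>Square integrable functions\<close>

text \<open>Convolution is diagonal for the complex exponentials, whereas the class, the filter and
  the band limits are given in the real product basis. A bound on each \<open>b j k\<close> thus
  controls sums of up to 2^d terms with phases: from above by the triangle inequality in every
  dimension, from below only if the phases cannot cancel. This is why the condition on singular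
  values guards the upper bound alone. \<open>adj_inv\<close> is a choice among the solutions of a
  family of equations. It can be computed only because the exponentials are complete, so
  completeness has to be proved before the estimator can be analysed. The rate comes from balancing
  the two terms of the risk: with \<kappa> of order \<delta> to the power -q/s and the log
  cardinality of order \<delta> to the power -d/s, equality requires 1/n of order \<delta> to the
  power 2 + (2q + d)/s. \<open>white_noise\<close> prescribes the laws of pairs only, and an
  estimator may read uncountably many coordinates. Linearity of \<open>W\<close> is therefore
  derived almost surely, for finitely many functions at a time, and laws are compared on cylinder
  sets.\<close>

lemma sets_cube [measurable_cong]: "sets cube = sets (restrict_space borel (cbox 0 (1::real^'d)))"
  unfolding cube_def by (simp cong: sets_restrict_space_cong)

lemma space_cube [simp]: "space (cube :: (real^'d) measure) = cbox 0 1"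
  by (simp add: cube_def space_restrict_space)

lemma inner_one_Basis: "b \<in> Basis \<Longrightarrow> (1::real^'d) \<bullet> b = 1"
  by (auto simp: Basis_vec_def inner_axis)

lemma prob_space_cube: "prob_space (cube :: (real^'d) measure)"
proof
  have "emeasure lborel (cbox 0 (1::real^'d)) = 1"
    by (subst emeasure_lborel_cbox) (auto simp: inner_one_Basis)
  then show "emeasure cube (space (cube :: (real^'d) measure)) = 1"
    by (simp add: cube_def emeasure_restrict_space)
qed

interpretation cube: prob_space "cube :: (real^'d) measure"
  by (rule prob_space_cube)

lemma borel_measurable_cubeI [measurable (raw)]:
  "f \<in> borel_measurable borel \<Longrightarrow> f \<in> borel_measurable cube"
  unfolding cube_def by (auto intro: measurable_restrict_space1)

lemma measurable_cube_id: "(\<lambda>x. x) \<in> measurable cube borel"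
  by measurable

lemma sq_int_measurable [measurable_dest]: "f \<in> sq_int \<Longrightarrow> f \<in> borel_measurable cube"
  by (simp add: sq_int_def)

lemma integrable_sq_int: "f \<in> sq_int \<Longrightarrow> integrable cube (\<lambda>x. (f x)\<^sup>2)"
  by (simp add: sq_int_def)

lemma sq_int_integrable_mult:
  assumes "f \<in> sq_int" "g \<in> sq_int"
  shows "integrable cube (\<lambda>x. f x * g x)"
proof (rule Bochner_Integration.integrable_bound)
  show "integrable cube (\<lambda>x. (f x)\<^sup>2 + (g x)\<^sup>2)"
    using assms by (auto intro: integrable_sq_int)
  show "(\<lambda>x. f x * g x) \<in> borel_measurable cube"
    using assms by measurable
  have "\<bar>u * v\<bar> \<le> u\<^sup>2 + v\<^sup>2" for u v :: real
  proof -
    have "0 \<le> (\<bar>u\<bar> - \<bar>v\<bar>)\<^sup>2" by simp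
    then have "2 * (\<bar>u\<bar> * \<bar>v\<bar>) \<le> u\<^sup>2 + v\<^sup>2" by (simp add: power2_diff)
    then show ?thesis by (simp add: abs_mult) (smt (verit) mult_nonneg_nonneg)
  qed
  then show "AE x in cube. norm (f x * g x) \<le> norm ((f x)\<^sup>2 + (g x)\<^sup>2)"
    by auto
qed

lemma sq_int_zero [simp]: "(\<lambda>_. 0) \<in> sq_int"
  by (simp add: sq_int_def)

lemma sq_int_cmult: "f \<in> sq_int \<Longrightarrow> (\<lambda>x. c * f x) \<in> sq_int"
  by (auto simp: sq_int_def power_mult_distrib)

lemma sq_int_add:
  assumes "f \<in> sq_int" "g \<in> sq_int"
  shows "(\<lambda>x. f x + g x) \<in> sq_int"
  using assms sq_int_integrable_mult[OF assms]
  by (auto simp: sq_int_def power2_sum mult.assoc intro!: Bochner_Integration.integrable_add)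

lemma sq_int_diff:
  assumes "f \<in> sq_int" "g \<in> sq_int"
  shows "(\<lambda>x. f x - g x) \<in> sq_int"
  using sq_int_add[OF assms(1) sq_int_cmult[OF assms(2), of "-1"]] by simp

lemma sq_int_sum:
  "(\<And>i. i \<in> I \<Longrightarrow> f i \<in> sq_int) \<Longrightarrow> (\<lambda>x. \<Sum>i\<in>I. f i x) \<in> sq_int"
  by (induction I rule: infinite_finite_induct) (auto intro: sq_int_add)

lemma sq_int_bounded:
  fixes f :: "real^'d \<Rightarrow> real"
  assumes [measurable]: "f \<in> borel_measurable borel" and "\<And>x. \<bar>f x\<bar> \<le> B"
  shows "f \<in> sq_int"
proof -
  have "\<bar>(f x)\<^sup>2\<bar> \<le> B\<^sup>2" for x
    using assms(2)[of x] by (simp add: abs_le_square_iff[symmetric])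
  then have "integrable cube (\<lambda>x. (f x)\<^sup>2)"
    by (intro cube.integrable_const_bound[where B="B\<^sup>2"]) auto
  then show ?thesis by (simp add: sq_int_def)
qed

lemma sq_int_integrable: 
  assumes "f \<in> sq_int"
  shows "integrable cube f"
proof -
  have "(\<lambda>_. 1) \<in> sq_int" by (rule sq_int_bounded[of _ 1]) auto
  from sq_int_integrable_mult[OF assms this] show ?thesis by simp
qed

lemma l2_norm_nonneg [simp]: "0 \<le> l2_norm f"
  by (simp add: l2_norm_def)

lemma l2_norm_sq: "(l2_norm f)\<^sup>2 = (LINT x|cube. (f x)\<^sup>2)"
  by (simp add: l2_norm_def)

lemma l2_norm_sq_inner: "(l2_norm f)\<^sup>2 = l2_inner f f"
  unfolding l2_norm_sq l2_inner_def by (simp add: power2_eq_square)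

lemma l2_inner_commute: "l2_inner f g = l2_inner g f"
  by (simp add: l2_inner_def mult.commute)

lemma l2_inner_add_left:
  "f \<in> sq_int \<Longrightarrow> g \<in> sq_int \<Longrightarrow> h \<in> sq_int \<Longrightarrow>
    l2_inner (\<lambda>x. f x + g x) h = l2_inner f h + l2_inner g h"
  by (simp add: l2_inner_def distrib_right sq_int_integrable_mult)

lemma l2_inner_diff_left:
  "f \<in> sq_int \<Longrightarrow> g \<in> sq_int \<Longrightarrow> h \<in> sq_int \<Longrightarrow>
    l2_inner (\<lambda>x. f x - g x) h = l2_inner f h - l2_inner g h"
  by (simp add: l2_inner_def left_diff_distrib sq_int_integrable_mult)

lemma l2_inner_cmult_left: "l2_inner (\<lambda>x. c * f x) h = c * l2_inner f h"
  by (simp add: l2_inner_def mult.assoc)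

lemma l2_inner_sum_left:
  assumes "\<And>i. i \<in> I \<Longrightarrow> f i \<in> sq_int" "h \<in> sq_int"
  shows "l2_inner (\<lambda>x. \<Sum>i\<in>I. f i x) h = (\<Sum>i\<in>I. l2_inner (f i) h)"
  using assms by (simp add: l2_inner_def sum_distrib_right sq_int_integrable_mult)

lemma l2_norm_diff_sq:
  assumes "f \<in> sq_int" "g \<in> sq_int"
  shows "(l2_norm (\<lambda>x. f x - g x))\<^sup>2 = (l2_norm f)\<^sup>2 - 2 * l2_inner f g + (l2_norm g)\<^sup>2"
proof -
  have fg: "(\<lambda>x. f x - g x) \<in> sq_int"
    using assms by (rule sq_int_diff)
  have "l2_inner (\<lambda>x. f x - g x) (\<lambda>x. f x - g x)
    = l2_inner (\<lambda>x. f x - g x) f - l2_inner (\<lambda>x. f x - g x) g"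
    using assms fg l2_inner_diff_left[of f g "\<lambda>x. f x - g x"]
    by (simp add: l2_inner_commute)
  also have "\<dots> = l2_inner f f - l2_inner g f - (l2_inner f g - l2_inner g g)"
    using assms by (simp add: l2_inner_diff_left)
  finally show ?thesis
    by (simp add: l2_norm_sq_inner l2_inner_commute[of g f])
qed

lemma l2_norm_cmult: "l2_norm (\<lambda>x. c * f x) = \<bar>c\<bar> * l2_norm f"
  by (simp add: l2_norm_def power_mult_distrib real_sqrt_mult)

lemma l2_norm_minus_commute: "l2_norm (\<lambda>x. f x - g x) = l2_norm (\<lambda>x. g x - f x)"
  by (simp add: l2_norm_def power2_commute)

lemma l2_norm_cong_AE:
  assumes "f \<in> borel_measurable cube" "g \<in> borel_measurable cube" "AE x in cube. f x = g x"
  shows "l2_norm f = l2_norm g"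
proof -
  have "(LINT x|cube. (f x)\<^sup>2) = (LINT x|cube. (g x)\<^sup>2)"
    using assms by (intro integral_cong_AE) auto
  then show ?thesis by (simp add: l2_norm_def)
qed

lemma l2_inner_cong_AE:
  assumes "f \<in> borel_measurable cube" "f' \<in> borel_measurable cube" "g \<in> borel_measurable cube"
    "AE x in cube. f x = f' x"
  shows "l2_inner f g = l2_inner f' g"
  unfolding l2_inner_def using assms by (intro integral_cong_AE) auto

lemma l2_norm_triangle_sq:
  assumes "f \<in> sq_int" "g \<in> sq_int"
  shows "(l2_norm (\<lambda>x. f x - g x))\<^sup>2 \<le> 2 * (l2_norm f)\<^sup>2 + 2 * (l2_norm g)\<^sup>2"
proof -
  have "(f x - g x)\<^sup>2 \<le> 2 * (f x)\<^sup>2 + 2 * (g x)\<^sup>2" for x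
    using sum_squares_ge_zero[of "f x + g x" 0] by (simp add: power2_eq_square algebra_simps)
  then have "(LINT x|cube. (f x - g x)\<^sup>2) \<le> (LINT x|cube. 2 * (f x)\<^sup>2 + 2 * (g x)\<^sup>2)"
    using assms by (intro integral_mono) (auto intro!: integrable_sq_int sq_int_diff)
  then show ?thesis
    using assms by (simp add: l2_norm_sq integrable_sq_int)
qed

lemma l2_Cauchy_Schwarz:
  assumes "f \<in> sq_int" "g \<in> sq_int"
  shows "\<bar>l2_inner f g\<bar> \<le> l2_norm f * l2_norm g"
proof -
  define p where "p = l2_inner f g"
  have *: "0 \<le> (l2_norm f)\<^sup>2 - 2 * t * p + t\<^sup>2 * (l2_norm g)\<^sup>2" for t
  proof -
    have "0 \<le> (l2_norm (\<lambda>x. f x - t * g x))\<^sup>2" by simp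
    also have "\<dots> = (l2_norm f)\<^sup>2 - 2 * t * p + t\<^sup>2 * (l2_norm g)\<^sup>2"
      using assms sq_int_cmult[OF assms(2), of t] by (simp add: l2_norm_diff_sq
        l2_norm_cmult power_mult_distrib l2_inner_commute[of f] l2_inner_cmult_left p_def)
    finally show ?thesis .
  qed
  have "p\<^sup>2 \<le> (l2_norm f)\<^sup>2 * (l2_norm g)\<^sup>2"
  proof (cases "l2_norm g = 0")
    case True
    have "p = 0"
    proof (rule ccontr)
      assume "p \<noteq> 0"
      \<comment> \<open>The quadratic has become affine in \<open>t\<close>; at this value it equals
        -1.\<close>
      with *[of "((l2_norm f)\<^sup>2 + 1) / (2 * p)"] True show False by simp
    qed
    then show ?thesis by simp
  next
    case False
    define G where "G = (l2_norm g)\<^sup>2"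
    from False have g: "G > 0" by (simp add: G_def)
    have "(p / G)\<^sup>2 * G = p\<^sup>2 / G" "2 * (p / G) * p = 2 * (p\<^sup>2 / G)"
      using g by (simp_all add: power2_eq_square)
    with *[of "p / G"] have "p\<^sup>2 / G \<le> (l2_norm f)\<^sup>2"
      unfolding G_def[symmetric] by linarith
    then show ?thesis using g by (simp add: G_def[symmetric] field_simps)
  qed
  then have "sqrt (p\<^sup>2) \<le> sqrt ((l2_norm f * l2_norm g)\<^sup>2)"
    by (intro real_sqrt_le_mono) (simp add: power_mult_distrib)
  then show ?thesis by (simp add: p_def)
qed

section \<open>Periodic functions on the cube\<close>

definition zvec :: "int^'d \<Rightarrow> real^'d" where
  "zvec z = (\<chi> i. of_int (z $ i))"

definition frac_vec :: "real^'d \<Rightarrow> real^'d" where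
  "frac_vec x = (\<chi> i. frac (x $ i))"

text \<open>The codomain is arbitrary because the notion serves real, complex and
  \<open>ennreal\<close> valued functions alike. All integer translates are built in, so that
  reduction by \<open>frac_vec\<close> is one instance.\<close>

definition periodic :: "(real^'d \<Rightarrow> 'b) \<Rightarrow> bool" where
  "periodic g \<longleftrightarrow> (\<forall>x z. g (x + zvec z) = g x)"

lemma zvec_nth [simp]: "zvec z $ i = of_int (z $ i)"
  by (simp add: zvec_def)

lemma frac_vec_nth [simp]: "frac_vec x $ i = frac (x $ i)"
  by (simp add: frac_vec_def)

lemma frac_vec_in_cube: "frac_vec x \<in> cbox 0 1"
  by (auto simp: mem_box_cart frac_lt_1[THEN less_imp_le])

lemma frac_vec_eq: "frac_vec x = x + zvec (\<chi> i. - \<lfloor>x $ i\<rfloor>)"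
  by (simp add: vec_eq_iff frac_def)

lemma periodic_frac_vec: "periodic g \<Longrightarrow> g (frac_vec x) = g x"
  by (simp add: frac_vec_eq periodic_def)

lemma periodic_frac_vec_comp: "periodic (\<lambda>x. g (frac_vec x))"
  by (simp add: periodic_def frac_vec_def frac_add_int_right)

lemma borel_measurable_vecI:
  fixes f :: "'a \<Rightarrow> real^'n::finite"
  assumes "\<And>i. (\<lambda>x. f x $ i) \<in> borel_measurable M"
  shows "f \<in> borel_measurable M"
  using assms by (intro borel_measurable_euclidean_space[THEN iffD2])
    (auto simp: Basis_vec_def inner_axis)

lemma borel_measurable_frac_vec [measurable]: "(frac_vec :: real^'d \<Rightarrow> real^'d) \<in> borel_measurable borel"
proof (rule borel_measurable_vecI)
  fix i :: 'd
  have "(\<lambda>x::real^'d. x $ i - real_of_int \<lfloor>x $ i\<rfloor>) \<in> borel_measurable borel"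
    by measurable
  then show "(\<lambda>x::real^'d. frac_vec x $ i) \<in> borel_measurable borel"
    by (simp add: frac_def)
qed

lemma one_periodic_imp_periodic:
  fixes f :: "real^'d \<Rightarrow> real"
  assumes "one_periodic f"
  shows "periodic f"
proof -
  have 1: "f (x + axis i 1) = f x" for x i
    using assms by (simp add: one_periodic_def)
  have 2: "f (x + of_int k *\<^sub>R axis i 1) = f x" for x i k
  proof (induction k rule: int_induct[of _ 0])
    case base show ?case by simp
  next
    case (step1 k)
    then show ?case using 1[of "x + of_int k *\<^sub>R axis i 1" i] by (simp add: algebra_simps)
  next
    case (step2 k)
    then show ?case using 1[of "x + of_int (k - 1) *\<^sub>R axis i 1" i] by (simp add: algebra_simps)
  qed
  have 3: "f (x + (\<Sum>i\<in>S. of_int (z $ i) *\<^sub>R axis i 1)) = f x" if "finite S" for x z S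
    using that
  proof (induction S arbitrary: x)
    case (insert i S)
    then show ?case using 2[of x "z $ i" i] by (simp add: add.assoc[symmetric])
  qed simp
  have "zvec z = (\<Sum>i\<in>UNIV. of_int (z $ i) *\<^sub>R axis i 1)" for z :: "int^'d"
    by (simp add: vec_eq_iff axis_def if_distrib cong: if_cong)
  then show ?thesis by (simp add: periodic_def 3)
qed

text \<open>\<open>g\<close> equals \<open>g\<close> composed with \<open>frac_vec\<close>, and
  \<open>frac_vec\<close> is measurable into the cube. Measurability on the cube thereby spreads to
  the whole space, as a convolution kernel \<open>a (x - y)\<close> requires.\<close>

lemma borel_measurable_periodic:
  fixes g :: "real^'d \<Rightarrow> real"
  assumes "periodic g" "g \<in> borel_measurable cube"
  shows "g \<in> borel_measurable borel"
proof -
  have *: "frac_vec \<in> measurable borel (cube :: (real^'d) measure)"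
    using frac_vec_in_cube
    by (subst measurable_cong_sets[OF refl sets_cube]) (auto intro!: measurable_restrict_space2)
  show ?thesis
    using measurable_compose[OF * assms(2)] by (simp add: periodic_frac_vec[OF assms(1)])
qed

text \<open>Half-open, so that its integer translates tile space without overlaps; it differs from
  the cube by a null set.\<close>

definition unit_box :: "(real^'d) set" where
  "unit_box = {x. \<forall>i. 0 \<le> x $ i \<and> x $ i < 1}"

lemma unit_box_borel [measurable]: "unit_box \<in> sets borel"
  unfolding unit_box_def by measurable

text \<open>Rounding down determines the one integer vector that counts. As an integral over
  counting measure, this partition of unity can be inserted and exchanged by Tonelli; the sign
  \<open>c\<close> is there because the box also occurs reflected.\<close>

lemma nn_integral_unit_box_translates:
  fixes w :: "real^'d"
  assumes "c = 1 \<or> c = -1"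
  shows "(\<integral>\<^sup>+z. indicator unit_box (w + c *\<^sub>R zvec z) \<partial>count_space UNIV) = 1"
proof -
  define z0 where "z0 = (\<chi> i. - (of_int (if c = 1 then 1 else - 1) * \<lfloor>w $ i\<rfloor>))"
  have "w + c *\<^sub>R zvec z \<in> unit_box \<longleftrightarrow> z = z0" for z
  proof -
    have "0 \<le> w $ i + c * of_int (z $ i) \<and> w $ i + c * of_int (z $ i) < 1 \<longleftrightarrow> z $ i = z0 $ i" for i
    proof (cases "c = 1")
      case True
      have "0 \<le> w $ i + of_int (z $ i) \<and> w $ i + of_int (z $ i) < 1 \<longleftrightarrow> \<lfloor>w $ i\<rfloor> = - (z $ i)"
        by (subst floor_eq_iff) auto
      then show ?thesis using True by (auto simp: z0_def)
    next
      case False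
      then have "c = -1" using assms by simp
      moreover have "0 \<le> w $ i - of_int (z $ i) \<and> w $ i - of_int (z $ i) < 1 \<longleftrightarrow> \<lfloor>w $ i\<rfloor> = z $ i"
        by (subst floor_eq_iff) auto
      ultimately show ?thesis by (auto simp: z0_def)
    qed
    then show ?thesis by (simp add: unit_box_def vec_eq_iff)
  qed
  then have "(\<lambda>z. indicator unit_box (w + c *\<^sub>R zvec z)) = (indicator {z0} :: int^'d \<Rightarrow> ennreal)"
    by (auto simp: fun_eq_iff split: split_indicator)
  then show ?thesis
    by (simp add: nn_integral_indicator)
qed

lemma distr_lborel_affine:
  fixes t :: "real^'d"
  assumes "c = 1 \<or> c = -1"
  shows "distr lborel borel (\<lambda>x. t + c *\<^sub>R x) = lborel"
  using lborel_affine[of c t] assms by (auto simp: density_1)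

lemma nn_integral_lborel_affine:
  fixes g :: "real^'d \<Rightarrow> ennreal"
  assumes "c = 1 \<or> c = -1" and [measurable]: "g \<in> borel_measurable borel"
  shows "(\<integral>\<^sup>+x. g (t + c *\<^sub>R x) \<partial>lborel) = (\<integral>\<^sup>+x. g x \<partial>lborel)"
proof -
  have "(\<integral>\<^sup>+x. g (t + c *\<^sub>R x) \<partial>lborel) = (\<integral>\<^sup>+x. g x \<partial>distr lborel borel (\<lambda>x. t + c *\<^sub>R x))"
    by (subst nn_integral_distr) auto
  then show ?thesis by (simp add: distr_lborel_affine[OF assms(1)])
qed

text \<open>Both sides are compared by cutting space into the integer translates of the unit box.\<close>

lemma nn_integral_unit_box_periodic:
  fixes g :: "real^'d \<Rightarrow> ennreal"
  assumes c: "c = 1 \<or> c = -1" and [measurable]: "g \<in> borel_measurable borel" and per: "periodic g"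
  shows "(\<integral>\<^sup>+x. indicator unit_box x * g (t + c *\<^sub>R x) \<partial>lborel) = (\<integral>\<^sup>+x. indicator unit_box x * g x \<partial>lborel)"
proof -
  have c': "- c = 1 \<or> - c = -1" using c by auto
  have cc: "c *\<^sub>R (c *\<^sub>R x) = x" for x :: "real^'d" using c by auto
  have "(\<integral>\<^sup>+x. indicator unit_box x * g (t + c *\<^sub>R x) \<partial>lborel)
    = (\<integral>\<^sup>+x. (\<lambda>y. indicator unit_box (c *\<^sub>R (y - t)) * g y) (t + c *\<^sub>R x) \<partial>lborel)"
    by (simp only: add_diff_cancel_left' cc)
  also have "\<dots> = (\<integral>\<^sup>+y. indicator unit_box (c *\<^sub>R (y - t)) * g y \<partial>lborel)"
    by (rule nn_integral_lborel_affine[OF c]) measurable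
  also have "\<dots> = (\<integral>\<^sup>+y. (\<integral>\<^sup>+z. indicator unit_box (y + 1 *\<^sub>R zvec z) *
      (indicator unit_box (c *\<^sub>R (y - t)) * g y) \<partial>count_space UNIV) \<partial>lborel)"
    by (subst nn_integral_multc) (simp_all add: nn_integral_unit_box_translates[of 1, simplified])
  also have "\<dots> = (\<integral>\<^sup>+z. (\<integral>\<^sup>+y. indicator unit_box (y + zvec z) *
      (indicator unit_box (c *\<^sub>R (y - t)) * g y) \<partial>lborel) \<partial>count_space UNIV)"
    by (subst nn_integral_count_space_nn_integral) auto
  also have "\<dots> = (\<integral>\<^sup>+z. (\<integral>\<^sup>+y. indicator unit_box y *
      (indicator unit_box (c *\<^sub>R (y - zvec z - t)) * g y) \<partial>lborel) \<partial>count_space UNIV)"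
  proof (rule nn_integral_cong)
    fix z :: "int^'d"
    have g: "g (y - zvec z) = g y" for y
      using per[unfolded periodic_def, rule_format, of "y - zvec z" z] by simp
    show "(\<integral>\<^sup>+y. indicator unit_box (y + zvec z) * (indicator unit_box (c *\<^sub>R (y - t)) * g y) \<partial>lborel)
      = (\<integral>\<^sup>+y. indicator unit_box y * (indicator unit_box (c *\<^sub>R (y - zvec z - t)) * g y) \<partial>lborel)"
      using nn_integral_lborel_affine[of 1 "\<lambda>y. indicator unit_box y *
        (indicator unit_box (c *\<^sub>R (y - zvec z - t)) * g (y - zvec z))" "zvec z"]
      by (simp add: algebra_simps g[unfolded diff_conv_add_uminus] g)
  qed
  \<comment> \<open>The box around \<open>y\<close> no longer depends on \<open>z\<close>, so the
    sum now runs over translates of the other box. They enter with \<open>- c\<close> times an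
    integer vector, hence \<open>c'\<close>.\<close>
  also have "\<dots> = (\<integral>\<^sup>+y. (\<integral>\<^sup>+z. indicator unit_box (c *\<^sub>R (y - t) + (-c) *\<^sub>R zvec z) *
      (indicator unit_box y * g y) \<partial>count_space UNIV) \<partial>lborel)"
    by (subst nn_integral_count_space_nn_integral)
      (auto simp: algebra_simps intro!: nn_integral_cong)
  also have "\<dots> = (\<integral>\<^sup>+x. indicator unit_box x * g x \<partial>lborel)"
    by (subst nn_integral_multc) (simp_all only: nn_integral_unit_box_translates[OF c'] mult_1, simp)
  finally show ?thesis .
qed

lemma AE_lborel_cbox_box: "AE x in lborel. x \<in> cbox a (b::real^'d) \<longrightarrow> x \<in> box a b"
proof -
  show ?thesis
    by (rule AE_I'[OF null_sets_cbox_Diff_box[of a b]]) auto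
qed

lemma AE_lborel_unit_box: "AE x in lborel. x \<in> cbox 0 (1::real^'d) \<longleftrightarrow> x \<in> unit_box"
proof -
  have "box 0 (1::real^'d) \<subseteq> unit_box" "unit_box \<subseteq> cbox 0 (1::real^'d)"
    by (simp_all add: unit_box_def mem_box_cart less_imp_le subset_iff)
  then show ?thesis
    using AE_lborel_cbox_box[of 0 "1::real^'d"] by (auto elim!: eventually_mono)
qed

lemma AE_cube_box: "AE x in cube. x \<in> box 0 (1::real^'d)"
proof -
  have "cbox 0 (1::real^'d) \<inter> space lborel \<in> sets lborel" by simp
  from AE_restrict_space_iff[OF this] show ?thesis
    using AE_lborel_cbox_box[of 0 "1::real^'d"] unfolding cube_def by simp
qed

lemma nn_integral_cube:
  fixes g :: "real^'d \<Rightarrow> ennreal"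
  assumes [measurable]: "g \<in> borel_measurable borel"
  shows "(\<integral>\<^sup>+x. g x \<partial>cube) = (\<integral>\<^sup>+x. indicator unit_box x * g x \<partial>lborel)"
proof -
  have "(\<integral>\<^sup>+x. g x \<partial>cube) = (\<integral>\<^sup>+x. g x * indicator (cbox 0 1) x \<partial>lborel)"
    by (simp add: cube_def nn_integral_restrict_space)
  also have "\<dots> = (\<integral>\<^sup>+x. indicator unit_box x * g x \<partial>lborel)"
    using AE_lborel_unit_box by (intro nn_integral_cong_AE) (auto split: split_indicator)
  finally show ?thesis .
qed

text \<open>Invariance is phrased for image measures under \<open>frac_vec\<close>, where it is
  proved once from indicators; integrals and integrability of vector-valued functions then follow by
  transport.\<close>

lemma distr_frac_vec_affine:
  fixes t :: "real^'d"
  assumes "c = 1 \<or> c = -1"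
  shows "distr cube borel (\<lambda>x. frac_vec (t + c *\<^sub>R x)) = distr cube borel frac_vec"
proof (rule measure_eqI)
  fix A assume "A \<in> sets (distr cube borel (\<lambda>x. frac_vec (t + c *\<^sub>R x)))"
  then have [measurable]: "A \<in> sets borel" by simp
  have "emeasure (distr cube borel (\<lambda>x. frac_vec (t + c *\<^sub>R x))) A
    = (\<integral>\<^sup>+x. indicator A x \<partial>distr cube borel (\<lambda>x. frac_vec (t + c *\<^sub>R x)))"
    by simp
  also have "\<dots> = (\<integral>\<^sup>+x. indicator A (frac_vec (t + c *\<^sub>R x)) \<partial>cube)"
    by (subst nn_integral_distr) auto
  also have "\<dots> = (\<integral>\<^sup>+x. indicator A (frac_vec x) \<partial>cube)"
    using nn_integral_unit_box_periodic[OF assms, of "\<lambda>x. indicator A (frac_vec x)" t]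
    by (simp add: nn_integral_cube periodic_frac_vec_comp)
  also have "\<dots> = (\<integral>\<^sup>+x. indicator A x \<partial>distr cube borel frac_vec)"
    by (subst nn_integral_distr) auto
  also have "\<dots> = emeasure (distr cube borel frac_vec) A"
    by simp
  finally show "emeasure (distr cube borel (\<lambda>x. frac_vec (t + c *\<^sub>R x))) A
    = emeasure (distr cube borel frac_vec) A" .
qed simp

text \<open>A periodic \<open>g\<close> is unchanged by \<open>frac_vec\<close>, so both sides are
  integrals against the same image measure. With \<open>c = -1\<close> this is the substitution of
  \<open>x - y\<close> for \<open>y\<close> in convolutions.\<close>

lemma
  fixes g :: "real^'d \<Rightarrow> 'b::{banach, second_countable_topology}"
  assumes c: "c = 1 \<or> c = -1" and [measurable]: "g \<in> borel_measurable borel" and per: "periodic g"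
  shows integral_periodic_affine: "(LINT x|cube. g (t + c *\<^sub>R x)) = (LINT x|cube. g x)"
    and integrable_periodic_affine: "integrable cube (\<lambda>x. g (t + c *\<^sub>R x)) \<longleftrightarrow> integrable cube g"
proof -
  have "(LINT x|cube. g (t + c *\<^sub>R x)) = (LINT x|distr cube borel (\<lambda>x. frac_vec (t + c *\<^sub>R x)). g x)"
    by (subst integral_distr) (auto simp: periodic_frac_vec[OF per])
  also have "\<dots> = (LINT x|cube. g x)"
    unfolding distr_frac_vec_affine[OF c]
    by (subst integral_distr) (auto simp: periodic_frac_vec[OF per])
  finally show "(LINT x|cube. g (t + c *\<^sub>R x)) = (LINT x|cube. g x)" .
  have "integrable cube (\<lambda>x. g (t + c *\<^sub>R x)) \<longleftrightarrow>
      integrable (distr cube borel (\<lambda>x. frac_vec (t + c *\<^sub>R x))) g"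
    by (subst integrable_distr_eq) (auto simp: periodic_frac_vec[OF per])
  also have "\<dots> \<longleftrightarrow> integrable cube g"
    unfolding distr_frac_vec_affine[OF c]
    by (subst integrable_distr_eq) (auto simp: periodic_frac_vec[OF per])
  finally show "integrable cube (\<lambda>x. g (t + c *\<^sub>R x)) \<longleftrightarrow> integrable cube g" .
qed

section \<open>Fourier coefficients\<close>

definition expo :: "int^'d \<Rightarrow> real^'d \<Rightarrow> complex" where
  "expo m x = cis (2 * pi * (\<Sum>i\<in>UNIV. of_int (m $ i) * x $ i))"

definition fcoef :: "(real^'d \<Rightarrow> real) \<Rightarrow> int^'d \<Rightarrow> complex" where
  "fcoef f m = (LINT x|cube. complex_of_real (f x) * cnj (expo m x))"

lemma expo_0 [simp]: "expo 0 x = 1"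
  by (simp add: expo_def)

lemma norm_expo [simp]: "norm (expo m x) = 1"
  by (simp add: expo_def)

lemma expo_uminus: "expo (- m) x = cnj (expo m x)"
  by (simp add: expo_def cis_cnj sum_negf)

lemma expo_add: "expo (m + k) x = expo m x * expo k x"
  by (simp add: expo_def cis_mult distrib_right sum.distrib distrib_left)

lemma expo_diff: "expo (m - k) x = expo m x * cnj (expo k x)"
  using expo_add[of m "- k" x] by (simp add: expo_uminus)

lemma expo_add_arg: "expo m (x + y) = expo m x * expo m y"
  by (simp add: expo_def cis_mult distrib_left sum.distrib)

lemma expo_uminus_arg: "expo m (- x) = cnj (expo m x)"
  by (simp add: expo_def cis_cnj sum_negf)

lemma expo_diff_arg: "expo m (x - y) = expo m x * cnj (expo m y)"
  using expo_add_arg[of m x "- y"] by (simp add: expo_uminus_arg)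

lemma expo_cnj_mult [simp]: "expo m x * cnj (expo m x) = 1" "cnj (expo m x) * expo m x = 1"
  by (simp_all add: complex_norm_square[symmetric] mult.commute)

lemma expo_zvec: "expo m (zvec z) = 1"
proof -
  have "(\<Sum>i\<in>UNIV. of_int (m $ i) * real_of_int (z $ i)) \<in> \<int>"
    by (intro Ints_sum Ints_mult) auto
  then show ?thesis by (simp add: expo_def)
qed

lemma periodic_expo: "periodic (expo m)"
  by (simp add: periodic_def expo_add_arg expo_zvec)

lemma continuous_on_expo: "continuous_on S (expo m)"
  unfolding expo_def cis_conv_exp by (intro continuous_intros)

lemma borel_measurable_expo [measurable]: "expo m \<in> borel_measurable borel"
  by (intro borel_measurable_continuous_onI continuous_on_expo)

lemma integrable_cube_bounded:
  fixes g :: "real^'d \<Rightarrow> complex"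
  assumes "g \<in> borel_measurable cube" "\<And>x. norm (g x) \<le> B"
  shows "integrable cube g"
  using assms by (intro cube.integrable_const_bound[where B=B]) auto

lemma integrable_expo: "integrable cube (expo m)"
  by (rule integrable_cube_bounded[where B=1]) auto

text \<open>Translation by a vector at which the character takes the value -1 reverses the sign of
  the integral, yet by periodicity it leaves the integral unchanged.\<close>

lemma integral_expo: "(LINT x|cube. expo m x) = (if m = 0 then 1 else 0)"
proof (cases "m = 0")
  case True
  then show ?thesis by (simp add: cube.prob_space[unfolded space_cube])
next
  case False
  then obtain i where i: "m $ i \<noteq> 0" by (auto simp: vec_eq_iff)
  define t :: "real^'a" where "t = axis i (1 / (2 * of_int (m $ i)))"
  have t2: "(\<Sum>k\<in>UNIV. of_int (m $ k) * t $ k) = 1 / 2"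
    using i by (simp add: t_def axis_def if_distrib cong: if_cong)
  then have t: "expo m t = -1" unfolding expo_def t2 by simp
  have "(LINT x|cube. expo m x) = (LINT x|cube. expo m (t + 1 *\<^sub>R x))"
    by (subst integral_periodic_affine) (auto simp: periodic_expo)
  also have "\<dots> = - (LINT x|cube. expo m x)"
    by (simp add: expo_add_arg t)
  finally show ?thesis using False by simp
qed

lemma sq_int_Re_expo: "(\<lambda>x. Re (z * expo m x)) \<in> sq_int"
proof (rule sq_int_bounded)
  show "\<bar>Re (z * expo m x)\<bar> \<le> norm z" for x
    using abs_Re_le_cmod[of "z * expo m x"] by (simp add: norm_mult)
qed measurable

lemma integrable_sq_int_expo:
  assumes "f \<in> sq_int"
  shows "integrable cube (\<lambda>x. complex_of_real (f x) * expo m x)"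
    "integrable cube (\<lambda>x. complex_of_real (f x) * cnj (expo m x))"
proof -
  note [measurable] = sq_int_measurable[OF assms]
  show "integrable cube (\<lambda>x. complex_of_real (f x) * expo m x)"
    by (rule Bochner_Integration.integrable_bound[OF sq_int_integrable[OF assms]]) (auto simp: norm_mult)
  show "integrable cube (\<lambda>x. complex_of_real (f x) * cnj (expo m x))"
    unfolding expo_uminus[symmetric]
    by (rule Bochner_Integration.integrable_bound[OF sq_int_integrable[OF assms]]) (auto simp: norm_mult)
qed

lemma integral_expo_eq_cnj_fcoef:
  "(LINT x|cube. complex_of_real (f x) * expo m x) = cnj (fcoef f m)"
  using Bochner_Integration.integral_cnj[of cube "\<lambda>x. complex_of_real (f x) * cnj (expo m x)"]
  by (simp add: fcoef_def)

lemma fcoef_uminus: "fcoef f (- m) = cnj (fcoef f m)"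
  by (simp add: fcoef_def expo_uminus integral_expo_eq_cnj_fcoef[unfolded fcoef_def])

lemma l2_inner_Re_expo:
  assumes "f \<in> sq_int"
  shows "l2_inner f (\<lambda>x. Re (z * expo m x)) = Re (z * cnj (fcoef f m))"
proof -
  have "l2_inner f (\<lambda>x. Re (z * expo m x)) = (LINT x|cube. Re (z * (complex_of_real (f x) * expo m x)))"
    unfolding l2_inner_def by (intro Bochner_Integration.integral_cong) (auto simp: algebra_simps)
  also have "\<dots> = Re (LINT x|cube. z * (complex_of_real (f x) * expo m x))"
    using assms by (intro integral_Re) (auto intro: integrable_sq_int_expo)
  finally show ?thesis by (simp add: integral_expo_eq_cnj_fcoef)
qed

lemma fcoef_diff:
  "f \<in> sq_int \<Longrightarrow> g \<in> sq_int \<Longrightarrow> fcoef (\<lambda>x. f x - g x) m = fcoef f m - fcoef g m"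
  by (simp add: fcoef_def left_diff_distrib integrable_sq_int_expo)

lemma fcoef_sum:
  "(\<And>i. i \<in> I \<Longrightarrow> f i \<in> sq_int) \<Longrightarrow> fcoef (\<lambda>x. \<Sum>i\<in>I. f i x) m = (\<Sum>i\<in>I. fcoef (f i) m)"
  by (simp add: fcoef_def sum_distrib_right integrable_sq_int_expo)

text \<open>The real part is half the sum of a character and its conjugate. For \<open>k = 0\<close>
  both conditions hold at \<open>m = 0\<close>, and the two halves add up to
  \<open>Re z\<close>.\<close>

lemma fcoef_Re_expo:
  "fcoef (\<lambda>x. Re (z * expo k x)) m
    = (if m = k then z / 2 else 0) + (if m = - k then cnj z / 2 else 0)"
proof -
  have eq: "complex_of_real (Re (z * expo k x)) * cnj (expo m x)
    = z / 2 * expo (k - m) x + cnj z / 2 * expo (- k - m) x" for x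
    by (simp add: complex_eq_iff expo_diff expo_uminus field_simps)
  have "fcoef (\<lambda>x. Re (z * expo k x)) m
    = z / 2 * (LINT x|cube. expo (k - m) x) + cnj z / 2 * (LINT x|cube. expo (- k - m) x)"
    unfolding fcoef_def eq by (simp add: integrable_expo)
  moreover have "k - m = 0 \<longleftrightarrow> m = k" "- k - m = 0 \<longleftrightarrow> m = - k"
    by (auto simp: algebra_simps)
  ultimately show ?thesis
    by (simp only: integral_expo) simp
qed

section \<open>Completeness of the complex exponentials\<close>

inductive trig_poly :: "(real^'d \<Rightarrow> real) \<Rightarrow> bool" where
  base: "trig_poly (\<lambda>x. Re (z * expo m x))"
| add: "trig_poly f \<Longrightarrow> trig_poly g \<Longrightarrow> trig_poly (\<lambda>x. f x + g x)"

lemma trig_poly_const: "trig_poly (\<lambda>_. c)"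
  using trig_poly.base[of "of_real c" 0] by simp

lemma trig_poly_cmult: "trig_poly f \<Longrightarrow> trig_poly (\<lambda>x. c * f x)"
proof (induction rule: trig_poly.induct)
  case (base z m)
  then show ?case using trig_poly.base[of "of_real c * z" m] by (simp add: mult.assoc)
next
  case (add f g)
  then show ?case using trig_poly.add[OF add.IH] by (simp add: distrib_left)
qed

lemma trig_poly_sum: "(\<And>i. i \<in> I \<Longrightarrow> trig_poly (f i)) \<Longrightarrow> trig_poly (\<lambda>x. \<Sum>i\<in>I. f i x)"
  by (induction I rule: infinite_finite_induct) (auto intro: trig_poly_const trig_poly.add)

lemma trig_poly_mult: "trig_poly f \<Longrightarrow> trig_poly g \<Longrightarrow> trig_poly (\<lambda>x. f x * g x)"
proof (induction rule: trig_poly.induct)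
  case (base z m)
  show ?case
    using base.prems
  proof (induction rule: trig_poly.induct)
    case (base w k)
    have "Re (z * expo m x) * Re (w * expo k x)
      = Re (z * w / 2 * expo (m + k) x) + Re (z * cnj w / 2 * expo (m - k) x)" for x
      by (simp add: expo_add expo_diff field_simps)
    then show ?case by (simp only:) (intro trig_poly.intros)
  next
    case (add f g)
    then show ?case using trig_poly.add[OF add.IH] by (simp add: distrib_left)
  qed
next
  case (add f g)
  then show ?case using trig_poly.add[OF add.IH] by (simp add: distrib_right)
qed

lemma trig_poly_sq_int: "trig_poly f \<Longrightarrow> f \<in> sq_int"
  by (induction rule: trig_poly.induct) (intro sq_int_Re_expo sq_int_add | assumption)+

lemma l2_inner_trig_poly_eq_0:
  assumes "trig_poly p" "f \<in> sq_int" "\<And>m. fcoef f m = 0"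
  shows "l2_inner f p = 0"
  using assms(1)
proof (induction rule: trig_poly.induct)
  case (base z m)
  show ?case unfolding l2_inner_Re_expo[OF assms(2)] by (simp add: assms(3))
next
  case (add g h)
  then show ?case using assms(2)
    by (simp add: l2_inner_commute[of f] l2_inner_add_left trig_poly_sq_int)
qed

text \<open>Embeds the torus: opposite faces of the cube are glued, the image is compact, and
  polynomials in its real coordinates pull back to trigonometric polynomials.\<close>

definition torus_map :: "real^'d \<Rightarrow> complex^'d" where
  "torus_map x = (\<chi> i. cis (2 * pi * x $ i))"

lemma continuous_on_torus_map: "continuous_on S torus_map"
  unfolding torus_map_def cis_conv_exp by (intro continuous_intros)

lemma expo_axis: "expo (axis i 1) x = cis (2 * pi * x $ i)"
proof -
  have "(\<Sum>k\<in>UNIV. of_int ((axis i 1 :: int^'a) $ k) * x $ k) = (\<Sum>k\<in>UNIV. if k = i then x $ k else 0)"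
    by (intro sum.cong) (auto simp: axis_def)
  then show ?thesis by (simp add: expo_def)
qed

lemma trig_poly_comp_torus_map:
  "real_polynomial_function p \<Longrightarrow> trig_poly (\<lambda>x. p (torus_map x))"
proof (induction rule: real_polynomial_function.induct)
  case (linear p)
  interpret bounded_linear p by fact
  have *: "p (torus_map x) = (\<Sum>b\<in>Basis. p b * (torus_map x \<bullet> b))" for x
    by (subst euclidean_representation[of "torus_map x", symmetric])
      (simp add: sum scaleR mult.commute del: euclidean_representation)
  have "trig_poly (\<lambda>x. torus_map x \<bullet> b)" if "b \<in> Basis" for b
  proof -
    from that obtain i u where b: "b = axis i u" and u: "u = 1 \<or> u = \<i>"
      by (auto simp: Basis_vec_def Basis_complex_def)
    have "torus_map x \<bullet> b = Re (cnj u * expo (axis i 1) x)" for x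
      using u by (auto simp: b inner_axis torus_map_def expo_axis inner_complex_def)
    then show ?thesis by (simp only:) (rule trig_poly.base)
  qed
  then show ?case unfolding * by (intro trig_poly_sum trig_poly_cmult)
qed (auto intro: trig_poly_const trig_poly.add trig_poly_mult)

text \<open>Glued points differ by a nonzero integer in some coordinate, while there an interior
  point is less than 1 away from every point of the cube.\<close>

lemma torus_map_eq_imp_boundary:
  assumes "torus_map x = torus_map y" "x \<in> cbox 0 1" "y \<in> cbox 0 1" "x \<noteq> y"
  shows "x \<notin> box 0 1"
proof -
  from \<open>x \<noteq> y\<close> obtain i where i: "x $ i \<noteq> y $ i" by (auto simp: vec_eq_iff)
  have "cis (2 * pi * x $ i) = cis (2 * pi * y $ i)"
    using assms(1) by (simp add: torus_map_def vec_eq_iff)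
  then have "cis (2 * pi * x $ i) * cis (- (2 * pi * y $ i)) = 1"
    by (simp add: cis_mult)
  then have "cis (2 * pi * x $ i - 2 * pi * y $ i) = 1"
    by (simp add: cis_mult)
  then have "cos (2 * pi * x $ i - 2 * pi * y $ i) = 1"
    by (simp add: complex_eq_iff)
  then obtain n :: int where n: "2 * pi * x $ i - 2 * pi * y $ i = of_int n * 2 * pi"
    by (auto simp: cos_one_2pi_int)
  then have "2 * pi * (x $ i - y $ i) = 2 * pi * of_int n"
    by (simp add: algebra_simps)
  then have n': "x $ i - y $ i = of_int n" by simp
  have b: "0 \<le> x $ i" "x $ i \<le> 1" "0 \<le> y $ i" "y $ i \<le> 1"
    using assms by (auto simp: mem_box_cart)
  show ?thesis
  proof
    assume "x \<in> box 0 1"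
    then have "0 < x $ i" "x $ i < 1" by (auto simp: mem_box_cart)
    with n' b have "real_of_int n < 1" "real_of_int n > - 1" by linarith+
    then have "n = 0" by linarith
    with n' i show False by simp
  qed
qed

text \<open>A function that vanishes on the boundary of the cube factors through the torus, where the
  Stone-Weierstrass theorem applies: unlike on the cube, the exponentials separate points there.\<close>

lemma uniform_trig_poly_approx:
  fixes F :: "real^'d \<Rightarrow> real"
  assumes F: "continuous_on UNIV F" and zero: "\<And>x. x \<notin> box 0 1 \<Longrightarrow> F x = 0" and "e > 0"
  obtains p where "trig_poly p" "\<And>x. x \<in> cbox 0 1 \<Longrightarrow> \<bar>F x - p x\<bar> < e"
proof -
  define S where "S = torus_map ` cbox 0 (1::real^'d)"
  define G where "G w = F (SOME x. x \<in> cbox 0 1 \<and> torus_map x = w)" for w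
  have S: "compact S"
    unfolding S_def by (intro compact_continuous_image continuous_on_torus_map compact_cbox)
  have G: "G (torus_map x) = F x" if "x \<in> cbox 0 1" for x
  proof -
    define y where "y = (SOME y. y \<in> cbox 0 1 \<and> torus_map y = torus_map x)"
    have y: "y \<in> cbox 0 1 \<and> torus_map y = torus_map x"
      unfolding y_def by (rule someI[of _ x]) (use that in auto)
    have "F y = F x"
    proof (cases "y = x")
      case False
      then show ?thesis
        using torus_map_eq_imp_boundary[of x y] torus_map_eq_imp_boundary[of y x] y that zero by metis
    qed simp
    then show ?thesis by (simp add: G_def y_def)
  qed
  \<comment> \<open>\<open>torus_map\<close> is a quotient map on the compact cube: the preimage of
    a closed set under \<open>G\<close> is the image of a compact set, hence closed.\<close>
  have "continuous_on S G"
    unfolding continuous_closedin_preimage_eq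
  proof (intro allI impI)
    fix T :: "real set" assume "closed T"
    have eq: "S \<inter> G -` T = torus_map ` (cbox 0 1 \<inter> F -` T)"
      unfolding S_def using G by auto
    have "closed (F -` T)"
      using F \<open>closed T\<close> by (simp add: continuous_on_closed_vimage)
    then have "compact (cbox 0 1 \<inter> F -` T)"
      by (intro compact_Int_closed compact_cbox)
    then have "closed (S \<inter> G -` T)"
      unfolding eq by (intro compact_imp_closed compact_continuous_image continuous_on_torus_map)
    then show "closedin (top_of_set S) (S \<inter> G -` T)"
      by (rule closed_subset[rotated]) auto
  qed
  then obtain p where p: "real_polynomial_function p" "\<And>w. w \<in> S \<Longrightarrow> \<bar>G w - p w\<bar> < e"
    using Stone_Weierstrass_real_polynomial_function[OF S _ \<open>e > 0\<close>] by blast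
  show ?thesis
  proof
    show "trig_poly (\<lambda>x. p (torus_map x))" by (rule trig_poly_comp_torus_map) fact
    show "\<bar>F x - p (torus_map x)\<bar> < e" if "x \<in> cbox 0 1" for x
      using p(2)[of "torus_map x"] that G[OF that] by (simp add: S_def)
  qed
qed

lemma integral_continuous_eq_0:
  fixes F :: "real^'d \<Rightarrow> real"
  assumes f: "f \<in> sq_int" "\<And>m. fcoef f m = 0"
    and F: "continuous_on UNIV F" and zero: "\<And>x. x \<notin> box 0 1 \<Longrightarrow> F x = 0"
    and FB: "\<And>x. \<bar>F x\<bar> \<le> B"
  shows "(LINT x|cube. f x * F x) = 0"
proof -
  have [measurable]: "F \<in> borel_measurable borel"
    by (intro borel_measurable_continuous_onI F)
  have Fs: "F \<in> sq_int" by (rule sq_int_bounded[OF _ FB]) measurable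
  have *: "\<bar>LINT x|cube. f x * F x\<bar> \<le> e * (LINT x|cube. \<bar>f x\<bar>)" if e: "e > 0" for e
  proof -
    obtain p where p: "trig_poly p" "\<And>x. x \<in> cbox 0 1 \<Longrightarrow> \<bar>F x - p x\<bar> < e"
      using uniform_trig_poly_approx[of F e] F zero e by blast
    have ps: "p \<in> sq_int" using p(1) by (rule trig_poly_sq_int)
    have "(LINT x|cube. f x * F x) = (LINT x|cube. f x * F x) - (LINT x|cube. f x * p x)"
      using l2_inner_trig_poly_eq_0[OF p(1) f] by (simp add: l2_inner_def)
    also have "\<dots> = (LINT x|cube. f x * (F x - p x))"
      using f Fs ps by (simp add: right_diff_distrib sq_int_integrable_mult)
    also have "\<bar>\<dots>\<bar> \<le> (LINT x|cube. \<bar>f x * (F x - p x)\<bar>)"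
      by (rule integral_abs_bound)
    also have "\<dots> \<le> (LINT x|cube. e * \<bar>f x\<bar>)"
    proof (rule integral_mono)
      show "integrable cube (\<lambda>x. \<bar>f x * (F x - p x)\<bar>)"
        using f(1) Fs ps by (intro integrable_abs sq_int_integrable_mult sq_int_diff)
      show "integrable cube (\<lambda>x. e * \<bar>f x\<bar>)"
        using f by (simp add: sq_int_integrable)
      fix x assume "x \<in> space (cube :: (real^'d) measure)"
      then show "\<bar>f x * (F x - p x)\<bar> \<le> e * \<bar>f x\<bar>"
        using p(2)[of x] by (simp add: abs_mult mult.commute[of e] mult_left_mono less_imp_le)
    qed
    finally show ?thesis by simp
  qed
  have "\<bar>LINT x|cube. f x * F x\<bar> \<le> 0 + e" if "e > 0" for e
  proof -
    define I where "I = (LINT x|cube. \<bar>f x\<bar>)"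
    have I: "I \<ge> 0" unfolding I_def by simp
    have "\<bar>LINT x|cube. f x * F x\<bar> \<le> e / (I + 1) * I"
      using *[of "e / (I + 1)"] I that by (simp flip: I_def)
    also have "\<dots> \<le> e" using I that by (simp add: field_simps)
    finally show ?thesis by simp
  qed
  then have "\<bar>LINT x|cube. f x * F x\<bar> \<le> 0" by (rule field_le_epsilon)
  then show ?thesis by simp
qed

text \<open>Truncated multiples of the distance to the complement increase to the indicator of an
  open set. Cutting \<open>V\<close> down to the open box costs a null set and makes these functions
  vanish on the boundary, as the approximation demands; dominated convergence does the rest.\<close>

lemma integral_open_eq_0:
  fixes V :: "(real^'d) set"
  assumes f: "f \<in> sq_int" "\<And>m. fcoef f m = 0" and "open V"
  shows "(LINT x|cube. indicator V x * f x) = 0"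
proof -
  define U where "U = V \<inter> box 0 1"
  have U: "open U" unfolding U_def using \<open>open V\<close> by (intro open_Int open_box)
  then have cl: "closed (- U)" by (simp add: closed_Compl)
  have ne: "- U \<noteq> {}"
  proof -
    have "0 \<in> - U" by (simp add: U_def mem_box_cart)
    then show ?thesis by blast
  qed
  note [measurable] = sq_int_measurable[OF f(1)] borel_open[OF U] borel_open[OF \<open>open V\<close>]
  define F where "F n x = min 1 (real n * infdist x (- U))" for n x
  have F0: "(LINT x|cube. f x * F n x) = 0" for n
  proof (rule integral_continuous_eq_0[OF f, where B=1])
    show "continuous_on UNIV (F n)" unfolding F_def by (intro continuous_intros)
    show "F n x = 0" if "x \<notin> box 0 1" for x
      using that by (simp add: F_def U_def)
    show "\<bar>F n x\<bar> \<le> 1" for x by (simp add: F_def infdist_nonneg min_def)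
  qed
  have lim: "(\<lambda>n. F n x) \<longlonglongrightarrow> indicator U x" for x
  proof (cases "x \<in> U")
    case True
    then have d: "infdist x (- U) > 0" using infdist_pos_not_in_closed[OF cl ne] by simp
    obtain N :: nat where N: "1 / infdist x (- U) < real N" using reals_Archimedean2 by blast
    have "F n x = 1" if "n \<ge> N" for n
    proof -
      have "1 / infdist x (- U) \<le> real n" using N that by linarith
      then show ?thesis using d by (simp add: F_def field_simps min_def)
    qed
    then have "eventually (\<lambda>n. F n x = indicator U x) sequentially"
      using True by (auto simp: eventually_sequentially)
    then show ?thesis by (rule tendsto_eventually)
  next
    case False
    then show ?thesis by (simp add: F_def)
  qed
  have [measurable]: "F n \<in> borel_measurable borel" for n
    unfolding F_def by (intro borel_measurable_continuous_onI continuous_intros)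
  have "(\<lambda>n. LINT x|cube. f x * F n x) \<longlonglongrightarrow> (LINT x|cube. f x * indicator U x)"
  proof (rule integral_dominated_convergence[where w="\<lambda>x. \<bar>f x\<bar>"])
    show "AE x in cube. (\<lambda>n. f x * F n x) \<longlonglongrightarrow> f x * indicator U x"
      by (intro AE_I2 tendsto_intros lim)
    show "AE x in cube. norm (f x * F n x) \<le> \<bar>f x\<bar>" for n
      by (intro AE_I2) (auto simp: F_def abs_mult infdist_nonneg min_def intro!: mult_left_le)
    show "integrable cube (\<lambda>x. \<bar>f x\<bar>)" using f(1) by (simp add: sq_int_integrable)
  qed measurable
  then have "(LINT x|cube. f x * indicator U x) = 0"
    using F0 by (simp add: LIMSEQ_const_iff)
  moreover have "(LINT x|cube. indicator V x * f x) = (LINT x|cube. f x * indicator U x)"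
    using AE_cube_box by (intro integral_cong_AE) (auto simp: U_def split: split_indicator)
  ultimately show ?thesis by simp
qed

text \<open>The open sets form a generator stable under intersection. The sets over which
  \<open>f\<close> integrates to zero are closed under countable disjoint unions and, the whole
  space being open, under complements. So \<open>f\<close> integrates to zero over every Borel
  set.\<close>

theorem fcoef_eq_0_imp_AE_eq_0:
  assumes f: "f \<in> sq_int" "\<And>m. fcoef f m = 0"
  shows "AE x in cube. f x = 0"
proof -
  note [measurable] = sq_int_measurable[OF f(1)]
  have int: "integrable cube f" by (rule sq_int_integrable) fact
  define \<Phi> where "\<Phi> B \<longleftrightarrow> (LINT x|cube. indicator B x * f x) = 0" for B
  have *: "\<Phi> B" if "B \<in> sets borel" for B
  proof -
    have "Int_stable {S. open S}" by (auto simp: Int_stable_def)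
    moreover have "{S. open S} \<subseteq> Pow UNIV" by auto
    moreover have "B \<in> sigma_sets UNIV {S. open S}" using that by (simp add: sets_borel)
    ultimately show ?thesis
    proof (induction rule: sigma_sets_induct_disjoint)
      case (basic A)
      then show ?case using integral_open_eq_0[OF f] by (simp add: \<Phi>_def)
    next
      case empty
      show ?case by (simp add: \<Phi>_def)
    next
      case (compl A)
      then have [measurable]: "A \<in> sets borel" by (simp add: sets_borel)
      have "indicator (UNIV - A) x * f x = f x - indicator A x * f x" for x
        by (simp split: split_indicator)
      moreover have "(LINT x|cube. f x) = 0"
        using integral_open_eq_0[OF f, of UNIV] by simp
      moreover have "integrable cube (\<lambda>x. indicator A x * f x)"
        by (rule Bochner_Integration.integrable_bound[OF int]) (auto split: split_indicator)
      ultimately show ?case using compl int by (simp add: \<Phi>_def)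
    next
      case (union A)
      then have [measurable]: "A i \<in> sets borel" for i by (auto simp: sets_borel)
      have "set_integrable cube (\<Union>i. A i \<inter> cbox 0 1) f"
        unfolding set_integrable_def
        by (rule Bochner_Integration.integrable_bound[OF int]) (auto split: split_indicator)
      then have "(LINT x:(\<Union>i. A i \<inter> cbox 0 1)|cube. f x) = (\<Sum>i. (LINT x:(A i \<inter> cbox 0 1)|cube. f x))"
        using union(1)
        by (intro lebesgue_integral_countable_add)
          (auto simp: disjoint_family_on_def sets_cube sets_restrict_space)
      moreover have "(LINT x:(C \<inter> cbox 0 1)|cube. f x) = (LINT x|cube. indicator C x * f x)" for C
        unfolding set_lebesgue_integral_def
        by (intro Bochner_Integration.integral_cong) (auto split: split_indicator)
      ultimately show ?case using union(3) by (simp add: \<Phi>_def flip: Int_UN_distrib2)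
    qed
  qed
  show ?thesis
  proof (rule cube.density_zero[OF int])
    fix A assume "A \<in> sets (cube :: (real^'a) measure)"
    then obtain B where "B \<in> sets borel" "A = cbox 0 1 \<inter> B"
      by (auto simp: sets_cube sets_restrict_space)
    moreover have "(LINT x:(cbox 0 1 \<inter> B)|cube. f x) = (LINT x|cube. indicator B x * f x)" for B
      unfolding set_lebesgue_integral_def
      by (intro Bochner_Integration.integral_cong) (auto split: split_indicator)
    ultimately show "set_lebesgue_integral cube A f = 0"
      using * by (simp add: \<Phi>_def)
  qed
qed

corollary fcoef_eq_imp_AE_eq:
  assumes "f \<in> sq_int" "g \<in> sq_int" "\<And>m. fcoef f m = fcoef g m"
  shows "AE x in cube. f x = g x"
  using fcoef_eq_0_imp_AE_eq_0[of "\<lambda>x. f x - g x"] assms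
  by (simp add: fcoef_diff sq_int_diff)

section \<open>The trigonometric basis\<close>

lemma integral_01_cos: "(LINT t|lborel. indicator {0..1} t *\<^sub>R cos (2 * pi * of_int n * t)) = (if n = 0 then 1 else 0)"
proof (cases "n = 0")
  case False
  have "(LINT t|lborel. indicator {0..1} t *\<^sub>R cos (2 * pi * of_int n * t))
    = sin (2 * pi * of_int n * 1) / (2 * pi * of_int n) - sin (2 * pi * of_int n * 0) / (2 * pi * of_int n)"
    using False
    by (intro integral_FTC_atLeastAtMost)
      (auto intro!: derivative_eq_intros continuous_intros
        simp flip: has_real_derivative_iff_has_vector_derivative)
  then show ?thesis using False by (simp add: sin_int_2pin cos_int_2pin)
qed simp

lemma integral_01_sin: "(LINT t|lborel. indicator {0..1} t *\<^sub>R sin (2 * pi * of_int n * t)) = 0"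
proof (cases "n = 0")
  case False
  have "(LINT t|lborel. indicator {0..1} t *\<^sub>R sin (2 * pi * of_int n * t))
    = - cos (2 * pi * of_int n * 1) / (2 * pi * of_int n) - - cos (2 * pi * of_int n * 0) / (2 * pi * of_int n)"
    using False
    by (intro integral_FTC_atLeastAtMost)
      (auto intro!: derivative_eq_intros continuous_intros
        simp flip: has_real_derivative_iff_has_vector_derivative)
  then show ?thesis using False by (simp add: sin_int_2pin cos_int_2pin)
qed simp

definition trig1 :: "nat \<Rightarrow> nat \<Rightarrow> real \<Rightarrow> real" where
  "trig1 j k t = sqrt 2 * ((1 - real k) * cos (2 * pi * real j * t) + real k * sin (2 * pi * real j * t))"

lemma trig_eq_prod: "trig j k x = (\<Prod>i\<in>UNIV. trig1 (j $ i) (k $ i) (x $ i))"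
  by (simp add: trig_def trig1_def)

lemma continuous_on_trig1: "continuous_on S (trig1 j k)"
  unfolding trig1_def by (intro continuous_intros)

lemma integrable_01_continuous:
  assumes "continuous_on UNIV (f :: real \<Rightarrow> real)"
  shows "integrable lborel (\<lambda>t. indicator {0..1} t *\<^sub>R f t)"
  using borel_integrable_compact[of "{0..1}" f] assms continuous_on_subset by auto

text \<open>Product-to-sum formulas leave the frequencies \<open>j - i\<close> and
  \<open>j + i\<close>, and only frequency zero survives integration. For \<open>j = i = 0\<close>
  both are zero, which produces the value 2; sines of frequency zero are excluded by the convention
  on \<open>K\<close>.\<close>

lemma integral_01_trig1_mult:
  assumes k: "k \<in> {0, 1}" "j = 0 \<Longrightarrow> k = 0" and l: "l \<in> {0, 1}" "i = 0 \<Longrightarrow> l = 0"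
  shows "(LINT t|lborel. indicator {0..1} t *\<^sub>R (trig1 j k t * trig1 i l t))
    = (if j = i \<and> k = l then (if j = 0 then 2 else 1) else 0)"
proof -
  define C where "C n t = indicator {0..1} t *\<^sub>R cos (2 * pi * of_int n * t)" for n and t :: real
  define S where "S n t = indicator {0..1} t *\<^sub>R sin (2 * pi * of_int n * t)" for n and t :: real
  have int: "integrable lborel (C n)" "integrable lborel (S n)" for n
    unfolding C_def S_def by (intro integrable_01_continuous continuous_intros)+
  have CI: "integral\<^sup>L lborel (C n) = (if n = 0 then 1 else 0)" for n
    unfolding C_def by (rule integral_01_cos)
  have SI: "integral\<^sup>L lborel (S n) = 0" for n
    unfolding S_def by (rule integral_01_sin)
  consider "k = 0" "l = 0" | "k = 0" "l = 1" | "k = 1" "l = 0" | "k = 1" "l = 1"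
    using k l by auto
  then show ?thesis
  proof cases
    case 1
    have "indicator {0..1} t *\<^sub>R (trig1 j k t * trig1 i l t) = C (int j - int i) t + C (int j + int i) t" for t
      using 1 by (simp add: C_def trig1_def left_diff_distrib right_diff_distrib distrib_left distrib_right cos_diff cos_add split: split_indicator)
    then show ?thesis using 1 by (simp only: Bochner_Integration.integral_add int CI) auto
  next
    case 2
    have "indicator {0..1} t *\<^sub>R (trig1 j k t * trig1 i l t) = S (int j + int i) t + S (int i - int j) t" for t
      using 2 by (simp add: S_def trig1_def left_diff_distrib right_diff_distrib distrib_left distrib_right sin_diff sin_add split: split_indicator)
    then show ?thesis using 2 by (simp only: Bochner_Integration.integral_add int SI) auto
  next
    case 3
    have "indicator {0..1} t *\<^sub>R (trig1 j k t * trig1 i l t) = S (int j + int i) t + S (int j - int i) t" for t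
      using 3 by (simp add: S_def trig1_def left_diff_distrib right_diff_distrib distrib_left distrib_right sin_diff sin_add split: split_indicator)
    then show ?thesis using 3 by (simp only: Bochner_Integration.integral_add int SI) auto
  next
    case 4
    then have "j \<noteq> 0" "i \<noteq> 0" using k l by auto
    have "indicator {0..1} t *\<^sub>R (trig1 j k t * trig1 i l t) = C (int j - int i) t - C (int j + int i) t" for t
      using 4 by (simp add: C_def trig1_def left_diff_distrib right_diff_distrib distrib_left distrib_right cos_diff cos_add split: split_indicator)
    then show ?thesis using 4 \<open>j \<noteq> 0\<close> \<open>i \<noteq> 0\<close>
      by (simp only: Bochner_Integration.integral_diff int CI) auto
  qed
qed

lemma Basis_real_vec: "(Basis :: (real^'d) set) = (\<lambda>i. axis i 1) ` UNIV"
  by (auto simp: Basis_vec_def)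

lemma inj_axis_1: "inj (\<lambda>i. axis i (1::real))"
  by (auto simp: inj_on_def axis_eq_axis)

text \<open>Lebesgue measure on the vector space is an image of a product indexed by basis vectors,
  so the factors are relabelled from coordinates to \<open>axis\<close> vectors before the product
  formula applies.\<close>

lemma integral_cube_prod:
  fixes f :: "'d::finite \<Rightarrow> real \<Rightarrow> real"
  assumes "\<And>i. continuous_on UNIV (f i)"
  shows "(LINT x|cube. (\<Prod>i\<in>UNIV. f i (x $ i))) = (\<Prod>i\<in>UNIV. LINT t|lborel. indicator {0..1} t *\<^sub>R f i t)"
proof -
  define g where "g i t = indicator {0..1} t *\<^sub>R f i t" for i t
  have int: "integrable lborel (g i)" for i
    unfolding g_def by (rule integrable_01_continuous) fact
  define G where "G b = g (axis_index b)" for b :: "real^'d"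
  have ax: "axis_index (axis i (1::real)) = i" for i :: 'd
    using axis_index[of "axis i (1::real)"] by (auto simp: axis_eq_axis)
  have G: "(\<Prod>b\<in>Basis. h (G b) b) = (\<Prod>i\<in>UNIV. h (g i) (axis i 1))" for h :: "(real \<Rightarrow> real) \<Rightarrow> (real^'d) \<Rightarrow> real"
    unfolding Basis_real_vec by (subst prod.reindex) (auto simp: inj_axis_1 G_def ax)
  have [measurable]: "f i \<in> borel_measurable borel" for i
    by (intro borel_measurable_continuous_onI assms)
  have [measurable]: "g i \<in> borel_measurable borel" for i
    unfolding g_def by measurable
  have [measurable]: "G b \<in> borel_measurable borel" for b
    unfolding G_def by measurable
  interpret product_sigma_finite "\<lambda>_::real^'d. lborel :: real measure"
    by (simp add: product_sigma_finite_def sigma_finite_lborel)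
  have "(LINT x|cube. (\<Prod>i\<in>UNIV. f i (x $ i)))
    = (LINT x|lborel. indicator (cbox 0 1) x *\<^sub>R (\<Prod>i\<in>UNIV. f i (x $ i)))"
    unfolding cube_def by (subst integral_restrict_space) auto
  also have "(\<lambda>x. indicator (cbox 0 1) x *\<^sub>R (\<Prod>i\<in>UNIV. f i (x $ i))) = (\<lambda>x. \<Prod>i\<in>UNIV. g i (x $ i))"
  proof
    fix x :: "real^'d"
    show "indicator (cbox 0 1) x *\<^sub>R (\<Prod>i\<in>UNIV. f i (x $ i)) = (\<Prod>i\<in>UNIV. g i (x $ i))"
    proof (cases "x \<in> cbox 0 1")
      case True
      then show ?thesis by (simp add: g_def mem_box_cart)
    next
      case False
      then obtain i where "x $ i \<notin> {0..1}" by (auto simp: mem_box_cart)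
      then have "g i (x $ i) = 0" by (simp only: g_def) simp
      then have "(\<Prod>i\<in>UNIV. g i (x $ i)) = 0" by (intro prod_zero) auto
      then show ?thesis using False by simp
    qed
  qed
  also have "(LINT x|lborel. (\<Prod>i\<in>UNIV. g i (x $ i))) = (LINT x|lborel. (\<Prod>b\<in>Basis. G b (x \<bullet> b)))"
    using G[of "\<lambda>u b. u (_ \<bullet> b)"] by (simp add: inner_axis)
  also have "\<dots> = (LINT x|(\<Pi>\<^sub>M b\<in>Basis. lborel). (\<Prod>b\<in>Basis. G b ((\<Sum>b\<in>Basis. x b *\<^sub>R b) \<bullet> b)))"
    by (subst lborel_eq, subst integral_distr) auto
  also have "\<dots> = (LINT x|(\<Pi>\<^sub>M b\<in>(Basis :: (real^'d) set). lborel). (\<Prod>b\<in>Basis. G b (x b)))"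
    by (intro Bochner_Integration.integral_cong prod.cong) (auto simp: inner_sum_left_Basis)
  also have "\<dots> = (\<Prod>b\<in>Basis. integral\<^sup>L lborel (G b))"
    by (rule product_integral_prod) (auto simp: G_def int)
  also have "\<dots> = (\<Prod>i\<in>UNIV. integral\<^sup>L lborel (g i))"
    using G[of "\<lambda>u b. integral\<^sup>L lborel u"] by simp
  finally show ?thesis by (simp add: g_def[abs_def])
qed

text \<open>The squared norm of \<open>trig j k\<close>: a coordinate of frequency zero contributes
  the square of sqrt 2, with no averaging of a squared cosine to halve it.\<close>

definition trig_weight :: "nat^'d \<Rightarrow> real" where
  "trig_weight j = (\<Prod>i\<in>UNIV. if j $ i = 0 then 2 else 1)"

lemma trig_weight_pos: "trig_weight j > 0"
  unfolding trig_weight_def by (intro prod_pos) auto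

lemma trig_weight_bounds: "1 \<le> trig_weight (j :: nat^'d)" "trig_weight j \<le> 2 ^ CARD('d)"
proof -
  show "1 \<le> trig_weight j" unfolding trig_weight_def by (intro prod_ge_1) auto
  have "trig_weight j \<le> (\<Prod>i\<in>(UNIV :: 'd set). 2)"
    unfolding trig_weight_def by (intro prod_mono) auto
  then show "trig_weight j \<le> 2 ^ CARD('d)" by simp
qed

lemma l2_inner_trig:
  assumes "(j, k) \<in> idx" "(i, l) \<in> idx"
  shows "l2_inner (trig j k) (trig i l) = (if j = i \<and> k = l then trig_weight j else 0)"
proof -
  have "l2_inner (trig j k) (trig i l)
    = (LINT x|cube. (\<Prod>n\<in>UNIV. trig1 (j $ n) (k $ n) (x $ n) * trig1 (i $ n) (l $ n) (x $ n)))"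
    by (simp add: l2_inner_def trig_eq_prod prod.distrib)
  also have "\<dots> = (\<Prod>n\<in>UNIV. LINT t|lborel. indicator {0..1} t *\<^sub>R (trig1 (j $ n) (k $ n) t * trig1 (i $ n) (l $ n) t))"
    by (intro integral_cube_prod[where f="\<lambda>n t. trig1 (j $ n) (k $ n) t * trig1 (i $ n) (l $ n) t"]
        continuous_intros continuous_on_trig1)
  also have "\<dots> = (\<Prod>n\<in>UNIV. if j $ n = i $ n \<and> k $ n = l $ n then (if j $ n = 0 then 2 else 1) else 0)"
    using assms by (intro prod.cong integral_01_trig1_mult) (auto simp: idx_def K_def)
  also have "\<dots> = (if j = i \<and> k = l then trig_weight j else 0)"
  proof (cases "j = i \<and> k = l")
    case False
    then obtain n where "\<not> (j $ n = i $ n \<and> k $ n = l $ n)" by (auto simp: vec_eq_iff)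
    then have "(\<Prod>n\<in>UNIV. if j $ n = i $ n \<and> k $ n = l $ n then (if j $ n = 0 then 2 else 1) else (0::real)) = 0"
      by (intro prod_zero bexI[of _ n]) (simp_all only: if_False finite UNIV_I)
    then show ?thesis using False by (simp only: if_False)
  qed (simp add: trig_weight_def)
  finally show ?thesis .
qed

lemma trig_bound:
  fixes x :: "real^'d"
  assumes "k \<in> K j"
  shows "\<bar>trig j k x\<bar> \<le> sqrt 2 ^ CARD('d)"
proof -
  have "\<bar>trig1 (j $ i) (k $ i) (x $ i)\<bar> \<le> sqrt 2" for i
  proof -
    have "k $ i = 0 \<or> k $ i = 1" using assms by (auto simp: K_def)
    then show ?thesis by (auto simp: trig1_def abs_mult mult_left_le)
  qed
  then have "(\<Prod>i\<in>UNIV. \<bar>trig1 (j $ i) (k $ i) (x $ i)\<bar>) \<le> (\<Prod>i\<in>(UNIV :: 'd set). sqrt 2)"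
    by (intro prod_mono) auto
  then show ?thesis by (simp add: trig_eq_prod abs_prod)
qed

lemma borel_measurable_trig [measurable]: "trig j k \<in> borel_measurable borel"
  unfolding trig_def by measurable

lemma trig_sq_int: "k \<in> K j \<Longrightarrow> trig j k \<in> sq_int"
  by (rule sq_int_bounded[OF _ trig_bound]) measurable

text \<open>For every finite \<open>S\<close> containing the index, \<open>D\<close> is the inner
  product of the residual \<open>R S\<close> with \<open>trig j k\<close>; by Cauchy-Schwarz it is
  bounded by quantities that tend to zero. Coefficients are thus unique, and the missing
  normalization shows up as \<open>trig_weight\<close>.\<close>

lemma has_expansion_coeff:
  assumes f: "has_expansion \<theta> f" and jk: "(j, k) \<in> idx"
  shows "l2_inner f (trig j k) = \<theta> j k * trig_weight j"
proof -
  have fs: "f \<in> sq_int" using f by (simp add: has_expansion_def)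
  have tjk: "trig j k \<in> sq_int" using jk by (auto simp: idx_def intro: trig_sq_int)
  define R where "R S = (\<lambda>x. f x - (\<Sum>(j, k)\<in>S. \<theta> j k * trig j k x))" for S
  define D where "D = l2_inner f (trig j k) - \<theta> j k * trig_weight j"
  have bound: "\<bar>D\<bar> \<le> l2_norm (R S) * l2_norm (trig j k)" if S: "finite S" "S \<subseteq> idx" "(j, k) \<in> S" for S
  proof -
    have ts: "(\<lambda>x. \<theta> (fst p) (snd p) * trig (fst p) (snd p) x) \<in> sq_int" if "p \<in> S" for p
      using that S by (intro sq_int_cmult trig_sq_int) (auto simp: idx_def)
    then have sum: "(\<lambda>x. \<Sum>p\<in>S. \<theta> (fst p) (snd p) * trig (fst p) (snd p) x) \<in> sq_int"
      by (intro sq_int_sum)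
    have "l2_inner (\<lambda>x. \<Sum>p\<in>S. \<theta> (fst p) (snd p) * trig (fst p) (snd p) x) (trig j k)
      = (\<Sum>p\<in>S. \<theta> (fst p) (snd p) * l2_inner (trig (fst p) (snd p)) (trig j k))"
      using ts tjk by (simp add: l2_inner_sum_left l2_inner_cmult_left)
    also have "\<dots> = (\<Sum>p\<in>S. if p = (j, k) then \<theta> j k * trig_weight j else 0)"
    proof (intro sum.cong refl)
      fix p assume "p \<in> S"
      then have "(fst p, snd p) \<in> idx" using S by auto
      then show "\<theta> (fst p) (snd p) * l2_inner (trig (fst p) (snd p)) (trig j k)
        = (if p = (j, k) then \<theta> j k * trig_weight j else 0)"
        using jk by (auto simp: l2_inner_trig prod_eq_iff)
    qed
    also have "\<dots> = \<theta> j k * trig_weight j" using S by simp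
    finally have "D = l2_inner (R S) (trig j k)"
      using fs sum tjk by (simp add: D_def R_def l2_inner_diff_left split_beta)
    moreover have "R S \<in> sq_int"
      unfolding R_def split_beta using fs sum by (intro sq_int_diff)
    ultimately show ?thesis using tjk by (simp add: l2_Cauchy_Schwarz)
  qed
  have "((\<lambda>S. l2_norm (R S)) \<longlongrightarrow> 0) (finite_subsets_at_top idx)"
    using f by (simp add: has_expansion_def R_def)
  then have lim: "((\<lambda>S. l2_norm (R S) * l2_norm (trig j k)) \<longlongrightarrow> 0 * l2_norm (trig j k)) (finite_subsets_at_top idx)"
    by (intro tendsto_mult tendsto_const)
  have "eventually (\<lambda>S. \<bar>D\<bar> \<le> l2_norm (R S) * l2_norm (trig j k)) (finite_subsets_at_top idx)"
    using jk by (auto simp: eventually_finite_subsets_at_top intro!: exI[of _ "{(j, k)}"] bound)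
  with lim have "\<bar>D\<bar> \<le> 0 * l2_norm (trig j k)"
    by (intro tendsto_lowerbound[OF lim]) auto
  then show ?thesis by (simp add: D_def)
qed

lemma has_expansion_finite:
  assumes "finite S" "S \<subseteq> idx" "\<And>j k. (j, k) \<in> idx \<Longrightarrow> (j, k) \<notin> S \<Longrightarrow> \<theta> j k = 0"
    and f: "\<And>x. f x = (\<Sum>(j, k)\<in>S. \<theta> j k * trig j k x)"
  shows "has_expansion \<theta> f"
proof -
  have "f \<in> sq_int"
    unfolding f[abs_def] split_beta using assms(2)
    by (intro sq_int_sum sq_int_cmult trig_sq_int) (auto simp: idx_def)
  moreover have "l2_norm (\<lambda>x. f x - (\<Sum>(j, k)\<in>S'. \<theta> j k * trig j k x)) = 0"
    if S': "finite S'" "S \<subseteq> S'" "S' \<subseteq> idx" for S'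
  proof -
    have "(\<Sum>(j, k)\<in>S'. \<theta> j k * trig j k x) = f x" for x
      unfolding f using S' assms(3) by (intro sum.mono_neutral_right) auto
    then show ?thesis by (simp add: l2_norm_def)
  qed
  then have "eventually (\<lambda>S'. l2_norm (\<lambda>x. f x - (\<Sum>(j, k)\<in>S'. \<theta> j k * trig j k x)) = 0)
      (finite_subsets_at_top idx)"
    using assms(1,2) by (auto simp: eventually_finite_subsets_at_top intro!: exI[of _ S])
  then have "((\<lambda>S. l2_norm (\<lambda>x. f x - (\<Sum>(j, k)\<in>S. \<theta> j k * trig j k x))) \<longlongrightarrow> 0)
      (finite_subsets_at_top idx)"
    by (rule tendsto_eventually)
  ultimately show ?thesis by (simp add: has_expansion_def)
qed

section \<open>Complex exponentials in the real product basis\<close>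

definition abs_freq :: "int^'d \<Rightarrow> nat^'d" where
  "abs_freq m = (\<chi> i. nat \<bar>m $ i\<bar>)"

text \<open>Encodes the elements of \<open>K j\<close> as subsets of the support of
  \<open>j\<close>: the set of coordinates that carry a sine is the index that arises when a product
  of binomials is multiplied out.\<close>

definition set_vec :: "'d set \<Rightarrow> nat^'d" where
  "set_vec S = (\<chi> i. if i \<in> S then 1 else 0)"

text \<open>Multiplying out $\prod_i (\cos 2\pi |m_i| x_i + \mathrm{i}\,\mathrm{sgn}(m_i) \sin 2\pi |m_i| x_i)$
  gives the following coordinates of the complex exponential.\<close>

definition expo_coeff :: "int^'d \<Rightarrow> nat^'d \<Rightarrow> complex" where
  "expo_coeff m k = (\<Prod>i\<in>{i. k $ i = 1}. \<i> * of_int (sgn (m $ i))) / of_real (sqrt 2) ^ CARD('d)"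

lemma abs_freq_nth [simp]: "abs_freq m $ i = nat \<bar>m $ i\<bar>"
  by (simp add: abs_freq_def)

lemma abs_freq_eq_0_iff: "abs_freq m = 0 \<longleftrightarrow> m = 0"
  by (simp add: vec_eq_iff)

lemma K_eq_image: "K j = set_vec ` Pow {i. j $ i \<noteq> 0}"
proof (intro equalityI subsetI)
  fix k assume k: "k \<in> K j"
  then have "k = set_vec {i. k $ i = 1}"
    by (force simp: K_def set_vec_def vec_eq_iff)
  moreover have "{i. k $ i = 1} \<subseteq> {i. j $ i \<noteq> 0}" using k by (auto simp: K_def)
  ultimately show "k \<in> set_vec ` Pow {i. j $ i \<noteq> 0}" by blast
qed (auto simp: K_def set_vec_def)

lemma inj_set_vec: "inj set_vec"
  by (rule inj_on_inverseI[of _ "\<lambda>k. {i. k $ i = 1}"]) (auto simp: set_vec_def)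

lemma finite_K: "finite (K j)"
  by (simp add: K_eq_image)

lemma card_K_le: "card (K (j :: nat^'d)) \<le> 2 ^ CARD('d)"
proof -
  have "card (K j) = card (Pow {i. j $ i \<noteq> 0})"
    unfolding K_eq_image by (intro card_image inj_on_subset[OF inj_set_vec]) auto
  also have "\<dots> \<le> card (Pow (UNIV :: 'd set))"
    by (intro card_mono) auto
  finally show ?thesis by (simp add: card_Pow)
qed

lemma sum_K: "(\<Sum>k\<in>K j. h k) = (\<Sum>S\<in>Pow {i. j $ i \<noteq> 0}. h (set_vec S))"
  unfolding K_eq_image by (subst sum.reindex) (auto intro: inj_on_subset[OF inj_set_vec])

lemma norm_expo_coeff_le: "norm (expo_coeff m k) \<le> 1"
proof -
  have "norm (\<Prod>i\<in>{i. k $ i = 1}. \<i> * of_int (sgn (m $ i)) :: complex) \<le> 1"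
    unfolding prod_norm[symmetric] by (intro prod_le_1) (auto simp: norm_mult sgn_if)
  also have "1 \<le> sqrt 2 ^ CARD('a)" by (intro one_le_power) simp
  finally show ?thesis
    by (simp add: expo_coeff_def norm_divide norm_power divide_le_eq)
qed

lemma expo_eq_sum_trig:
  fixes x :: "real^'d"
  shows "expo m x = (\<Sum>k\<in>K (abs_freq m). expo_coeff m k * of_real (trig (abs_freq m) k x))"
proof -
  define c where "c i = complex_of_real (cos (2 * pi * of_int \<bar>m $ i\<bar> * x $ i))" for i
  define s where "s i = \<i> * of_int (sgn (m $ i)) * complex_of_real (sin (2 * pi * of_int \<bar>m $ i\<bar> * x $ i))" for i
  define J where "J = {i. abs_freq m $ i \<noteq> 0}"
  have J: "i \<in> J \<longleftrightarrow> m $ i \<noteq> 0" for i by (simp add: J_def)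
  have "expo m x = (\<Prod>i\<in>UNIV. cis (2 * pi * of_int (m $ i) * x $ i))"
    by (simp add: expo_def cis_conv_exp sum_distrib_left exp_sum mult.assoc)
  also have "\<dots> = (\<Prod>i\<in>UNIV. s i + c i)"
  proof (intro prod.cong refl)
    fix i
    show "cis (2 * pi * of_int (m $ i) * x $ i) = s i + c i"
      by (cases "m $ i" "0::int" rule: linorder_cases) (simp_all add: complex_eq_iff s_def c_def)
  qed
  also have "\<dots> = (\<Sum>S\<in>Pow UNIV. (\<Prod>i\<in>S. s i) * (\<Prod>i\<in>UNIV - S. c i))"
    by (rule prod_add) simp
  also have "\<dots> = (\<Sum>S\<in>Pow J. (\<Prod>i\<in>S. s i) * (\<Prod>i\<in>UNIV - S. c i))"
  proof (rule sum.mono_neutral_right)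
    show "\<forall>S\<in>Pow UNIV - Pow J. (\<Prod>i\<in>S. s i) * (\<Prod>i\<in>UNIV - S. c i) = 0"
    proof
      fix S :: "'d set" assume "S \<in> Pow UNIV - Pow J"
      then obtain i where "i \<in> S" "m $ i = 0" using J by auto
      then have "(\<Prod>i\<in>S. s i) = 0"
        by (intro prod_zero bexI[of _ i]) (simp_all add: s_def)
      then show "(\<Prod>i\<in>S. s i) * (\<Prod>i\<in>UNIV - S. c i) = 0" by simp
    qed
  qed auto
  also have "\<dots> = (\<Sum>S\<in>Pow J. expo_coeff m (set_vec S) * of_real (trig (abs_freq m) (set_vec S) x))"
  proof (intro sum.cong refl)
    fix S assume "S \<in> Pow J"
    define sn where "sn i = sin (2 * pi * of_int \<bar>m $ i\<bar> * x $ i)" for i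
    define cs where "cs i = cos (2 * pi * of_int \<bar>m $ i\<bar> * x $ i)" for i
    have "trig (abs_freq m) (set_vec S) x = (\<Prod>i\<in>UNIV. sqrt 2 * (if i \<in> S then sn i else cs i))"
      unfolding trig_def by (intro prod.cong) (auto simp: set_vec_def sn_def cs_def)
    also have "\<dots> = sqrt 2 ^ CARD('d) * (\<Prod>i\<in>UNIV. if i \<in> S then sn i else cs i)"
      by (simp add: prod.distrib)
    also have "(\<Prod>i\<in>UNIV. if i \<in> S then sn i else cs i) = (\<Prod>i\<in>S. sn i) * (\<Prod>i\<in>UNIV - S. cs i)"
      by (simp add: prod.If_cases Compl_eq_Diff_UNIV)
    finally have t: "trig (abs_freq m) (set_vec S) x = sqrt 2 ^ CARD('d) * ((\<Prod>i\<in>S. sn i) * (\<Prod>i\<in>UNIV - S. cs i))" .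
    have "{i. set_vec S $ i = 1} = S" by (auto simp: set_vec_def)
    then have "expo_coeff m (set_vec S) = (\<Prod>i\<in>S. \<i> * of_int (sgn (m $ i))) / of_real (sqrt 2) ^ CARD('d)"
      by (simp add: expo_coeff_def)
    then show "(\<Prod>i\<in>S. s i) * (\<Prod>i\<in>UNIV - S. c i) = expo_coeff m (set_vec S) * of_real (trig (abs_freq m) (set_vec S) x)"
      unfolding t by (simp add: s_def c_def sn_def cs_def prod.distrib)
  qed
  also have "\<dots> = (\<Sum>k\<in>K (abs_freq m). expo_coeff m k * of_real (trig (abs_freq m) k x))"
    by (simp add: sum_K J_def)
  finally show ?thesis .
qed

lemma Re_expo_eq_sum_trig:
  "Re (expo m x) = (\<Sum>k\<in>K (abs_freq m). Re (expo_coeff m k) * trig (abs_freq m) k x)"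
  by (simp add: expo_eq_sum_trig)

lemma fcoef_eq_sum:
  assumes "f \<in> sq_int"
  shows "fcoef f m = (\<Sum>k\<in>K (abs_freq m). cnj (expo_coeff m k) * of_real (l2_inner f (trig (abs_freq m) k)))"
proof -
  have "fcoef f m = (LINT x|cube. (\<Sum>k\<in>K (abs_freq m).
      cnj (expo_coeff m k) * complex_of_real (f x * trig (abs_freq m) k x)))"
    unfolding fcoef_def expo_eq_sum_trig
    by (intro Bochner_Integration.integral_cong) (auto simp: sum_distrib_left algebra_simps)
  also have "\<dots> = (\<Sum>k\<in>K (abs_freq m). cnj (expo_coeff m k) * of_real (l2_inner f (trig (abs_freq m) k)))"
  proof (subst Bochner_Integration.integral_sum)
    show "integrable cube (\<lambda>x. cnj (expo_coeff m k) * complex_of_real (f x * trig (abs_freq m) k x))"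
      if "k \<in> K (abs_freq m)" for k
      using assms that
      by (intro integrable_mult_right integrable_of_real sq_int_integrable_mult trig_sq_int)
  qed (simp only: integral_mult_right_zero integral_complex_of_real l2_inner_def)
  finally show ?thesis .
qed

lemma fcoef_has_expansion:
  assumes "has_expansion \<theta> f"
  shows "fcoef f m = trig_weight (abs_freq m) *
    (\<Sum>k\<in>K (abs_freq m). cnj (expo_coeff m k) * of_real (\<theta> (abs_freq m) k))"
proof -
  have "f \<in> sq_int" using assms by (simp add: has_expansion_def)
  then show ?thesis
    by (simp add: fcoef_eq_sum has_expansion_coeff[OF assms] idx_def sum_distrib_left algebra_simps)
qed

section \<open>The convolution operator\<close>

lemma l2_inner_Re_sum_expo:
  assumes "f \<in> sq_int"
  shows "l2_inner f (\<lambda>x. Re (\<Sum>m\<in>B. c m * expo m x)) = Re (\<Sum>m\<in>B. c m * cnj (fcoef f m))"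
proof -
  have "l2_inner f (\<lambda>x. \<Sum>m\<in>B. Re (c m * expo m x)) = (\<Sum>m\<in>B. l2_inner f (\<lambda>x. Re (c m * expo m x)))"
    unfolding l2_inner_commute[of f]
    by (rule l2_inner_sum_left) (auto intro: assms sq_int_Re_expo simp del: times_complex.sel)
  then show ?thesis
    by (simp add: l2_inner_Re_expo[OF assms] del: times_complex.sel)
qed

lemma sq_int_Re_sum_expo: "(\<lambda>x. Re (\<Sum>m\<in>B. c m * expo m x)) \<in> sq_int"
  unfolding Re_sum by (intro sq_int_sum sq_int_Re_expo)

text \<open>Orthonormality of the characters gives equality for the complex polynomial
  \<open>h\<close>; passing to the real part can only decrease the norm.\<close>

lemma l2_norm_Re_sum_expo_le:
  assumes "finite B"
  shows "(l2_norm (\<lambda>x. Re (\<Sum>m\<in>B. c m * expo m x)))\<^sup>2 \<le> (\<Sum>m\<in>B. (cmod (c m))\<^sup>2)"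
proof -
  define h where "h x = (\<Sum>m\<in>B. c m * expo m x)" for x
  have hh: "h x * cnj (h x) = (\<Sum>m\<in>B. \<Sum>k\<in>B. c m * cnj (c k) * expo (m - k) x)" for x
    by (simp add: h_def sum_product expo_diff algebra_simps)
  have int: "integrable cube (\<lambda>x. h x * cnj (h x))"
    unfolding hh by (intro Bochner_Integration.integrable_sum integrable_mult_right integrable_expo)
  have "(LINT x|cube. h x * cnj (h x)) = (\<Sum>m\<in>B. \<Sum>k\<in>B. c m * cnj (c k) * (if m - k = 0 then 1 else 0))"
    unfolding hh by (simp add: integrable_expo integral_expo)
  also have "\<dots> = (\<Sum>m\<in>B. \<Sum>k\<in>B. if k = m then c m * cnj (c m) else 0)"
    by (intro sum.cong) auto
  also have "\<dots> = of_real (\<Sum>m\<in>B. (cmod (c m))\<^sup>2)"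
    using assms by (simp add: complex_norm_square del: of_real_power)
  finally have I: "(LINT x|cube. h x * cnj (h x)) = of_real (\<Sum>m\<in>B. (cmod (c m))\<^sup>2)" .
  have "(l2_norm (\<lambda>x. Re (h x)))\<^sup>2 = (LINT x|cube. (Re (h x))\<^sup>2)"
    by (rule l2_norm_sq)
  also have "\<dots> \<le> (LINT x|cube. Re (h x * cnj (h x)))"
  proof (rule integral_mono)
    show "integrable cube (\<lambda>x. (Re (h x))\<^sup>2)"
      unfolding h_def by (rule integrable_sq_int[OF sq_int_Re_sum_expo])
    show "integrable cube (\<lambda>x. Re (h x * cnj (h x)))" by (rule integrable_Re[OF int])
    show "(Re (h x))\<^sup>2 \<le> Re (h x * cnj (h x))" for x
      by (simp add: power2_eq_square)
  qed
  also have "\<dots> = (\<Sum>m\<in>B. (cmod (c m))\<^sup>2)"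
    using integral_Re[OF int] I by simp
  finally show ?thesis by (simp add: h_def)
qed

text \<open>Being a real part, \<open>u\<close> need not be a projection of \<open>f\<close>. Still,
  its inner product with \<open>f\<close> is the full sum and its squared norm is at most that sum,
  which is enough when the squared norm of \<open>f - u\<close> is expanded.\<close>

lemma Bessel_fcoef:
  assumes "finite B" "f \<in> sq_int"
  shows "(\<Sum>m\<in>B. (cmod (fcoef f m))\<^sup>2) \<le> (l2_norm f)\<^sup>2"
proof -
  define u where "u x = Re (\<Sum>m\<in>B. fcoef f m * expo m x)" for x
  have u: "u \<in> sq_int" unfolding u_def[abs_def] by (rule sq_int_Re_sum_expo)
  have fu: "l2_inner f u = (\<Sum>m\<in>B. (cmod (fcoef f m))\<^sup>2)"
    using l2_inner_Re_sum_expo[OF assms(2), of "fcoef f" B]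
    by (simp add: u_def[abs_def] cmod_def flip: power2_eq_square)
  have "0 \<le> (l2_norm (\<lambda>x. f x - u x))\<^sup>2" by simp
  also have "\<dots> = (l2_norm f)\<^sup>2 - 2 * l2_inner f u + (l2_norm u)\<^sup>2"
    by (rule l2_norm_diff_sq[OF assms(2) u])
  finally show ?thesis
    using l2_norm_Re_sum_expo_le[OF assms(1), of "fcoef f"] unfolding fu u_def[abs_def, symmetric]
    by linarith
qed

lemma l2_norm_Re_expo:
  assumes "m \<noteq> 0"
  shows "l2_norm (\<lambda>x. Re (z * expo m x)) = cmod z / sqrt 2"
proof -
  have "m \<noteq> - m" using assms by (auto simp: vec_eq_iff)
  then have "(l2_norm (\<lambda>x. Re (z * expo m x)))\<^sup>2 = Re (z * cnj (z / 2))"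
    unfolding l2_norm_sq_inner l2_inner_Re_expo[OF sq_int_Re_expo] fcoef_Re_expo by simp
  also have "\<dots> = (cmod z / sqrt 2)\<^sup>2"
    by (simp add: power_divide cmod_power2) (simp add: power2_eq_square add_divide_distrib)
  finally show ?thesis
    by (rule power2_eq_imp_eq) auto
qed

lemma measurable_fst_cube [measurable]: "fst \<in> borel_measurable (cube \<Otimes>\<^sub>M N)"
  by (rule measurable_compose[OF measurable_fst measurable_cube_id])

lemma measurable_snd_cube [measurable]: "snd \<in> borel_measurable (N \<Otimes>\<^sub>M cube)"
  by (rule measurable_compose[OF measurable_snd measurable_cube_id])

lemma conv_eq_l2_inner: "conv a f x = l2_inner (\<lambda>y. a (x - y)) f"
  by (simp add: conv_def l2_inner_def)

locale periodic_filter =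
  fixes a :: "real^'d \<Rightarrow> real"
  assumes periodic: "periodic a" and filter_sq_int: "a \<in> sq_int"
begin

lemma borel_measurable_filter [measurable]: "a \<in> borel_measurable borel"
  using periodic filter_sq_int by (intro borel_measurable_periodic sq_int_measurable)

lemma sq_int_reflect: "(\<lambda>y. a (x - y)) \<in> sq_int"
proof -
  have "integrable cube (\<lambda>y. (a (x + (-1) *\<^sub>R y))\<^sup>2)"
    using filter_sq_int periodic
    by (subst integrable_periodic_affine[of "-1" "\<lambda>y. (a y)\<^sup>2"])
      (auto simp: periodic_def integrable_sq_int)
  then show ?thesis by (simp add: sq_int_def)
qed

lemma l2_norm_reflect: "l2_norm (\<lambda>y. a (x - y)) = l2_norm a"
proof -
  have "(LINT y|cube. (a (x + (-1) *\<^sub>R y))\<^sup>2) = (LINT y|cube. (a y)\<^sup>2)"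
    using periodic by (subst integral_periodic_affine[of "-1" "\<lambda>y. (a y)\<^sup>2"]) (auto simp: periodic_def)
  then show ?thesis by (simp add: l2_norm_def)
qed

lemma conv_bound: "f \<in> sq_int \<Longrightarrow> \<bar>conv a f x\<bar> \<le> l2_norm a * l2_norm f"
  using l2_Cauchy_Schwarz[OF sq_int_reflect, of f x] by (simp add: conv_eq_l2_inner l2_norm_reflect)

lemma borel_measurable_conv:
  assumes "f \<in> sq_int"
  shows "conv a f \<in> borel_measurable borel"
proof -
  note [measurable] = measurable_compose[OF measurable_snd[of borel] sq_int_measurable[OF assms]]
  have "(\<lambda>x. LINT y|cube. a (x - y) * f y) \<in> borel_measurable borel"
    by measurable
  then show ?thesis by (simp add: conv_def[abs_def])
qed

lemma sq_int_conv: "f \<in> sq_int \<Longrightarrow> conv a f \<in> sq_int"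
  by (rule sq_int_bounded[OF borel_measurable_conv conv_bound])

lemma conv_diff:
  assumes "f \<in> sq_int" "g \<in> sq_int"
  shows "conv a (\<lambda>x. f x - g x) x = conv a f x - conv a g x"
  unfolding conv_eq_l2_inner l2_inner_commute[of "\<lambda>y. a (x - y)"]
  using assms by (intro l2_inner_diff_left sq_int_reflect)

lemma conv_cmult: "conv a (\<lambda>x. c * f x) x = c * conv a f x"
  unfolding conv_eq_l2_inner l2_inner_commute[of "\<lambda>y. a (x - y)"]
  by (rule l2_inner_cmult_left)

lemma fcoef_reflect: "(LINT y|cube. complex_of_real (a (x - y)) * cnj (expo m (x - y))) = fcoef a m"
proof -
  have "(LINT y|cube. (\<lambda>y. complex_of_real (a y) * expo (- m) y) (x + (-1) *\<^sub>R y)) = fcoef a m"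
    using periodic periodic_expo[of "- m"] unfolding fcoef_def expo_uminus[symmetric]
    by (intro integral_periodic_affine) (auto simp: periodic_def)
  then show ?thesis by (simp add: expo_uminus)
qed

lemma fcoef_translate: "(LINT x|cube. complex_of_real (a (x - y)) * cnj (expo m (x - y))) = fcoef a m"
proof -
  have "(LINT x|cube. (\<lambda>x. complex_of_real (a x) * expo (- m) x) (- y + 1 *\<^sub>R x)) = fcoef a m"
    using periodic periodic_expo[of "- m"] unfolding fcoef_def expo_uminus[symmetric]
    by (intro integral_periodic_affine) (auto simp: periodic_def)
  then show ?thesis by (simp add: expo_uminus)
qed

text \<open>Characters are eigenfunctions: shifting the argument splits off \<open>expo m x\<close>,
  and what remains is the Fourier coefficient of the filter. The complex factor \<open>z\<close>
  lets one real part carry cosine and sine at once.\<close>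

lemma conv_Re_expo: "conv a (\<lambda>x. Re (z * expo m x)) x = Re (z * fcoef a m * expo m x)"
proof -
  have "complex_of_real (a (x - y)) * cnj (expo m (x - y)) * expo m x
    = complex_of_real (a (x - y)) * expo m y * (cnj (expo m x) * expo m x)" for y
    by (simp only: expo_diff_arg complex_cnj_mult complex_cnj_cnj ac_simps)
  then have "fcoef a m * expo m x = (LINT y|cube. complex_of_real (a (x - y)) * expo m y)"
    unfolding fcoef_reflect[of x, symmetric]
    by (simp only: integral_mult_left_zero[symmetric] expo_cnj_mult mult_1_right)
  also have "\<dots> = cnj (fcoef (\<lambda>y. a (x - y)) m)"
    by (rule integral_expo_eq_cnj_fcoef)
  finally have "Re (z * (fcoef a m * expo m x)) = Re (z * cnj (fcoef (\<lambda>y. a (x - y)) m))"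
    by (simp only:)
  then show ?thesis
    unfolding conv_eq_l2_inner l2_inner_Re_expo[OF sq_int_reflect] by (simp only: mult.assoc)
qed

text \<open>Fubini. When \<open>x\<close> is integrated first, translation invariance yields a
  factor \<open>fcoef a m\<close> that does not depend on \<open>y\<close>. Integrability on the
  product holds because Cauchy-Schwarz bounds the inner integral of the absolute values uniformly in
  \<open>x\<close>.\<close>

lemma fcoef_conv:
  assumes f: "f \<in> sq_int"
  shows "fcoef (conv a f) m = fcoef a m * fcoef f m"
proof -
  note [measurable] = sq_int_measurable[OF f]
  interpret pair_sigma_finite "cube :: (real^'d) measure" cube ..
  define H where "H x y = complex_of_real (a (x - y) * f y) * expo (- m) x" for x y
  have [measurable]: "(\<lambda>p. f (snd p)) \<in> borel_measurable ((cube :: (real^'d) measure) \<Otimes>\<^sub>M cube)"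
    by (rule measurable_compose[OF measurable_snd sq_int_measurable[OF f]])
  have H: "case_prod H \<in> borel_measurable (cube \<Otimes>\<^sub>M cube)"
    unfolding H_def split_beta' by measurable
  have fabs: "(\<lambda>y. \<bar>f y\<bar>) \<in> sq_int" using f by (simp add: sq_int_def)
  have aabs: "(\<lambda>y. \<bar>a (x - y)\<bar>) \<in> sq_int" for x using sq_int_reflect[of x] by (simp add: sq_int_def)
  have norm: "norm (H x y) = \<bar>a (x - y)\<bar> * \<bar>f y\<bar>" for x y
    by (simp add: H_def norm_mult abs_mult)
  have "integrable (cube \<Otimes>\<^sub>M cube) (case_prod H)"
  proof (rule Fubini_integrable[OF H])
    show "integrable cube (\<lambda>x. LINT y|cube. norm (case_prod H (x, y)))"
    proof (rule cube.integrable_const_bound[where B="l2_norm a * l2_norm f"])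
      show "AE x in cube. norm (LINT y|cube. norm (case_prod H (x, y))) \<le> l2_norm a * l2_norm f"
        using l2_Cauchy_Schwarz[OF aabs fabs] l2_norm_reflect
        by (intro AE_I2) (simp add: norm l2_inner_def l2_norm_def)
      show "(\<lambda>x. LINT y|cube. norm (case_prod H (x, y))) \<in> borel_measurable cube"
        unfolding norm split by measurable
    qed
    show "AE x in cube. integrable cube (\<lambda>y. case_prod H (x, y))"
      unfolding H_def split by (intro AE_I2 integrable_mult_left integrable_of_real sq_int_integrable_mult
          sq_int_reflect f)
  qed
  then have "(LINT y|cube. (LINT x|cube. H x y)) = (LINT x|cube. (LINT y|cube. H x y))"
    by (rule Fubini_integral)
  moreover have "(LINT y|cube. H x y) = complex_of_real (conv a f x) * cnj (expo m x)" for x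
    unfolding H_def expo_uminus by (simp only: integral_mult_left_zero integral_complex_of_real conv_def)
  moreover have "(LINT x|cube. H x y) = fcoef a m * (complex_of_real (f y) * cnj (expo m y))" for y
  proof -
    have split: "expo m x = expo m (x - y) * expo m y" for x
      by (simp add: expo_diff_arg mult.assoc)
    have "H x y = complex_of_real (a (x - y)) * cnj (expo m (x - y)) * (complex_of_real (f y) * cnj (expo m y))" for x
      unfolding H_def expo_uminus by (subst split) (simp only: of_real_mult complex_cnj_mult ac_simps)
    then show ?thesis by (simp only: integral_mult_left_zero fcoef_translate)
  qed
  ultimately show ?thesis by (simp add: fcoef_def)
qed

end

section \<open>The adjoint of the inverse\<close>

lemma vecs_eq_image: "{v :: 'a^'d. \<forall>i. v $ i \<in> A} = vec_lambda ` (UNIV \<rightarrow>\<^sub>E A)"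
proof (intro equalityI subsetI)
  fix v :: "'a^'d" assume "v \<in> {v. \<forall>i. v $ i \<in> A}"
  then have "vec_nth v \<in> UNIV \<rightarrow>\<^sub>E A" "v = vec_lambda (vec_nth v)" by auto
  then show "v \<in> vec_lambda ` (UNIV \<rightarrow>\<^sub>E A)" by blast
qed auto

lemma finite_vecs: "finite A \<Longrightarrow> finite {v :: 'a^'d. \<forall>i. v $ i \<in> A}"
  unfolding vecs_eq_image by (intro finite_imageI finite_PiE) auto

lemma card_vecs: "finite A \<Longrightarrow> card {v :: 'a^'d. \<forall>i. v $ i \<in> A} = card A ^ CARD('d)"
  unfolding vecs_eq_image by (subst card_image) (auto simp: inj_on_def card_PiE vec_lambda_inject)

definition freqs :: "nat \<Rightarrow> (int^'d) set" where
  "freqs M = {m. \<forall>i. m $ i \<in> {- int M..int M}}"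

lemma finite_freqs: "finite (freqs M)"
  unfolding freqs_def by (rule finite_vecs) simp

lemma uminus_freqs: "- m \<in> freqs M \<longleftrightarrow> m \<in> freqs M"
  by (auto simp: freqs_def minus_le_iff)

lemma band_limited_sq_int: "band_limited M g \<Longrightarrow> g \<in> sq_int"
  by (auto simp: band_limited_def has_expansion_def)

lemma band_limited_fcoef:
  assumes "band_limited M g" "m \<notin> freqs M"
  shows "fcoef g m = 0"
proof -
  obtain \<theta> where \<theta>: "has_expansion \<theta> g" and
    0: "\<forall>(j, k)\<in>idx. (\<exists>i. j $ i > M) \<longrightarrow> \<theta> j k = 0"
    using assms(1) unfolding band_limited_def by blast
  obtain i where "m $ i \<notin> {- int M..int M}" using assms(2) by (auto simp: freqs_def)
  then have "abs_freq m $ i > M" by auto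
  then have "\<exists>i. abs_freq m $ i > M" by blast
  then have "\<theta> (abs_freq m) k = 0" if "k \<in> K (abs_freq m)" for k
    using that 0 unfolding idx_def by blast
  then show ?thesis by (simp add: fcoef_has_expansion[OF \<theta>])
qed

lemma band_limited_eq_AE:
  assumes g: "band_limited M g"
  shows "AE x in cube. g x = Re (\<Sum>m\<in>freqs M. fcoef g m * expo m x)"
proof (rule fcoef_eq_imp_AE_eq)
  show "g \<in> sq_int" by (rule band_limited_sq_int[OF g])
  show "(\<lambda>x. Re (\<Sum>m\<in>freqs M. fcoef g m * expo m x)) \<in> sq_int" by (rule sq_int_Re_sum_expo)
  fix m
  have "fcoef (\<lambda>x. Re (\<Sum>k\<in>freqs M. fcoef g k * expo k x)) m
    = (\<Sum>k\<in>freqs M. fcoef (\<lambda>x. Re (fcoef g k * expo k x)) m)"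
    unfolding Re_sum by (intro fcoef_sum sq_int_Re_expo)
  \<comment> \<open>Each \<open>m\<close> in the symmetric box is hit twice, by \<open>k = m\<close>
    and by \<open>k = - m\<close>; each hit supplies half of the coefficient.\<close>
  also have "\<dots> = (\<Sum>k\<in>freqs M. if k = m then fcoef g m / 2 else 0)
      + (\<Sum>k\<in>freqs M. if k = - m then cnj (fcoef g (- m)) / 2 else 0)"
    unfolding fcoef_Re_expo sum.distrib by (intro arg_cong2[of _ _ _ _ plus] sum.cong) auto
  also have "\<dots> = (if m \<in> freqs M then fcoef g m else 0)"
    by (simp add: finite_freqs uminus_freqs fcoef_uminus)
  finally show "fcoef g m = fcoef (\<lambda>x. Re (\<Sum>m\<in>freqs M. fcoef g m * expo m x)) m"
    using band_limited_fcoef[OF g, of m] by simp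
qed

context periodic_filter
begin

text \<open>The adjoint of convolution multiplies the coefficient at \<open>m\<close> by the
  conjugate of \<open>fcoef a m\<close>. Dividing by it on a finite band solves the adjoint equation
  explicitly, even though the inverse is unbounded in general.\<close>

definition adj_sol :: "nat \<Rightarrow> (real^'d \<Rightarrow> real) \<Rightarrow> real^'d \<Rightarrow> real" where
  "adj_sol M g = (\<lambda>x. Re (\<Sum>m\<in>freqs M. fcoef g m / cnj (fcoef a m) * expo m x))"

lemma adj_sol_sq_int: "adj_sol M g \<in> sq_int"
  unfolding adj_sol_def by (rule sq_int_Re_sum_expo)

lemma l2_inner_conv_adj_sol:
  assumes f: "f \<in> sq_int" and g: "band_limited M g" and nz: "\<And>m. fcoef a m \<noteq> 0"
  shows "l2_inner (conv a f) (adj_sol M g) = l2_inner f g"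
proof -
  have "l2_inner (conv a f) (adj_sol M g)
    = Re (\<Sum>m\<in>freqs M. fcoef g m / cnj (fcoef a m) * cnj (fcoef a m * fcoef f m))"
    unfolding adj_sol_def l2_inner_Re_sum_expo[OF sq_int_conv[OF f]] fcoef_conv[OF f] ..
  also have "\<dots> = Re (\<Sum>m\<in>freqs M. fcoef g m * cnj (fcoef f m))"
    using nz by (intro arg_cong[of _ _ Re] sum.cong) auto
  also have "\<dots> = l2_inner f (\<lambda>x. Re (\<Sum>m\<in>freqs M. fcoef g m * expo m x))"
    by (rule l2_inner_Re_sum_expo[OF f, symmetric])
  also have "\<dots> = l2_inner f g"
    unfolding l2_inner_commute[of f] using f band_limited_sq_int[OF g] sq_int_Re_sum_expo
    by (intro l2_inner_cong_AE)
      (auto intro: sq_int_measurable AE_mp[OF band_limited_eq_AE[OF g]] simp del: Re_sum)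
  finally show ?thesis .
qed

text \<open>The range of the convolution operator contains all trigonometric polynomials, so that
  completeness of the exponentials leaves no freedom in the choice made by \<open>adj_inv\<close>.\<close>

lemma
  assumes g: "band_limited M g" and nz: "\<And>m. fcoef a m \<noteq> 0"
  shows adj_inv_sq_int: "adj_inv a g \<in> sq_int"
    and adj_inv_AE: "AE x in cube. adj_inv a g x = adj_sol M g x"
    and l2_inner_adj_inv_conv: "f \<in> sq_int \<Longrightarrow> l2_inner (adj_inv a g) (conv a f) = l2_inner f g"
proof -
  define u where "u = adj_inv a g"
  let ?R = "\<lambda>u. u \<in> sq_int \<and> (\<forall>h \<in> conv a ` sq_int. l2_inner (conv_inv a h) g = l2_inner h u)"
  have inv: "conv_inv a (conv a f) \<in> sq_int \<and> (AE x in cube. conv a (conv_inv a (conv a f)) x = conv a f x)"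
    if "f \<in> sq_int" for f
    unfolding conv_inv_def by (rule someI[of _ f]) (use that in simp)
  have "l2_inner (conv_inv a (conv a f)) g = l2_inner (conv a f) (adj_sol M g)" if "f \<in> sq_int" for f
  proof -
    have "l2_inner (conv_inv a (conv a f)) g = l2_inner (conv a (conv_inv a (conv a f))) (adj_sol M g)"
      using inv[OF that] by (intro l2_inner_conv_adj_sol[symmetric] g nz) auto
    also have "\<dots> = l2_inner (conv a f) (adj_sol M g)"
      using inv[OF that] that
      by (intro l2_inner_cong_AE sq_int_measurable sq_int_conv adj_sol_sq_int) auto
    finally show ?thesis .
  qed
  then have sol: "?R (adj_sol M g)" by (auto simp: adj_sol_sq_int)
  then have u: "?R u"
    unfolding u_def adj_inv_def by (rule someI[of ?R])
  then have us: "u \<in> sq_int" by simp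
  have eq: "l2_inner (conv a f) u = l2_inner (conv a f) (adj_sol M g)" if "f \<in> sq_int" for f
    using u sol that by (metis imageI)
  have "AE x in cube. u x = adj_sol M g x"
  proof (rule fcoef_eq_imp_AE_eq[OF us adj_sol_sq_int])
    fix m
    \<comment> \<open>Convolution turns the input with factor \<open>w / fcoef a m\<close> into
      \<open>Re (w * expo m x)\<close>. Testing both candidates against it gives
      \<open>Re (w * cnj w) = 0\<close>, so their coefficients agree.\<close>
    define w where "w = fcoef u m - fcoef (adj_sol M g) m"
    have c: "l2_inner (conv a (\<lambda>x. Re (w / fcoef a m * expo m x))) v = Re (w * cnj (fcoef v m))"
      if "v \<in> sq_int" for v
    proof -
      have "conv a (\<lambda>x. Re (w / fcoef a m * expo m x)) = (\<lambda>x. Re (w * expo m x))"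
        unfolding conv_Re_expo using nz by (simp del: times_complex.sel)
      then show ?thesis by (simp only: l2_inner_commute[of _ v] l2_inner_Re_expo[OF that])
    qed
    have "Re (w * cnj (fcoef u m)) = Re (w * cnj (fcoef (adj_sol M g) m))"
      using eq[OF sq_int_Re_expo[of "w / fcoef a m" m]] unfolding c[OF us] c[OF adj_sol_sq_int] .
    then have "Re (w * cnj w) = 0" unfolding w_def by (simp add: algebra_simps)
    then have "(cmod w)\<^sup>2 = 0" by (simp add: cmod_power2 power2_eq_square complex_eq_iff)
    then show "fcoef u m = fcoef (adj_sol M g) m" by (simp add: w_def)
  qed
  then show "AE x in cube. adj_inv a g x = adj_sol M g x" by (simp add: u_def)
  show "adj_inv a g \<in> sq_int" using us by (simp add: u_def)
  show "l2_inner (adj_inv a g) (conv a f) = l2_inner f g" if "f \<in> sq_int"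
    using eq[OF that] l2_inner_conv_adj_sol[OF that g nz] by (simp add: u_def l2_inner_commute)
qed

lemma l2_norm_adj_inv_diff_le:
  assumes g: "band_limited M g" and h: "band_limited M h" and "\<kappa> > 0"
    and nz: "\<And>m. fcoef a m \<noteq> 0" and \<kappa>: "\<And>m. m \<in> freqs M \<Longrightarrow> 1 \<le> \<kappa> * cmod (fcoef a m)"
  shows "(l2_norm (\<lambda>x. adj_inv a g x - adj_inv a h x))\<^sup>2 \<le> \<kappa>\<^sup>2 * (l2_norm (\<lambda>x. g x - h x))\<^sup>2"
proof -
  have gs: "g \<in> sq_int" and hs: "h \<in> sq_int" using g h by (auto intro: band_limited_sq_int)
  have "l2_norm (\<lambda>x. adj_inv a g x - adj_inv a h x) = l2_norm (\<lambda>x. adj_sol M g x - adj_sol M h x)"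
    using adj_inv_AE[OF g nz] adj_inv_AE[OF h nz]
    by (intro l2_norm_cong_AE sq_int_measurable sq_int_diff adj_inv_sq_int[OF g nz] adj_inv_sq_int[OF h nz]
        adj_sol_sq_int) auto
  also have "(\<lambda>x. adj_sol M g x - adj_sol M h x)
    = (\<lambda>x. Re (\<Sum>m\<in>freqs M. fcoef (\<lambda>x. g x - h x) m / cnj (fcoef a m) * expo m x))"
    by (simp only: adj_sol_def fcoef_diff[OF gs hs] diff_divide_distrib left_diff_distrib sum_subtractf minus_complex.sel)
  also have "(l2_norm \<dots>)\<^sup>2 \<le> (\<Sum>m\<in>freqs M. (cmod (fcoef (\<lambda>x. g x - h x) m / cnj (fcoef a m)))\<^sup>2)"
    by (rule l2_norm_Re_sum_expo_le[OF finite_freqs])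
  also have "\<dots> \<le> (\<Sum>m\<in>freqs M. \<kappa>\<^sup>2 * (cmod (fcoef (\<lambda>x. g x - h x) m))\<^sup>2)"
  proof (rule sum_mono)
    fix m :: "int^'d" assume "m \<in> freqs M"
    then have "1 / cmod (fcoef a m) \<le> \<kappa>" using \<kappa>[of m] nz[of m] by (simp add: field_simps)
    then have "cmod (fcoef (\<lambda>x. g x - h x) m) * (1 / cmod (fcoef a m)) \<le> cmod (fcoef (\<lambda>x. g x - h x) m) * \<kappa>"
      by (intro mult_left_mono) auto
    then have "cmod (fcoef (\<lambda>x. g x - h x) m / cnj (fcoef a m)) \<le> \<kappa> * cmod (fcoef (\<lambda>x. g x - h x) m)"
      by (simp add: norm_divide mult.commute)
    then have "(cmod (fcoef (\<lambda>x. g x - h x) m / cnj (fcoef a m)))\<^sup>2 \<le> (\<kappa> * cmod (fcoef (\<lambda>x. g x - h x) m))\<^sup>2"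
      by (intro power_mono) auto
    then show "(cmod (fcoef (\<lambda>x. g x - h x) m / cnj (fcoef a m)))\<^sup>2 \<le> \<kappa>\<^sup>2 * (cmod (fcoef (\<lambda>x. g x - h x) m))\<^sup>2"
      by (simp add: power_mult_distrib)
  qed
  also have "\<dots> \<le> \<kappa>\<^sup>2 * (l2_norm (\<lambda>x. g x - h x))\<^sup>2"
    unfolding sum_distrib_left[symmetric]
    by (intro mult_left_mono Bessel_fcoef finite_freqs sq_int_diff gs hs) simp
  finally show ?thesis .
qed

end

section \<open>Size of the Fourier coefficients of the filter\<close>

lemma deg_abs_freq_pos: "m \<noteq> 0 \<Longrightarrow> deg (abs_freq m) \<ge> 1"
proof -
  assume "m \<noteq> 0"
  then obtain i where "m $ i \<noteq> 0" by (auto simp: vec_eq_iff)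
  then have "1 \<le> abs_freq m $ i" by simp
  also have "\<dots> \<le> deg (abs_freq m)" unfolding deg_def by (intro member_le_sum) auto
  finally show ?thesis .
qed

lemma deg_abs_freq_le: "m \<in> freqs M \<Longrightarrow> deg (abs_freq (m :: int^'d)) \<le> CARD('d) * M"
  unfolding deg_def using sum_bounded_above[of UNIV "\<lambda>i. abs_freq m $ i" M]
  by (auto simp: freqs_def abs_le_iff nat_le_iff minus_le_iff)

text \<open>Of the factor 4^d, one 2^d bounds \<open>trig_weight\<close> and the other the number of
  \<open>k\<close>; each \<open>expo_coeff\<close> has modulus at most 1.\<close>

lemma cmod_fcoef_le:
  fixes a :: "real^'d \<Rightarrow> real"
  assumes exp: "has_expansion b a" and "\<And>k. k \<in> K (abs_freq m) \<Longrightarrow> \<bar>b (abs_freq m) k\<bar> \<le> B"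
  shows "cmod (fcoef a m) \<le> 4 ^ CARD('d) * B"
proof -
  have "0 \<in> K (abs_freq m)" by (simp add: K_def)
  with assms(2) have B: "B \<ge> 0" using abs_ge_zero order_trans by blast
  have "cmod (\<Sum>k\<in>K (abs_freq m). cnj (expo_coeff m k) * of_real (b (abs_freq m) k))
    \<le> (\<Sum>k\<in>K (abs_freq m). 1 * B)"
  proof (rule sum_norm_le)
    fix k assume "k \<in> K (abs_freq m)"
    then show "cmod (cnj (expo_coeff m k) * of_real (b (abs_freq m) k)) \<le> 1 * B"
      unfolding norm_mult complex_mod_cnj norm_of_real
      by (intro mult_mono norm_expo_coeff_le assms(2)) auto
  qed
  also have "\<dots> \<le> 2 ^ CARD('d) * B"
    using card_K_le[of "abs_freq m"] B by (simp add: mult_right_mono)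
  finally have "cmod (fcoef a m) \<le> 2 ^ CARD('d) * (2 ^ CARD('d) * B)"
    unfolding fcoef_has_expansion[OF exp] norm_mult
    using trig_weight_bounds[of "abs_freq m"] trig_weight_pos[of "abs_freq m"] B by (intro mult_mono) auto
  also have "\<dots> = 4 ^ CARD('d) * B" by (simp flip: power_mult_distrib mult.assoc)
  finally show ?thesis .
qed

text \<open>At frequency zero \<open>K\<close> has a single element, so nothing can cancel. The
  decay condition does not reach this frequency; positivity of \<open>b 0 0\<close> takes its
  place.\<close>

lemma cmod_fcoef_0:
  fixes a :: "real^'d \<Rightarrow> real"
  assumes exp: "has_expansion b a"
  shows "fcoef a 0 = trig_weight (0 :: nat^'d) * b 0 0 / sqrt 2 ^ CARD('d)"
proof -
  have K0: "K (0 :: nat^'d) = {0}" by (auto simp: K_def vec_eq_iff)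
  have "abs_freq (0 :: int^'d) = 0" by (simp add: abs_freq_eq_0_iff)
  then show ?thesis using fcoef_has_expansion[OF exp, of 0]
    by (simp add: K0 expo_coeff_def)
qed

text \<open>With at most two nonzero frequencies, the terms of the real part or those of the imaginary
  part all have the same sign.\<close>

lemma cmod_fcoef_ge_low_dim:
  fixes a :: "real^'d \<Rightarrow> real"
  assumes exp: "has_expansion b a" and d: "CARD('d) \<le> 2" and m: "m \<noteq> 0" and "B \<ge> 0"
    and b: "\<And>k. k \<in> K (abs_freq m) \<Longrightarrow> B \<le> b (abs_freq m) k"
  shows "B / 2 \<le> cmod (fcoef a m)"
proof -
  define j where "j = abs_freq m"
  define J where "J = {i. j $ i \<noteq> 0}"
  define s where "s i = (of_int (sgn (m $ i)) :: real)" for i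
  define \<beta> where "\<beta> S = b j (set_vec S)" for S
  have \<beta>: "B \<le> \<beta> S" if "S \<subseteq> J" for S
    using b that unfolding \<beta>_def j_def[symmetric] K_eq_image J_def[symmetric] by blast
  have s: "s i = 1 \<or> s i = -1" if "i \<in> J" for i
    using that by (auto simp: s_def J_def j_def sgn_if)
  define Z where "Z = (\<Sum>S\<in>Pow J. (\<Prod>i\<in>S. - \<i> * of_real (s i)) * of_real (\<beta> S))"
  have "{i. set_vec S $ i = 1} = S" for S :: "'d set" by (auto simp: set_vec_def)
  then have c: "cnj (expo_coeff m (set_vec S)) = (\<Prod>i\<in>S. - \<i> * of_real (s i)) / of_real (sqrt 2 ^ CARD('d))" for S
    by (simp add: expo_coeff_def s_def)
  have f: "fcoef a m = of_real (trig_weight j / sqrt 2 ^ CARD('d)) * Z"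
    unfolding fcoef_has_expansion[OF exp] sum_K j_def[symmetric] c J_def[symmetric] \<beta>_def[symmetric] Z_def
    by (simp add: sum_distrib_left algebra_simps)
  have J0: "J \<noteq> {}" using m by (auto simp: J_def j_def vec_eq_iff)
  have "card J \<le> 2" using d card_mono[of UNIV J] by auto
  moreover have "card J \<noteq> 0" using J0 by simp
  ultimately consider "card J = 1" | "card J = 2" by linarith
  then have "B \<le> cmod Z"
  proof cases
    case 1
    then obtain i where J: "J = {i}" by (auto simp: card_1_singleton_iff)
    have "Z = \<beta> {} + (- \<i> * of_real (s i)) * of_real (\<beta> {i})"
      unfolding Z_def J by (simp add: Pow_insert)
    then have "Re Z = \<beta> {}" by simp
    then show ?thesis using \<beta>[of "{}"] complex_Re_le_cmod[of Z] by simp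
  next
    case 2
    then obtain i l where J: "J = {i, l}" "i \<noteq> l" by (auto simp: card_2_iff)
    have "Pow J = {{}, {i}, {l}, {i, l}}" using J by (auto simp: Pow_insert)
    then have Z: "Z = of_real (\<beta> {}) - \<i> * of_real (s i * \<beta> {i}) - \<i> * of_real (s l * \<beta> {l}) - of_real (s i * s l * \<beta> {i, l})"
      unfolding Z_def using J by (simp add: doubleton_eq_iff algebra_simps)
    have Re: "Re Z = \<beta> {} - s i * s l * \<beta> {i, l}" and Im: "Im Z = - (s i * \<beta> {i} + s l * \<beta> {l})"
      unfolding Z by simp_all
    have \<beta>s: "B \<le> \<beta> {}" "B \<le> \<beta> {i}" "B \<le> \<beta> {l}" "B \<le> \<beta> {i, l}" using \<beta> J by auto
    \<comment> \<open>Equal signs make the two terms of \<open>Im Z\<close> add up, opposite signs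
      those of \<open>Re Z\<close>.\<close>
    have "B \<le> \<bar>Re Z\<bar> \<or> B \<le> \<bar>Im Z\<bar>"
      unfolding Re Im using s[of i] s[of l] \<beta>s J \<open>B \<ge> 0\<close> by auto
    then show ?thesis using abs_Re_le_cmod[of Z] abs_Im_le_cmod[of Z] by linarith
  qed
  \<comment> \<open>The factor 1/2 in the claim is the normalization of \<open>expo_coeff\<close> at
    its worst, in dimension 2.\<close>
  have "sqrt 2 ^ CARD('d) \<le> sqrt 2 ^ 2" using d by (intro power_increasing) auto
  then have "1 / 2 \<le> 1 / sqrt 2 ^ CARD('d)" by (intro divide_left_mono) auto
  also have "\<dots> \<le> trig_weight j / sqrt 2 ^ CARD('d)"
    using trig_weight_bounds[of j] by (intro divide_right_mono) auto
  finally have "1 / 2 \<le> trig_weight j / sqrt 2 ^ CARD('d)" .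
  then have "1 / 2 * B \<le> trig_weight j / sqrt 2 ^ CARD('d) * cmod Z"
    using \<open>B \<le> cmod Z\<close> \<open>B \<ge> 0\<close> trig_weight_pos[of j]
    by (intro mult_mono) (auto intro: less_imp_le)
  then show ?thesis
    using trig_weight_pos[of j] unfolding f norm_mult norm_of_real by simp
qed

text \<open>The wave \<open>Re (expo m x)\<close> lies in the span of the \<open>trig j k\<close>
  with \<open>j = abs_freq m\<close>, and convolution multiplies its amplitude by
  \<open>cmod (fcoef a m)\<close>. On it the condition becomes the claim, since the common norm
  factor cancels.\<close>

lemma (in periodic_filter) cmod_fcoef_ge_singular:
  assumes "singular_values_ge a q"
  obtains c where "c > 0" "\<And>m. m \<noteq> 0 \<Longrightarrow> c * real (deg (abs_freq m)) powr (-q) \<le> cmod (fcoef a m)"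
proof -
  obtain c where c: "c > 0" "\<And>j t. j \<noteq> 0 \<Longrightarrow>
     c * real (deg j) powr (-q) * l2_norm (\<lambda>x. \<Sum>k\<in>K j. t k * trig j k x)
       \<le> l2_norm (conv a (\<lambda>x. \<Sum>k\<in>K j. t k * trig j k x))"
    using assms unfolding singular_values_ge_def by blast
  have "c * real (deg (abs_freq m)) powr (-q) \<le> cmod (fcoef a m)" if "m \<noteq> 0" for m
  proof -
    have "abs_freq m \<noteq> 0" using that by (simp add: abs_freq_eq_0_iff)
    from c(2)[OF this, of "\<lambda>k. Re (expo_coeff m k)"]
    have "c * real (deg (abs_freq m)) powr (-q) * l2_norm (\<lambda>x. Re (1 * expo m x))
      \<le> l2_norm (conv a (\<lambda>x. Re (1 * expo m x)))"
      by (simp add: Re_expo_eq_sum_trig)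
    also have "conv a (\<lambda>x. Re (1 * expo m x)) = (\<lambda>x. Re (1 * fcoef a m * expo m x))"
      by (rule ext) (rule conv_Re_expo)
    finally show ?thesis
      unfolding l2_norm_Re_expo[OF that] by (simp add: divide_le_cancel)
  qed
  then show ?thesis using c(1) that by blast
qed

section \<open>Laws determined by cosine transforms\<close>

lemma (in finite_measure) integrable_cos:
  "X \<in> borel_measurable M \<Longrightarrow> integrable M (\<lambda>x. cos (X x :: real))"
  by (rule integrable_const_bound[where B=1]) auto

text \<open>Cosines with arbitrary phase carry the whole characteristic function, since a sine is a
  cosine with phase \<open>- (pi / 2)\<close>. The factor \<open>c\<close> serves to normalize a
  finite measure to a probability.\<close>

lemma (in finite_measure) char_scaled_distr:
  assumes [measurable]: "X \<in> borel_measurable M" and "c > 0"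
  shows "char (density (distr M borel X) (\<lambda>_. ennreal c)) t
    = c * (complex_of_real (LINT x|M. cos (t * X x + 0)) + \<i> * complex_of_real (LINT x|M. cos (t * X x + - (pi / 2))))"
proof -
  have int: "integrable M (\<lambda>x. cos (t * X x))" "integrable M (\<lambda>x. sin (t * X x))"
    by (rule integrable_const_bound[where B=1]; simp)+
  have "char (density (distr M borel X) (\<lambda>_. ennreal c)) t = (CLINT x|M. c *\<^sub>R iexp (t * X x))"
    using \<open>c > 0\<close> unfolding char_def by (subst integral_density) (auto simp: integral_distr)
  also have "\<dots> = c * (CLINT x|M. iexp (t * X x))"
    by (simp add: scaleR_conv_of_real)
  also have "(\<lambda>x. iexp (t * X x)) = (\<lambda>x. complex_of_real (cos (t * X x)) + \<i> * complex_of_real (sin (t * X x)))"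
    by (simp add: exp_Euler flip: cos_of_real sin_of_real of_real_mult)
  also have "(CLINT x|M. complex_of_real (cos (t * X x)) + \<i> * complex_of_real (sin (t * X x)))
    = complex_of_real (LINT x|M. cos (t * X x)) + \<i> * complex_of_real (LINT x|M. sin (t * X x))"
  proof (subst Bochner_Integration.integral_add)
    show "integrable M (\<lambda>x. complex_of_real (cos (t * X x)))" using int(1) by (rule integrable_of_real)
    show "integrable M (\<lambda>x. \<i> * complex_of_real (sin (t * X x)))"
      using int(2) by (intro integrable_mult_right integrable_of_real)
  qed simp
  finally show ?thesis by (simp add: cos_diff)
qed

text \<open>Levy's theorem speaks of probability laws. At \<open>t = 0\<close> and phase zero the
  transform is the total mass, so both measures have the same mass and are normalized by it, unless
  it is zero and both vanish.\<close>

lemma distr_eq_of_cos: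
  fixes X :: "'a \<Rightarrow> real" and Y :: "'b \<Rightarrow> real"
  assumes M: "finite_measure M" and N: "finite_measure N"
    and X[measurable]: "X \<in> borel_measurable M" and Y[measurable]: "Y \<in> borel_measurable N"
    and cos: "\<And>t \<phi>. (LINT x|M. cos (t * X x + \<phi>)) = (LINT x|N. cos (t * Y x + \<phi>))"
  shows "distr M borel X = distr N borel Y"
proof -
  interpret M: finite_measure M by fact
  interpret N: finite_measure N by fact
  have mass: "measure M (space M) = measure N (space N)"
    using cos[of 0 0] by simp
  then have mass': "emeasure M (space M) = emeasure N (space N)"
    by (simp add: M.emeasure_eq_measure N.emeasure_eq_measure)
  show ?thesis
  proof (cases "measure M (space M) = 0")
    case True
    have "emeasure (distr M borel X) A = emeasure (distr N borel Y) A" if "A \<in> sets borel" for A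
    proof -
      have "emeasure (distr M borel X) A \<le> emeasure M (space M)"
        using that by (simp add: emeasure_distr emeasure_space)
      moreover have "emeasure (distr N borel Y) A \<le> emeasure N (space N)"
        using that by (simp add: emeasure_distr emeasure_space)
      ultimately show ?thesis
        using True mass by (simp add: M.emeasure_eq_measure N.emeasure_eq_measure)
    qed
    then show ?thesis by (intro measure_eqI) auto
  next
    case False
    define c where "c = 1 / measure M (space M)"
    have c: "c > 0" using False by (simp add: c_def zero_less_measure_iff)
    have pM: "real_distribution (density (distr M borel X) (\<lambda>_. ennreal c))"
      unfolding real_distribution_def real_distribution_axioms_def
    proof (intro conjI prob_spaceI)
      have "emeasure M (X -` UNIV \<inter> space M) = ennreal (measure M (space M))"
        by (simp add: M.emeasure_eq_measure)
      then show "emeasure (density (distr M borel X) (\<lambda>_. ennreal c)) (space (density (distr M borel X) (\<lambda>_. ennreal c))) = 1"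
        using c False by (simp add: emeasure_density nn_integral_cmult emeasure_distr c_def zero_less_measure_iff flip: ennreal_mult)
    qed simp
    have pN: "real_distribution (density (distr N borel Y) (\<lambda>_. ennreal c))"
      unfolding real_distribution_def real_distribution_axioms_def
    proof (intro conjI prob_spaceI)
      have "emeasure N (Y -` UNIV \<inter> space N) = ennreal (measure M (space M))"
        by (simp add: N.emeasure_eq_measure mass)
      then show "emeasure (density (distr N borel Y) (\<lambda>_. ennreal c)) (space (density (distr N borel Y) (\<lambda>_. ennreal c))) = 1"
        using c False by (simp add: emeasure_density nn_integral_cmult emeasure_distr c_def zero_less_measure_iff flip: ennreal_mult)
    qed simp
    have eq: "density (distr M borel X) (\<lambda>_. ennreal c) = density (distr N borel Y) (\<lambda>_. ennreal c)"
      by (rule Levy_uniqueness[OF pM pN])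
        (simp only: fun_eq_iff M.char_scaled_distr[OF X c] N.char_scaled_distr[OF Y c] cos, simp)
    show ?thesis
    proof (rule measure_eqI)
      fix A assume "A \<in> sets (distr M borel X)"
      then have [measurable]: "A \<in> sets borel" by simp
      have "ennreal c * emeasure (distr M borel X) A = ennreal c * emeasure (distr N borel Y) A"
        using arg_cong[OF eq, of "\<lambda>\<mu>. emeasure \<mu> A"] by (simp add: emeasure_density nn_integral_cmult)
      then show "emeasure (distr M borel X) A = emeasure (distr N borel Y) A"
        using c by (simp add: ennreal_mult_cancel_left)
    qed simp
  qed
qed

lemma (in finite_measure) finite_measure_density_bounded:
  assumes [measurable]: "g \<in> borel_measurable M" and "\<And>x. g x \<le> ennreal B"
  shows "finite_measure (density M g)"
proof
  have "(\<integral>\<^sup>+x. g x \<partial>M) \<le> (\<integral>\<^sup>+x. ennreal B \<partial>M)" using assms by (intro nn_integral_mono) auto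
  also have "\<dots> < \<infinity>" by (simp add: ennreal_mult_less_top emeasure_eq_measure)
  finally show "emeasure (density M g) (space (density M g)) \<noteq> \<infinity>"
    by (simp add: emeasure_density cong: nn_integral_cong_simp)
qed

lemma one_plus_cos_nonneg: "0 \<le> 1 + cos (x :: real)"
  using cos_ge_minus_one[of x] by linarith

text \<open>By product-to-sum the reweighting leads back to unweighted cosine transforms; the
  constant 1 makes the density nonnegative.\<close>

lemma (in finite_measure) integral_density_one_plus_cos:
  assumes [measurable]: "U \<in> borel_measurable M" "X \<in> borel_measurable M"
  shows "(LINT x|density M (\<lambda>x. ennreal (1 + cos (U x))). cos (X x))
    = (LINT x|M. cos (X x)) + ((LINT x|M. cos (X x + U x)) + (LINT x|M. cos (X x - U x))) / 2"
proof -
  have "(LINT x|density M (\<lambda>x. ennreal (1 + cos (U x))). cos (X x))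
    = (LINT x|M. cos (X x) + (cos (X x + U x) + cos (X x - U x)) / 2)"
    by (subst integral_density)
      (auto intro!: Bochner_Integration.integral_cong simp: one_plus_cos_nonneg cos_add cos_diff algebra_simps)
  then show ?thesis by (simp add: integrable_cos)
qed

lemma (in finite_measure) measure_density_one_plus_cos:
  assumes [measurable]: "U \<in> borel_measurable M" "S \<in> sets M"
  shows "measure (density M (\<lambda>x. ennreal (1 + cos (U x)))) S = measure M S + (LINT x|M. indicator S x * cos (U x))"
proof -
  have i: "integrable M (\<lambda>x. indicator S x * cos (U x))"
    by (rule integrable_const_bound[where B=1]) (auto split: split_indicator)
  have "measure (density M (\<lambda>x. ennreal (1 + cos (U x)))) S
    = (LINT x|density M (\<lambda>x. ennreal (1 + cos (U x))). indicator S x)"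
    by simp
  also have "\<dots> = (LINT x|M. (1 + cos (U x)) *\<^sub>R indicator S x)"
    by (rule integral_density) (simp_all add: one_plus_cos_nonneg)
  also have "\<dots> = (LINT x|M. indicator S x + indicator S x * cos (U x))"
    by (simp add: algebra_simps)
  finally show ?thesis using i by (simp add: emeasure_eq_measure)
qed

text \<open>The multivariate statement is reduced to the univariate one by reweighting with the
  nonnegative densities $1 + \cos(\sum_i c_i X_i + \varphi)$.\<close>

lemma emeasure_eq_of_cos:
  fixes X :: "'i \<Rightarrow> 'a \<Rightarrow> real" and Y :: "'i \<Rightarrow> 'b \<Rightarrow> real"
  assumes "finite J" and "finite_measure M" and "finite_measure N"
    and "\<And>i. i \<in> J \<Longrightarrow> X i \<in> borel_measurable M" and "\<And>i. i \<in> J \<Longrightarrow> Y i \<in> borel_measurable N"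
    and "\<And>i. i \<in> J \<Longrightarrow> B i \<in> sets borel"
    and "\<And>c \<phi>. (LINT x|M. cos ((\<Sum>i\<in>J. c i * X i x) + \<phi>)) = (LINT x|N. cos ((\<Sum>i\<in>J. c i * Y i x) + \<phi>))"
  shows "emeasure M {x \<in> space M. \<forall>i\<in>J. X i x \<in> B i} = emeasure N {x \<in> space N. \<forall>i\<in>J. Y i x \<in> B i}"
  using assms
proof (induction J arbitrary: M N rule: finite_induct)
  case empty
  interpret M: finite_measure M by fact
  interpret N: finite_measure N by fact
  from empty(6)[of _ 0] have "measure M (space M) = measure N (space N)" by simp
  then show ?case by (simp add: M.emeasure_eq_measure N.emeasure_eq_measure)
next
  case (insert i J)
  interpret M: finite_measure M by fact
  interpret N: finite_measure N by fact
  have [measurable]: "X i \<in> borel_measurable M" "Y i \<in> borel_measurable N" "B i \<in> sets borel"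
    using insert.prems by auto
  have X[measurable]: "X j \<in> borel_measurable M" if "j \<in> J" for j using insert.prems(3) that by auto
  have Y[measurable]: "Y j \<in> borel_measurable N" if "j \<in> J" for j using insert.prems(4) that by auto
  define u where "u c x = (\<Sum>j\<in>J. c j * X j x)" for c x
  define v where "v c x = (\<Sum>j\<in>J. c j * Y j x)" for c x
  have [measurable]: "u c \<in> borel_measurable M" "v c \<in> borel_measurable N" for c
    unfolding u_def v_def by measurable
  have hyp: "(LINT x|M. cos (t * X i x + u c x + \<phi>)) = (LINT x|N. cos (t * Y i x + v c x + \<phi>))" for t c \<phi>
  proof -
    have *: "(\<Sum>j\<in>insert i J. (c(i := t)) j * z j) = t * z i + (\<Sum>j\<in>J. c j * z j)" for z :: "'i \<Rightarrow> real"
      using insert.hyps by (auto intro!: sum.cong)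
    show ?thesis
      using insert.prems(6)[of "c(i := t)" \<phi>] unfolding * u_def v_def .
  qed
  have hyp_neg: "(LINT x|M. cos (t * X i x - u c x + \<phi>)) = (LINT x|N. cos (t * Y i x - v c x + \<phi>))" for t c \<phi>
  proof -
    have "u (\<lambda>j. - c j) x = - u c x" "v (\<lambda>j. - c j) y = - v c y" for x y
      by (simp_all add: u_def v_def sum_negf)
    then show ?thesis using hyp[of t "\<lambda>j. - c j" \<phi>] by simp
  qed
  have hyp0: "(LINT x|M. cos (t * X i x + \<phi>)) = (LINT x|N. cos (t * Y i x + \<phi>))" for t \<phi>
    using hyp[of t "\<lambda>_. 0" \<phi>] by (simp add: u_def v_def)
  define S where "S = X i -` B i \<inter> space M"
  define T where "T = Y i -` B i \<inter> space N"
  have [measurable]: "S \<in> sets M" "T \<in> sets N" unfolding S_def T_def by measurable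
  have ST: "measure M S = measure N T"
    using arg_cong[OF distr_eq_of_cos[OF insert.prems(1,2), of "X i" "Y i"], of "\<lambda>\<mu>. measure \<mu> (B i)"] hyp0
    by (simp add: measure_distr S_def T_def)
  \<comment> \<open>Reweighting adds to \<open>measure M S\<close> the integral of a cosine over
    \<open>S\<close>. As \<open>S\<close> and \<open>T\<close> have the same mass, these integrals
    agree too, and they are the cosine transforms of the measures restricted to \<open>S\<close> and
    \<open>T\<close>, to which the induction hypothesis is applied. Restriction is the reason for
    admitting arbitrary finite measures.\<close>
  have weighted: "(LINT x|M. indicator S x * cos (u c x + \<phi>)) = (LINT x|N. indicator T x * cos (v c x + \<phi>))" for c \<phi>
  proof -
    let ?M = "density M (\<lambda>x. ennreal (1 + cos (u c x + \<phi>)))"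
    let ?N = "density N (\<lambda>x. ennreal (1 + cos (v c x + \<phi>)))"
    have le: "ennreal (1 + cos r) \<le> ennreal 2" for r by (intro ennreal_leI) simp
    have "distr ?M borel (X i) = distr ?N borel (Y i)"
    proof (rule distr_eq_of_cos)
      show "finite_measure ?M" by (rule M.finite_measure_density_bounded[OF _ le]) measurable
      show "finite_measure ?N" by (rule N.finite_measure_density_bounded[OF _ le]) measurable
      fix t \<psi>
      have "(LINT x|?M. cos (t * X i x + \<psi>)) = (LINT x|M. cos (t * X i x + \<psi>))
        + ((LINT x|M. cos (t * X i x + u c x + (\<psi> + \<phi>))) + (LINT x|M. cos (t * X i x - u c x + (\<psi> - \<phi>)))) / 2"
        by (subst M.integral_density_one_plus_cos) (auto simp: algebra_simps)
      also have "\<dots> = (LINT x|N. cos (t * Y i x + \<psi>))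
        + ((LINT x|N. cos (t * Y i x + v c x + (\<psi> + \<phi>))) + (LINT x|N. cos (t * Y i x - v c x + (\<psi> - \<phi>)))) / 2"
        unfolding hyp hyp0 hyp_neg ..
      also have "\<dots> = (LINT x|?N. cos (t * Y i x + \<psi>))"
        by (subst N.integral_density_one_plus_cos) (auto simp: algebra_simps)
      finally show "(LINT x|?M. cos (t * X i x + \<psi>)) = (LINT x|?N. cos (t * Y i x + \<psi>))" .
    qed measurable
    from arg_cong[OF this, of "\<lambda>\<mu>. measure \<mu> (B i)"]
    have "measure ?M S = measure ?N T"
      by (simp add: measure_distr S_def T_def)
    then show ?thesis
      using ST by (simp add: M.measure_density_one_plus_cos N.measure_density_one_plus_cos)
  qed
  have "emeasure (density M (indicator S)) {x \<in> space (density M (indicator S)). \<forall>j\<in>J. X j x \<in> B j}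
    = emeasure (density N (indicator T)) {x \<in> space (density N (indicator T)). \<forall>j\<in>J. Y j x \<in> B j}"
  proof (rule insert.IH)
    show "finite_measure (density M (indicator S))"
      by (rule M.finite_measure_density_bounded[where B=1]) (auto split: split_indicator)
    show "finite_measure (density N (indicator T))"
      by (rule N.finite_measure_density_bounded[where B=1]) (auto split: split_indicator)
    show "X j \<in> borel_measurable (density M (indicator S))" if "j \<in> J" for j using X[OF that] by simp
    show "Y j \<in> borel_measurable (density N (indicator T))" if "j \<in> J" for j using Y[OF that] by simp
    show "B j \<in> sets borel" if "j \<in> J" for j using insert.prems(5) that by auto
    fix c \<phi>
    have "(LINT x|density M (indicator S). cos (u c x + \<phi>)) = (LINT x|M. indicator S x * cos (u c x + \<phi>))"
      using integral_density[of "\<lambda>x. cos (u c x + \<phi>)" M "indicator S"] by (simp add: ennreal_indicator)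
    also have "\<dots> = (LINT x|N. indicator T x * cos (v c x + \<phi>))" by (rule weighted)
    also have "\<dots> = (LINT x|density N (indicator T). cos (v c x + \<phi>))"
      using integral_density[of "\<lambda>x. cos (v c x + \<phi>)" N "indicator T"] by (simp add: ennreal_indicator)
    finally show "(LINT x|density M (indicator S). cos ((\<Sum>j\<in>J. c j * X j x) + \<phi>))
      = (LINT x|density N (indicator T). cos ((\<Sum>j\<in>J. c j * Y j x) + \<phi>))"
      by (simp add: u_def v_def)
  qed
  moreover have "emeasure (density M (indicator S)) {x \<in> space (density M (indicator S)). \<forall>j\<in>J. X j x \<in> B j}
    = emeasure M {x \<in> space M. \<forall>j\<in>insert i J. X j x \<in> B j}"
  proof -
    have [measurable]: "{x \<in> space M. \<forall>j\<in>J. X j x \<in> B j} \<in> sets M"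
    proof (rule sets.sets_Collect_finite_All[OF _ insert.hyps(1)])
      fix j assume "j \<in> J"
      then have "X j -` B j \<inter> space M \<in> sets M"
        using insert.prems(5) by (intro measurable_sets[OF X]) auto
      then show "{x \<in> space M. X j x \<in> B j} \<in> sets M" by (simp add: vimage_def Int_def conj_commute)
    qed
    have "emeasure (density M (indicator S)) {x \<in> space (density M (indicator S)). \<forall>j\<in>J. X j x \<in> B j}
      = emeasure M (S \<inter> {x \<in> space M. \<forall>j\<in>J. X j x \<in> B j})"
      by (simp add: emeasure_density indicator_inter_arith[symmetric])
    also have "S \<inter> {x \<in> space M. \<forall>j\<in>J. X j x \<in> B j} = {x \<in> space M. \<forall>j\<in>insert i J. X j x \<in> B j}"
      by (auto simp: S_def)
    finally show ?thesis .
  qed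
  moreover have "emeasure (density N (indicator T)) {x \<in> space (density N (indicator T)). \<forall>j\<in>J. Y j x \<in> B j}
    = emeasure N {x \<in> space N. \<forall>j\<in>insert i J. Y j x \<in> B j}"
  proof -
    have [measurable]: "{x \<in> space N. \<forall>j\<in>J. Y j x \<in> B j} \<in> sets N"
    proof (rule sets.sets_Collect_finite_All[OF _ insert.hyps(1)])
      fix j assume "j \<in> J"
      then have "Y j -` B j \<inter> space N \<in> sets N"
        using insert.prems(5) by (intro measurable_sets[OF Y]) auto
      then show "{x \<in> space N. Y j x \<in> B j} \<in> sets N" by (simp add: vimage_def Int_def conj_commute)
    qed
    have "emeasure (density N (indicator T)) {x \<in> space (density N (indicator T)). \<forall>j\<in>J. Y j x \<in> B j}
      = emeasure N (T \<inter> {x \<in> space N. \<forall>j\<in>J. Y j x \<in> B j})"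
      by (simp add: emeasure_density indicator_inter_arith[symmetric])
    also have "T \<inter> {x \<in> space N. \<forall>j\<in>J. Y j x \<in> B j} = {x \<in> space N. \<forall>j\<in>insert i J. Y j x \<in> B j}"
      by (auto simp: T_def)
    finally show ?thesis .
  qed
  ultimately show ?case by simp
qed

section \<open>Gaussian variables\<close>

lemma centered_gaussian_borel: "centered_gaussian P X v \<Longrightarrow> X \<in> borel_measurable P"
  by (simp add: centered_gaussian_def)

lemma integral_cos_gaussian:
  assumes "prob_space P" "centered_gaussian P X v" "v \<ge> 0"
  shows "(LINT x|P. cos (X x + \<phi>)) = exp (- v / 2) * cos \<phi>"
proof -
  interpret prob_space P by fact
  have [measurable]: "X \<in> borel_measurable P" using assms(2) by (rule centered_gaussian_borel)
  show ?thesis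
  proof (cases "v = 0")
    case True
    then have "AE x in P. X x = 0" using assms(2) by (simp add: centered_gaussian_def)
    then have "(LINT x|P. cos (X x + \<phi>)) = (LINT x|P. cos \<phi>)"
      by (intro integral_cong_AE) auto
    then show ?thesis using True by (simp add: prob_space)
  next
    case False
    then have v: "sqrt v > 0" using assms(3) by simp
    have "distributed P lborel X (normal_density 0 (sqrt v))"
      using assms(2) False by (simp add: centered_gaussian_def)
    then have "distributed P lborel (\<lambda>x. X x / sqrt v) std_normal_density"
      using normal_standard_normal_convert[OF v, of X 0] by simp
    from distributed_distr_eq_density[OF this]
    have d: "distr P lborel (\<lambda>x. X x / sqrt v) = std_normal_distribution" .
    have "char (distr P lborel (\<lambda>x. X x / sqrt v)) (sqrt v) = (CLINT x|P. iexp (sqrt v * (X x / sqrt v)))"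
      unfolding char_def by (subst integral_distr) auto
    also have "\<dots> = (CLINT x|P. complex_of_real (cos (X x)) + \<i> * complex_of_real (sin (X x)))"
      using v by (simp add: exp_Euler flip: cos_of_real sin_of_real of_real_mult)
    also have "\<dots> = complex_of_real (LINT x|P. cos (X x)) + \<i> * complex_of_real (LINT x|P. sin (X x))"
    proof (subst Bochner_Integration.integral_add)
      show "integrable P (\<lambda>x. complex_of_real (cos (X x)))" by (rule integrable_const_bound[where B=1]) auto
      show "integrable P (\<lambda>x. \<i> * complex_of_real (sin (X x)))" by (rule integrable_const_bound[where B=1]) (auto simp: norm_mult)
    qed simp
    finally have "complex_of_real (LINT x|P. cos (X x)) + \<i> * complex_of_real (LINT x|P. sin (X x))
      = complex_of_real (exp (- v / 2))"
      unfolding d char_std_normal_distribution using assms(3) by simp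
    then have cs: "(LINT x|P. cos (X x)) = exp (- v / 2)" "(LINT x|P. sin (X x)) = 0"
      by (simp_all add: complex_eq_iff)
    have int: "integrable P (\<lambda>x. cos (X x))" "integrable P (\<lambda>x. sin (X x))"
      by (rule integrable_const_bound[where B=1]; simp)+
    have "(LINT x|P. cos (X x + \<phi>)) = (LINT x|P. cos (X x) * cos \<phi> - sin (X x) * sin \<phi>)"
      by (simp add: cos_add)
    also have "\<dots> = exp (- v / 2) * cos \<phi>"
      using int by (simp add: cs)
    finally show ?thesis .
  qed
qed

text \<open>Completing the square: exponential tilting moves the mean by \<open>c * v\<close> and
  keeps the variance; the subtracted term is the normalization.\<close>

lemma exp_normal_density:
  assumes "v > 0"
  shows "normal_density 0 (sqrt v) x * exp (c * x - c\<^sup>2 * v / 2) = normal_density (c * v) (sqrt v) x"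
proof -
  have "- x\<^sup>2 / (2 * v) + (c * x - c\<^sup>2 * v / 2) = - (x - c * v)\<^sup>2 / (2 * v)"
    using assms by (simp add: field_simps power2_eq_square)
  then have "exp (- x\<^sup>2 / (2 * v)) * exp (c * x - c\<^sup>2 * v / 2) = exp (- (x - c * v)\<^sup>2 / (2 * v))"
    by (simp only: exp_add[symmetric])
  then show ?thesis using assms by (simp add: normal_density_def)
qed

lemma nn_integral_exp_gaussian:
  assumes "prob_space P" "centered_gaussian P X v" "v \<ge> 0"
  shows "(\<integral>\<^sup>+x. ennreal (exp (c * X x - c\<^sup>2 * v / 2)) \<partial>P) = 1"
proof -
  interpret prob_space P by fact
  have [measurable]: "X \<in> borel_measurable P" using assms(2) by (rule centered_gaussian_borel)
  show ?thesis
  proof (cases "v = 0")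
    case True
    then have "AE x in P. X x = 0" using assms(2) by (simp add: centered_gaussian_def)
    then have "(\<integral>\<^sup>+x. ennreal (exp (c * X x - c\<^sup>2 * v / 2)) \<partial>P) = (\<integral>\<^sup>+x. 1 \<partial>P)"
      using True by (intro nn_integral_cong_AE) auto
    then show ?thesis by (simp add: emeasure_space_1)
  next
    case False
    then have v: "v > 0" using assms(3) by simp
    have D: "distributed P lborel X (normal_density 0 (sqrt v))"
      using assms(2) False by (simp add: centered_gaussian_def)
    have "(\<integral>\<^sup>+x. ennreal (exp (c * X x - c\<^sup>2 * v / 2)) \<partial>P)
      = (\<integral>\<^sup>+x. ennreal (normal_density 0 (sqrt v) x) * ennreal (exp (c * x - c\<^sup>2 * v / 2)) \<partial>lborel)"
      by (rule distributed_nn_integral[OF D, symmetric]) measurable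
    also have "\<dots> = (\<integral>\<^sup>+x. ennreal (normal_density (c * v) (sqrt v) x) \<partial>lborel)"
      by (simp add: exp_normal_density[OF v] flip: ennreal_mult)
    also have "\<dots> = 1"
      using v by (subst nn_integral_eq_integral) auto
    finally show ?thesis .
  qed
qed

text \<open>Cameron-Martin on the line: tilting with \<open>c = 1\<close> moves the mean by the
  variance \<open>v\<close>.\<close>

lemma integral_exp_gaussian_shift:
  fixes g :: "real \<Rightarrow> real"
  assumes "prob_space P" "centered_gaussian P X v" "v > 0" and [measurable]: "g \<in> borel_measurable borel"
  shows "(LINT x|P. exp (X x - v / 2) * g (X x)) = (LINT x|P. g (X x + v))"
proof -
  have D: "distributed P lborel X (normal_density 0 (sqrt v))"
    using assms by (simp add: centered_gaussian_def)
  have "(LINT x|P. exp (X x - v / 2) * g (X x))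
    = (LINT x|lborel. normal_density 0 (sqrt v) x * (exp (x - v / 2) * g x))"
    by (rule distributed_integral[OF D, symmetric]) auto
  also have "\<dots> = (LINT x|lborel. normal_density v (sqrt v) x * g x)"
    using exp_normal_density[OF \<open>v > 0\<close>, of _ 1] by (simp flip: mult.assoc)
  also have "\<dots> = (LINT x|lborel. normal_density v (sqrt v) (v + 1 * x) * g (v + 1 * x))"
    by (subst lborel_integral_real_affine[of 1 _ v]) auto
  also have "\<dots> = (LINT x|lborel. normal_density 0 (sqrt v) x * g (x + v))"
    by (simp add: normal_density_def add.commute)
  also have "\<dots> = (LINT x|P. g (X x + v))"
    by (rule distributed_integral[OF D]) auto
  finally show ?thesis .
qed

lemma gaussian_second_moment:
  assumes "prob_space P" "centered_gaussian P X v" "v \<ge> 0"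
  shows "integrable P (\<lambda>x. (X x)\<^sup>2)" "(LINT x|P. (X x)\<^sup>2) = v"
proof -
  interpret prob_space P by fact
  have [measurable]: "X \<in> borel_measurable P" using assms(2) by (rule centered_gaussian_borel)
  have "integrable P (\<lambda>x. (X x)\<^sup>2) \<and> (LINT x|P. (X x)\<^sup>2) = v"
  proof (cases "v = 0")
    case True
    then have 0: "AE x in P. X x = 0" using assms(2) by (simp add: centered_gaussian_def)
    have "integrable P (\<lambda>x. (X x)\<^sup>2)"
      by (rule integrable_cong_AE_imp[of _ "\<lambda>_. 0"]) (use 0 in auto)
    moreover have "(LINT x|P. (X x)\<^sup>2) = 0" by (rule integral_eq_zero_AE) (use 0 in auto)
    ultimately show ?thesis using True by simp
  next
    case False
    then have v: "sqrt v > 0" using assms(3) by simp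
    have D: "distributed P lborel X (normal_density 0 (sqrt v))"
      using assms(2) False by (simp add: centered_gaussian_def)
    have "integrable lborel (\<lambda>x. normal_density 0 (sqrt v) x * x\<^sup>2)"
      using integrable_normal_moment[OF v, of 0 2] by simp
    then have "integrable P (\<lambda>x. (X x)\<^sup>2)"
      by (subst (asm) distributed_integrable[OF D]) auto
    moreover have "(LINT x|P. (X x)\<^sup>2) = v"
      using normal_distributed_variance[OF v D] normal_distributed_expectation[OF v D] assms(3) by simp
    ultimately show ?thesis by simp
  qed
  then show "integrable P (\<lambda>x. (X x)\<^sup>2)" "(LINT x|P. (X x)\<^sup>2) = v" by auto
qed

section \<open>White noise\<close>

lemma l2_norm_lin_comb_sq:
  assumes "h \<in> sq_int" "g \<in> sq_int"
  shows "(l2_norm (\<lambda>x. r * h x + t * g x))\<^sup>2 = r\<^sup>2 * (l2_norm h)\<^sup>2 + 2 * r * t * l2_inner h g + t\<^sup>2 * (l2_norm g)\<^sup>2"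
proof -
  have "(l2_norm (\<lambda>x. r * h x - (- t) * g x))\<^sup>2
    = (l2_norm (\<lambda>x. r * h x))\<^sup>2 - 2 * l2_inner (\<lambda>x. r * h x) (\<lambda>x. (- t) * g x) + (l2_norm (\<lambda>x. (- t) * g x))\<^sup>2"
    using assms by (intro l2_norm_diff_sq sq_int_cmult)
  moreover have "l2_inner (\<lambda>x. r * h x) (\<lambda>x. (- t) * g x) = - (r * t * l2_inner h g)"
    unfolding l2_inner_cmult_left l2_inner_commute[of h] by simp
  ultimately show ?thesis
    by (simp add: l2_norm_cmult power_mult_distrib l2_norm_cmult[of "- t", simplified])
qed

locale noise =
  fixes P :: "'w measure" and W :: "(real^'d \<Rightarrow> real) \<Rightarrow> 'w \<Rightarrow> real"
  assumes white_noise: "white_noise P W"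
begin

sublocale prob_space P
  using white_noise by (simp add: white_noise_def)

lemma gaussian_lin_comb:
  assumes "h \<in> sq_int" "g \<in> sq_int"
  shows "centered_gaussian P (\<lambda>\<omega>. r * W h \<omega> + t * W g \<omega>) ((l2_norm (\<lambda>x. r * h x + t * g x))\<^sup>2)"
  using white_noise assms
  by (simp add: white_noise_def centered_gaussian_pair_def l2_norm_lin_comb_sq mult.assoc)

lemma gaussian_noise: "h \<in> sq_int \<Longrightarrow> centered_gaussian P (W h) ((l2_norm h)\<^sup>2)"
  using gaussian_lin_comb[of h h 1 0] by simp

lemma borel_measurable_noise: "h \<in> sq_int \<Longrightarrow> W h \<in> borel_measurable P"
  using gaussian_noise centered_gaussian_borel by blast

lemma noise_second_moment:
  assumes "h \<in> sq_int"
  shows "integrable P (\<lambda>\<omega>. (W h \<omega>)\<^sup>2)" "expectation (\<lambda>\<omega>. (W h \<omega>)\<^sup>2) = (l2_norm h)\<^sup>2"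
  using gaussian_second_moment[OF prob_space_axioms gaussian_noise[OF assms]] by auto

lemma noise_covariance:
  assumes "h \<in> sq_int" "g \<in> sq_int"
  shows "integrable P (\<lambda>\<omega>. W h \<omega> * W g \<omega>)" "expectation (\<lambda>\<omega>. W h \<omega> * W g \<omega>) = l2_inner h g"
proof -
  have "centered_gaussian P (\<lambda>\<omega>. W h \<omega> + W g \<omega>) ((l2_norm (\<lambda>x. h x + g x))\<^sup>2)"
    using gaussian_lin_comb[OF assms, of 1 1] by simp
  note sum = gaussian_second_moment[OF prob_space_axioms this zero_le_power2]
  note hg = noise_second_moment[OF assms(1)] noise_second_moment[OF assms(2)]
  have eq: "W h \<omega> * W g \<omega> = ((W h \<omega> + W g \<omega>)\<^sup>2 - (W h \<omega>)\<^sup>2 - (W g \<omega>)\<^sup>2) / 2" for \<omega>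
    by (simp add: power2_sum)
  show "integrable P (\<lambda>\<omega>. W h \<omega> * W g \<omega>)"
    unfolding eq using sum hg by (intro integrable_divide Bochner_Integration.integrable_diff)
  have "expectation (\<lambda>\<omega>. W h \<omega> * W g \<omega>) = ((l2_norm (\<lambda>x. h x + g x))\<^sup>2 - (l2_norm h)\<^sup>2 - (l2_norm g)\<^sup>2) / 2"
    unfolding eq using sum hg by simp
  then show "expectation (\<lambda>\<omega>. W h \<omega> * W g \<omega>) = l2_inner h g"
    using l2_norm_lin_comb_sq[OF assms, of 1 1] by simp
qed

text \<open>\<open>white_noise\<close> does not postulate linearity, but it prescribes covariances,
  and by them the difference \<open>D\<close> has second moment zero. The exceptional null set
  depends on \<open>r\<close>, \<open>h\<close> and \<open>g\<close>.\<close>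

lemma noise_lin_comb_AE:
  assumes h: "h \<in> sq_int" and g: "g \<in> sq_int"
  shows "AE \<omega> in P. W (\<lambda>x. r * h x + g x) \<omega> = r * W h \<omega> + W g \<omega>"
proof -
  define u where "u = (\<lambda>x. r * h x + g x)"
  have u: "u \<in> sq_int" unfolding u_def using h g by (intro sq_int_add sq_int_cmult)
  have inner: "l2_inner u v = r * l2_inner h v + l2_inner g v" if "v \<in> sq_int" for v
    unfolding u_def using h g that by (simp add: l2_inner_add_left sq_int_cmult l2_inner_cmult_left)
  define D where "D \<omega> = W u \<omega> - r * W h \<omega> - W g \<omega>" for \<omega>
  have D: "(D \<omega>)\<^sup>2 = W u \<omega> * W u \<omega> - 2 * r * (W u \<omega> * W h \<omega>) - 2 * (W u \<omega> * W g \<omega>)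
    + r\<^sup>2 * (W h \<omega> * W h \<omega>) + 2 * r * (W h \<omega> * W g \<omega>) + W g \<omega> * W g \<omega>" for \<omega>
    by (simp add: D_def power2_eq_square algebra_simps)
  note int = noise_covariance(1)[OF u u] noise_covariance(1)[OF u h] noise_covariance(1)[OF u g]
    noise_covariance(1)[OF h h] noise_covariance(1)[OF h g] noise_covariance(1)[OF g g]
  have "expectation (\<lambda>\<omega>. (D \<omega>)\<^sup>2) = 0"
  proof -
    have gh: "l2_inner g h = l2_inner h g" by (rule l2_inner_commute)
    have uh: "l2_inner u h = r * l2_inner h h + l2_inner h g" using inner[OF h] gh by simp
    have ug: "l2_inner u g = r * l2_inner h g + l2_inner g g" using inner[OF g] .
    have uu: "l2_inner u u = r * l2_inner u h + l2_inner u g"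
      using inner[OF u] l2_inner_commute[of h u] l2_inner_commute[of g u] by simp
    have "expectation (\<lambda>\<omega>. (D \<omega>)\<^sup>2) = l2_inner u u - 2 * r * l2_inner u h - 2 * l2_inner u g
      + r\<^sup>2 * l2_inner h h + 2 * r * l2_inner h g + l2_inner g g"
      unfolding D using int
      by (simp add: noise_covariance(2)[OF u u] noise_covariance(2)[OF u h] noise_covariance(2)[OF u g]
          noise_covariance(2)[OF h h] noise_covariance(2)[OF h g] noise_covariance(2)[OF g g])
    also have "\<dots> = 0"
      unfolding uu uh ug by (simp add: algebra_simps power2_eq_square)
    finally show ?thesis .
  qed
  moreover have "integrable P (\<lambda>\<omega>. (D \<omega>)\<^sup>2)"
    unfolding D using int by (intro Bochner_Integration.integrable_add Bochner_Integration.integrable_diff integrable_mult_right)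
  ultimately have "AE \<omega> in P. (D \<omega>)\<^sup>2 = 0"
    by (subst (asm) integral_nonneg_eq_0_iff_AE) auto
  then have "AE \<omega> in P. W u \<omega> = r * W h \<omega> + W g \<omega>"
    by eventually_elim (simp add: D_def)
  then show ?thesis by (simp only: u_def)
qed

text \<open>Extends pairwise Gaussianity to finite families: a linear combination of several
  \<open>W (h i)\<close> is almost surely a single value of \<open>W\<close>, hence
  Gaussian.\<close>

lemma noise_sum_AE:
  assumes "finite J" "\<And>i. i \<in> J \<Longrightarrow> h i \<in> sq_int"
  shows "AE \<omega> in P. W (\<lambda>x. \<Sum>i\<in>J. c i * h i x) \<omega> = (\<Sum>i\<in>J. c i * W (h i) \<omega>)"
  using assms
proof (induction J rule: finite_induct)
  case empty
  have "l2_norm (\<lambda>_ :: real^'d. 0) = 0" by (simp add: l2_norm_def)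
  then show ?case using gaussian_noise[OF sq_int_zero] by (simp add: centered_gaussian_def)
next
  case (insert i J)
  have "(\<lambda>x. \<Sum>i\<in>J. c i * h i x) \<in> sq_int"
    using insert.prems by (intro sq_int_sum sq_int_cmult) auto
  from noise_lin_comb_AE[OF insert.prems[of i] this, of "c i"]
  have 1: "AE \<omega> in P. W (\<lambda>x. c i * h i x + (\<Sum>i\<in>J. c i * h i x)) \<omega>
    = c i * W (h i) \<omega> + W (\<lambda>x. \<Sum>i\<in>J. c i * h i x) \<omega>" by simp
  have 2: "AE \<omega> in P. W (\<lambda>x. \<Sum>i\<in>J. c i * h i x) \<omega> = (\<Sum>i\<in>J. c i * W (h i) \<omega>)"
    using insert.prems by (intro insert.IH) auto
  from 1 2 show ?case
    by eventually_elim (simp add: insert.hyps)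
qed

lemma integrable_exp_noise:
  assumes v: "v \<in> sq_int"
  shows "(\<integral>\<^sup>+\<omega>. ennreal (exp (W v \<omega> - (l2_norm v)\<^sup>2 / 2)) \<partial>P) = 1"
    and "integrable P (\<lambda>\<omega>. exp (W v \<omega> - (l2_norm v)\<^sup>2 / 2))"
proof -
  note [measurable] = borel_measurable_noise[OF v]
  show 1: "(\<integral>\<^sup>+\<omega>. ennreal (exp (W v \<omega> - (l2_norm v)\<^sup>2 / 2)) \<partial>P) = 1"
    using nn_integral_exp_gaussian[OF prob_space_axioms gaussian_noise[OF v], of 1] by simp
  show "integrable P (\<lambda>\<omega>. exp (W v \<omega> - (l2_norm v)\<^sup>2 / 2))"
    by (rule integrableI_nonneg) (auto simp: 1)
qed

text \<open>The residual \<open>\<eta>\<close> of the regression of \<open>W h\<close> on \<open>W v\<close> is independent of \<open>W v\<close>; the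
  independence is read off from cosine transforms.\<close>

lemma integral_exp_noise_cos:
  assumes v: "v \<in> sq_int" and h: "h \<in> sq_int"
  shows "expectation (\<lambda>\<omega>. exp (W v \<omega> - (l2_norm v)\<^sup>2 / 2) * cos (W h \<omega> + \<phi>))
    = exp (- (l2_norm h)\<^sup>2 / 2) * cos (l2_inner h v + \<phi>)"
proof -
  note [measurable] = borel_measurable_noise[OF v] borel_measurable_noise[OF h]
  define s where "s = (l2_norm v)\<^sup>2"
  show ?thesis
  proof (cases "l2_norm v = 0")
    case True
    have "l2_inner h v = 0" using l2_Cauchy_Schwarz[OF h v] True by simp
    moreover have "AE \<omega> in P. W v \<omega> = 0" using gaussian_noise[OF v] True by (simp add: centered_gaussian_def)
    then have "expectation (\<lambda>\<omega>. exp (W v \<omega> - (l2_norm v)\<^sup>2 / 2) * cos (W h \<omega> + \<phi>))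
      = expectation (\<lambda>\<omega>. cos (W h \<omega> + \<phi>))"
      using True by (intro integral_cong_AE) auto
    ultimately show ?thesis
      using integral_cos_gaussian[OF prob_space_axioms gaussian_noise[OF h]] by simp
  next
    case False
    then have s: "s > 0" by (simp add: s_def)
    define \<rho> where "\<rho> = l2_inner h v"
    \<comment> \<open>The regression coefficient: with it \<open>\<eta>\<close> and \<open>X\<close>
      are uncorrelated, so the variance in \<open>G\<close> has no cross term, and
      \<open>\<kappa>\<close> is the residual variance.\<close>
    define \<beta> where "\<beta> = \<rho> / s"
    define \<kappa> where "\<kappa> = (l2_norm (\<lambda>x. - \<beta> * v x + 1 * h x))\<^sup>2"
    define X where "X = W v"
    define \<eta> where "\<eta> \<omega> = W h \<omega> - \<beta> * X \<omega>" for \<omega>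
    have [measurable]: "X \<in> borel_measurable P" "\<eta> \<in> borel_measurable P"
      unfolding X_def \<eta>_def by measurable
    have \<beta>s: "\<beta> * s = \<rho>" using s by (simp add: \<beta>_def)
    have \<kappa>: "\<kappa> = (l2_norm h)\<^sup>2 - \<beta> * \<rho>"
      unfolding \<kappa>_def l2_norm_lin_comb_sq[OF v h] s_def[symmetric]
      by (simp add: power2_eq_square l2_inner_commute[of v] \<rho>_def[symmetric] mult.assoc \<beta>s)
    have G: "centered_gaussian P (\<lambda>\<omega>. r * X \<omega> + t * \<eta> \<omega>) (r\<^sup>2 * s + t\<^sup>2 * \<kappa>)" for r t
    proof -
      have "(\<lambda>\<omega>. (r - t * \<beta>) * W v \<omega> + t * W h \<omega>) = (\<lambda>\<omega>. r * X \<omega> + t * \<eta> \<omega>)"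
        by (simp add: X_def \<eta>_def algebra_simps)
      moreover have "(l2_norm (\<lambda>x. (r - t * \<beta>) * v x + t * h x))\<^sup>2 = r\<^sup>2 * s + t\<^sup>2 * \<kappa>"
        unfolding l2_norm_lin_comb_sq[OF v h] s_def[symmetric] \<kappa> l2_inner_commute[of v] \<rho>_def[symmetric] \<beta>s[symmetric]
        by (simp add: power2_eq_square algebra_simps)
      ultimately show ?thesis using gaussian_lin_comb[OF v h, of "r - t * \<beta>" t] by simp
    qed
    have \<kappa>0: "\<kappa> \<ge> 0" by (simp add: \<kappa>_def)
    have cosE: "expectation (\<lambda>\<omega>. cos (r * X \<omega> + t * \<eta> \<omega> + \<psi>)) = exp (- (r\<^sup>2 * s + t\<^sup>2 * \<kappa>) / 2) * cos \<psi>" for r t \<psi>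
      using s \<kappa>0 by (intro integral_cos_gaussian[OF prob_space_axioms G]) auto
    \<comment> \<open>Reweighting by \<open>1 + cos (\<eta> \<omega> + \<phi>)\<close> changes the
      law of \<open>X\<close> only by the constant \<open>k\<close>, the mean of the weight. Thus
      cosine transforms yield the factorization also for unbounded integrable \<open>g\<close>, such
      as the exponential density.\<close>
    have indep: "expectation (\<lambda>\<omega>. g (X \<omega>) * cos (\<eta> \<omega> + \<phi>)) = exp (- \<kappa> / 2) * cos \<phi> * expectation (\<lambda>\<omega>. g (X \<omega>))"
      if [measurable]: "g \<in> borel_measurable borel" and int: "integrable P (\<lambda>\<omega>. g (X \<omega>))" for g :: "real \<Rightarrow> real" and \<phi>
    proof -
      define k where "k = 1 + exp (- \<kappa> / 2) * cos \<phi>"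
      have "\<bar>exp (- \<kappa> / 2) * cos \<phi>\<bar> \<le> 1 * 1"
        unfolding abs_mult using \<kappa>0 by (intro mult_mono) auto
      then have k: "k \<ge> 0" by (simp add: k_def)
      let ?M = "density P (\<lambda>\<omega>. ennreal (1 + cos (\<eta> \<omega> + \<phi>)))"
      let ?N = "density P (\<lambda>\<omega>. ennreal k)"
      have le: "ennreal (1 + cos r) \<le> ennreal 2" for r by (intro ennreal_leI) simp
      have "distr ?M borel X = distr ?N borel X"
      proof (rule distr_eq_of_cos)
        show "finite_measure ?M"
          by (rule finite_measure_density_bounded[OF _ le]) measurable
        show "finite_measure ?N"
          by (rule finite_measure_density_bounded[where B=k]) auto
        fix t \<psi>
        have "(LINT \<omega>|?M. cos (t * X \<omega> + \<psi>)) = expectation (\<lambda>\<omega>. cos (t * X \<omega> + 0 * \<eta> \<omega> + \<psi>))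
          + (expectation (\<lambda>\<omega>. cos (t * X \<omega> + 1 * \<eta> \<omega> + (\<psi> + \<phi>))) + expectation (\<lambda>\<omega>. cos (t * X \<omega> + (- 1) * \<eta> \<omega> + (\<psi> - \<phi>)))) / 2"
          by (subst integral_density_one_plus_cos) (auto simp: algebra_simps)
        also have "\<dots> = k * (exp (- (t\<^sup>2 * s) / 2) * cos \<psi>)"
          unfolding cosE by (simp add: k_def cos_add cos_diff exp_add[symmetric] algebra_simps add_divide_distrib diff_divide_distrib)
        also have "\<dots> = k * expectation (\<lambda>\<omega>. cos (t * X \<omega> + 0 * \<eta> \<omega> + \<psi>))"
          unfolding cosE by simp
        also have "\<dots> = (LINT \<omega>|?N. cos (t * X \<omega> + \<psi>))"
          using k by (subst integral_density) auto
        finally show "(LINT \<omega>|?M. cos (t * X \<omega> + \<psi>)) = (LINT \<omega>|?N. cos (t * X \<omega> + \<psi>))" .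
      qed measurable
      from arg_cong[OF this, of "\<lambda>\<mu>. integral\<^sup>L \<mu> g"]
      have "(LINT \<omega>|?M. g (X \<omega>)) = (LINT \<omega>|?N. g (X \<omega>))"
        by (simp add: integral_distr)
      moreover have "(LINT \<omega>|?M. g (X \<omega>)) = expectation (\<lambda>\<omega>. (1 + cos (\<eta> \<omega> + \<phi>)) *\<^sub>R g (X \<omega>))"
        by (rule integral_density) (auto simp: one_plus_cos_nonneg)
      moreover have "(LINT \<omega>|?N. g (X \<omega>)) = expectation (\<lambda>\<omega>. k *\<^sub>R g (X \<omega>))"
        by (rule integral_density) (auto simp: k)
      moreover have "integrable P (\<lambda>\<omega>. g (X \<omega>) * cos (\<eta> \<omega> + \<phi>))"
        by (rule Bochner_Integration.integrable_bound[OF int]) (auto simp: abs_mult mult_left_le)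
      ultimately show ?thesis
        using int by (simp add: distrib_right mult.commute[of "cos _"] k_def)
    qed
    have int: "integrable P (\<lambda>\<omega>. exp (X \<omega> - s / 2))"
      using integrable_exp_noise[OF v] by (simp add: X_def s_def)
    have intc: "integrable P (\<lambda>\<omega>. exp (X \<omega> - s / 2) * cos (\<beta> * X \<omega> + \<psi>))" for \<psi>
      by (rule Bochner_Integration.integrable_bound[OF int]) (auto simp: abs_mult mult_left_le)
    have Ec: "expectation (\<lambda>\<omega>. exp (X \<omega> - s / 2) * cos (\<beta> * X \<omega> + \<psi>)) = exp (- (\<beta>\<^sup>2 * s) / 2) * cos (\<rho> + \<psi>)" for \<psi>
    proof -
      have "expectation (\<lambda>\<omega>. exp (X \<omega> - s / 2) * cos (\<beta> * X \<omega> + \<psi>)) = expectation (\<lambda>\<omega>. cos (\<beta> * (X \<omega> + s) + \<psi>))"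
        using gaussian_noise[OF v] unfolding X_def
        by (intro integral_exp_gaussian_shift[OF prob_space_axioms _ s]) (auto simp: s_def)
      also have "\<dots> = expectation (\<lambda>\<omega>. cos (\<beta> * X \<omega> + 0 * \<eta> \<omega> + (\<rho> + \<psi>)))"
        by (simp add: \<beta>s[symmetric] algebra_simps)
      finally show ?thesis unfolding cosE by simp
    qed
    \<comment> \<open>Sines are written as cosines with a shifted phase, so that
      \<open>indep\<close> and \<open>Ec\<close> cover both terms of the addition formula.\<close>
    have split: "exp (X \<omega> - s / 2) * cos (W h \<omega> + \<phi>)
      = exp (X \<omega> - s / 2) * cos (\<beta> * X \<omega> + 0) * cos (\<eta> \<omega> + \<phi>)
        + exp (X \<omega> - s / 2) * cos (\<beta> * X \<omega> + pi / 2) * cos (\<eta> \<omega> + (\<phi> - pi / 2))" for \<omega>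
    proof -
      have "W h \<omega> + \<phi> = \<beta> * X \<omega> + (\<eta> \<omega> + \<phi>)" by (simp add: \<eta>_def)
      then have c1: "cos (W h \<omega> + \<phi>)
        = cos (\<beta> * X \<omega>) * cos (\<eta> \<omega> + \<phi>) - sin (\<beta> * X \<omega>) * sin (\<eta> \<omega> + \<phi>)"
        by (simp only: cos_add)
      have c2: "cos (\<beta> * X \<omega> + pi / 2) = - sin (\<beta> * X \<omega>)" by (simp add: cos_add)
      have c3: "cos (\<eta> \<omega> + (\<phi> - pi / 2)) = sin (\<eta> \<omega> + \<phi>)"
        using cos_diff[of "\<eta> \<omega> + \<phi>" "pi / 2"] by (simp add: add_diff_eq)
      show ?thesis unfolding c1 c2 c3 by (simp add: right_diff_distrib mult.assoc)
    qed
    have int2: "integrable P (\<lambda>\<omega>. exp (X \<omega> - s / 2) * cos (\<beta> * X \<omega> + \<psi>) * cos (\<eta> \<omega> + \<psi>'))" for \<psi> \<psi>'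
      by (rule Bochner_Integration.integrable_bound[OF intc[of \<psi>]]) (auto simp: abs_mult mult_left_le)
    have "expectation (\<lambda>\<omega>. exp (X \<omega> - s / 2) * cos (W h \<omega> + \<phi>))
      = exp (- \<kappa> / 2) * cos \<phi> * (exp (- (\<beta>\<^sup>2 * s) / 2) * cos (\<rho> + 0))
        + exp (- \<kappa> / 2) * cos (\<phi> - pi / 2) * (exp (- (\<beta>\<^sup>2 * s) / 2) * cos (\<rho> + pi / 2))"
      unfolding split using indep[of "\<lambda>x. exp (x - s / 2) * cos (\<beta> * x + 0)" \<phi>]
        indep[of "\<lambda>x. exp (x - s / 2) * cos (\<beta> * x + pi / 2)" "\<phi> - pi / 2"]
      by (subst Bochner_Integration.integral_add) (simp_all only: int2 intc Ec, measurable)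
    also have "\<dots> = exp (- \<kappa> / 2) * exp (- (\<beta>\<^sup>2 * s) / 2) * cos (\<rho> + \<phi>)"
      by (simp add: cos_add cos_diff algebra_simps)
    also have "exp (- \<kappa> / 2) * exp (- (\<beta>\<^sup>2 * s) / 2) = exp (- (l2_norm h)\<^sup>2 / 2)"
      unfolding exp_add[symmetric] \<kappa> \<beta>s[symmetric] by (simp add: power2_eq_square field_simps)
    finally show ?thesis by (simp add: X_def s_def \<rho>_def)
  qed
qed

text \<open>Cylinder sets determine a finite measure on the product space, and a cylinder involves
  finitely many \<open>h\<close>, so their linear combinations decide. The drift \<open>A\<close> is
  arbitrary, which permits a shift between any two signals.\<close>

lemma Cameron_Martin:
  fixes A :: "(real^'d \<Rightarrow> real) \<Rightarrow> real"
  assumes v: "v \<in> sq_int"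
  shows "distr (density P (\<lambda>\<omega>. ennreal (exp (W v \<omega> - (l2_norm v)\<^sup>2 / 2)))) data_space
      (\<lambda>\<omega>. \<lambda>h\<in>sq_int. A h + r * W h \<omega>)
    = distr P data_space (\<lambda>\<omega>. \<lambda>h\<in>sq_int. A h + r * l2_inner h v + r * W h \<omega>)"
    (is "distr ?M _ ?Y = distr _ _ ?Z")
proof -
  note W[measurable] = borel_measurable_noise
  note [measurable] = W[OF v]
  have M: "prob_space ?M"
  proof
    show "emeasure ?M (space ?M) = 1"
      using integrable_exp_noise(1)[OF v] by (simp add: emeasure_density cong: nn_integral_cong_simp)
  qed
  have Y: "?Y \<in> measurable ?M data_space" and Z: "?Z \<in> measurable P data_space"
    unfolding data_space_def by (intro measurable_restrict; simp)+
  show ?thesis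
  proof (rule measure_eqI_PiM_infinite[where I=sq_int and M="\<lambda>_. borel"])
    show "sets (distr ?M data_space ?Y) = sets (PiM sq_int (\<lambda>_. borel))"
      "sets (distr P data_space ?Z) = sets (PiM sq_int (\<lambda>_. borel))"
      by (simp_all add: data_space_def)
    show "finite_measure (distr ?M data_space ?Y)"
      using prob_space.prob_space_distr[OF M Y] by (rule prob_space.finite_measure)
    fix B :: "(real^'d \<Rightarrow> real) \<Rightarrow> real set" and J
    assume J: "finite J" "J \<subseteq> sq_int" and B: "\<And>h. h \<in> J \<Longrightarrow> B h \<in> sets borel"
    have E: "prod_emb sq_int (\<lambda>_. borel) J (Pi\<^sub>E J B) \<in> sets data_space"
      unfolding data_space_def using J B by (intro sets_PiM_I) auto
    have vim: "U -` prod_emb sq_int (\<lambda>_. borel) J (Pi\<^sub>E J B) \<inter> \<Omega> = {\<omega>\<in>\<Omega>. \<forall>h\<in>J. u h \<omega> \<in> B h}"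
      if U: "U = (\<lambda>\<omega>. \<lambda>h\<in>sq_int. u h \<omega>)" for U u and \<Omega> :: "'w set"
      using J(2) unfolding U prod_emb_def subset_iff
      by (auto simp: PiE_iff restrict_def extensional_def)
    have "emeasure ?M {\<omega>\<in>space ?M. \<forall>h\<in>J. A h + r * W h \<omega> \<in> B h}
      = emeasure P {\<omega>\<in>space P. \<forall>h\<in>J. A h + r * l2_inner h v + r * W h \<omega> \<in> B h}"
    proof (rule emeasure_eq_of_cos[OF J(1)])
      show "finite_measure ?M" using M by (rule prob_space.finite_measure)
      show "finite_measure P" by (rule finite_measure_axioms)
      show "(\<lambda>\<omega>. A h + r * W h \<omega>) \<in> borel_measurable ?M"
        "(\<lambda>\<omega>. A h + r * l2_inner h v + r * W h \<omega>) \<in> borel_measurable P" if "h \<in> J" for h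
        using W[of h] J that by auto
      show "B h \<in> sets borel" if "h \<in> J" for h using B that by auto
      fix c \<phi>
      \<comment> \<open>Collapses the linear combination to one function, so that only transforms of
        a single Gaussian variable remain to be compared.\<close>
      define H where "H = (\<lambda>x. \<Sum>h\<in>J. (c h * r) * h x)"
      have Hs: "H \<in> sq_int" unfolding H_def using J by (intro sq_int_sum sq_int_cmult) auto
      have AE: "AE \<omega> in P. W H \<omega> = (\<Sum>h\<in>J. (c h * r) * W h \<omega>)"
        unfolding H_def using J by (intro noise_sum_AE) auto
      have inner: "(\<Sum>h\<in>J. c h * (r * l2_inner h v)) = l2_inner H v"
      proof -
        have "l2_inner H v = (\<Sum>h\<in>J. l2_inner (\<lambda>x. (c h * r) * h x) v)"
          unfolding H_def using J v by (intro l2_inner_sum_left sq_int_cmult) auto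
        then show ?thesis by (simp only: l2_inner_cmult_left mult.assoc)
      qed
      define a where "a = (\<Sum>h\<in>J. c h * A h)"
      have split: "(\<Sum>h\<in>J. c h * (A h + r * W h \<omega>)) = (\<Sum>h\<in>J. c h * r * W h \<omega>) + a" for \<omega>
        by (simp add: a_def distrib_left sum.distrib mult.assoc)
      have mJ: "(\<lambda>\<omega>. \<Sum>h\<in>J. c h * (A h + r * W h \<omega>)) \<in> borel_measurable P"
        using J by (intro borel_measurable_sum) (auto intro!: borel_measurable_times borel_measurable_add W)
      note [measurable] = W[OF Hs] mJ
      have "(LINT \<omega>|?M. cos ((\<Sum>h\<in>J. c h * (A h + r * W h \<omega>)) + \<phi>))
        = expectation (\<lambda>\<omega>. exp (W v \<omega> - (l2_norm v)\<^sup>2 / 2) *\<^sub>R cos ((\<Sum>h\<in>J. c h * (A h + r * W h \<omega>)) + \<phi>))"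
        by (rule integral_density) auto
      also have "\<dots> = expectation (\<lambda>\<omega>. exp (W v \<omega> - (l2_norm v)\<^sup>2 / 2) * cos (W H \<omega> + (a + \<phi>)))"
      proof (rule integral_cong_AE)
        show "AE \<omega> in P. exp (W v \<omega> - (l2_norm v)\<^sup>2 / 2) *\<^sub>R cos ((\<Sum>h\<in>J. c h * (A h + r * W h \<omega>)) + \<phi>)
          = exp (W v \<omega> - (l2_norm v)\<^sup>2 / 2) * cos (W H \<omega> + (a + \<phi>))"
          using AE by eventually_elim (simp add: split add.assoc)
      qed measurable
      also have "\<dots> = exp (- (l2_norm H)\<^sup>2 / 2) * cos (l2_inner H v + (a + \<phi>))"
        by (rule integral_exp_noise_cos[OF v Hs])
      also have "\<dots> = expectation (\<lambda>\<omega>. cos (W H \<omega> + (l2_inner H v + (a + \<phi>))))"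
        by (rule integral_cos_gaussian[OF prob_space_axioms gaussian_noise[OF Hs] zero_le_power2, symmetric])
      also have "\<dots> = expectation (\<lambda>\<omega>. cos ((\<Sum>h\<in>J. c h * (A h + r * W h \<omega>)) + l2_inner H v + \<phi>))"
      proof (rule integral_cong_AE)
        show "AE \<omega> in P. cos (W H \<omega> + (l2_inner H v + (a + \<phi>)))
          = cos ((\<Sum>h\<in>J. c h * (A h + r * W h \<omega>)) + l2_inner H v + \<phi>)"
          using AE by eventually_elim (simp add: split ac_simps)
      qed measurable
      also have "\<dots> = expectation (\<lambda>\<omega>. cos ((\<Sum>h\<in>J. c h * (A h + r * l2_inner h v + r * W h \<omega>)) + \<phi>))"
        unfolding inner[symmetric] by (simp add: distrib_left sum.distrib algebra_simps)
      finally show "(LINT \<omega>|?M. cos ((\<Sum>h\<in>J. c h * (A h + r * W h \<omega>)) + \<phi>))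
        = expectation (\<lambda>\<omega>. cos ((\<Sum>h\<in>J. c h * (A h + r * l2_inner h v + r * W h \<omega>)) + \<phi>))" .
    qed
    then show "emeasure (distr ?M data_space ?Y) (prod_emb sq_int (\<lambda>_. borel) J (Pi\<^sub>E J B))
      = emeasure (distr P data_space ?Z) (prod_emb sq_int (\<lambda>_. borel) J (Pi\<^sub>E J B))"
      by (simp only: emeasure_distr[OF Y E] emeasure_distr[OF Z E] vim[OF refl])
  qed
qed

end

section \<open>Risk of the delta-net estimator\<close>

locale deconvolution = noise P W + periodic_filter a
  for P :: "'w measure" and W :: "(real^'d \<Rightarrow> real) \<Rightarrow> 'w \<Rightarrow> real" and a :: "real^'d \<Rightarrow> real"
begin

lemma observation_apply:
  "h \<in> sq_int \<Longrightarrow> observation a W n f \<omega> h = l2_inner h (conv a f) + real n powr (-1/2) * W h \<omega>"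
  by (simp add: observation_def)

lemma measurable_observation: "observation a W n f \<in> measurable P data_space"
  unfolding observation_def data_space_def using borel_measurable_noise
  by (intro measurable_restrict) simp

lemma observation_space: "\<omega> \<in> space P \<Longrightarrow> observation a W n f \<omega> \<in> space data_space"
  by (rule measurable_space[OF measurable_observation])

lemma gaussian_noise_diff:
  assumes "h \<in> sq_int" "g \<in> sq_int"
  shows "centered_gaussian P (\<lambda>\<omega>. W h \<omega> - W g \<omega>) ((l2_norm (\<lambda>x. h x - g x))\<^sup>2)"
  using gaussian_lin_comb[OF assms, of 1 "-1"] by simp

text \<open>The Gaussian increments are controlled through exponential moments: \<open>\<Psi> g\<close> is normalized such
  that \<open>exp (\<Psi> g)\<close> has expectation at most 1, which also makes a peeling argument unnecessary.\<close>

theorem risk_delta_net_estimator_le: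
  assumes T: "delta_net_estimator a N T" and N: "delta_net \<delta> F N" and f: "f \<in> F" "f \<in> sq_int"
    and bl: "\<And>g. g \<in> N \<Longrightarrow> band_limited M g" and n: "n \<ge> 1" and "\<kappa> > 0"
    and nz: "\<And>m. fcoef a m \<noteq> 0" and \<kappa>: "\<And>m. m \<in> freqs M \<Longrightarrow> 1 \<le> \<kappa> * cmod (fcoef a m)"
  shows "risk P W a n T f \<le> ennreal (3 * \<delta>\<^sup>2 + 16 * \<kappa>\<^sup>2 * ln (real (card N)) / real n)"
proof -
  have Ns: "g \<in> sq_int" if "g \<in> N" for g using N that by (auto simp: delta_net_def)
  obtain g0 where g0: "g0 \<in> N" "l2_norm (\<lambda>x. f x - g0 x) \<le> \<delta>"
    using N f by (auto simp: delta_net_def)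
  have finN: "finite N" using N by (simp add: delta_net_def)
  have cN: "card N > 0" using finN g0 by (auto simp: card_gt_0_iff)
  define u where "u = adj_inv a"
  have us: "u g \<in> sq_int" if "g \<in> N" for g
    unfolding u_def by (rule adj_inv_sq_int[OF bl[OF that] nz])
  have uf: "l2_inner (u g) (conv a f) = l2_inner f g" if "g \<in> N" for g
    unfolding u_def by (rule l2_inner_adj_inv_conv[OF bl[OF that] nz f(2)])
  define X where "X g \<omega> = W (u g) \<omega> - W (u g0) \<omega>" for g \<omega>
  define r2 where "r2 g = (l2_norm (\<lambda>x. g x - g0 x))\<^sup>2" for g
  define w where "w g = (l2_norm (\<lambda>x. u g x - u g0 x))\<^sup>2" for g
  have w: "w g \<le> \<kappa>\<^sup>2 * r2 g" if "g \<in> N" for g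
    unfolding w_def r2_def u_def
    using l2_norm_adj_inv_diff_le[OF bl[OF that] bl[OF g0(1)] \<open>\<kappa> > 0\<close> nz \<kappa>] .
  have G: "centered_gaussian P (X g) (w g)" if "g \<in> N" for g
    unfolding X_def w_def using that g0 us by (intro gaussian_noise_diff) auto
  have X[measurable]: "X g \<in> borel_measurable P" if "g \<in> N" for g
    using G[OF that] by (rule centered_gaussian_borel)
  define \<sigma> where "\<sigma> = real n powr (-1/2)"
  have \<sigma>2: "\<sigma>\<^sup>2 = 1 / real n"
    unfolding \<sigma>_def using n by (simp add: power2_eq_square powr_minus_divide flip: powr_add)
  \<comment> \<open>Makes the correction in the exponential moment, at most
    \<open>\<tau> * (2 * \<tau> * \<kappa>\<^sup>2 / real n) * r2 g\<close>, equal to the penalty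
    \<open>\<tau> * r2 g / 4\<close> in \<open>\<Psi>\<close>.\<close>
  define \<tau> where "\<tau> = real n / (8 * \<kappa>\<^sup>2)"
  have \<tau>: "\<tau> > 0" using n \<open>\<kappa> > 0\<close> by (simp add: \<tau>_def)
  \<comment> \<open>A penalty of a quarter is affordable because \<open>r2 g\<close> is at most
    twice the loss plus \<open>2 * \<delta>\<^sup>2\<close>: half of the loss moves to the left
    side, which yields the constants 3 and \<open>2 / \<tau>\<close>.\<close>
  define \<Psi> where "\<Psi> g \<omega> = \<tau> * (2 * \<sigma> * X g \<omega> - r2 g / 4)" for g \<omega>
  have E\<Psi>: "integrable P (\<lambda>\<omega>. exp (\<Psi> g \<omega>)) \<and> expectation (\<lambda>\<omega>. exp (\<Psi> g \<omega>)) \<le> 1" if g: "g \<in> N" for g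
  proof -
    note [measurable] = X[OF g]
    define c where "c = 2 * \<tau> * \<sigma>"
    have nn: "(\<integral>\<^sup>+\<omega>. ennreal (exp (c * X g \<omega> - c\<^sup>2 * w g / 2)) \<partial>P) = 1"
      by (rule nn_integral_exp_gaussian[OF prob_space_axioms G[OF g]]) (simp add: w_def)
    then have int: "integrable P (\<lambda>\<omega>. exp (c * X g \<omega> - c\<^sup>2 * w g / 2))"
      by (intro integrableI_nonneg) auto
    have one: "expectation (\<lambda>\<omega>. exp (c * X g \<omega> - c\<^sup>2 * w g / 2)) = 1"
      by (subst integral_eq_nn_integral) (auto simp: nn)
    have "c\<^sup>2 * w g / 2 \<le> c\<^sup>2 * (\<kappa>\<^sup>2 * r2 g) / 2"
      using w[OF g] by (intro divide_right_mono mult_left_mono) auto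
    also have "c\<^sup>2 * (\<kappa>\<^sup>2 * r2 g) / 2 = \<tau> * (2 * \<tau> * \<kappa>\<^sup>2 / real n) * r2 g"
      by (simp add: c_def power_mult_distrib \<sigma>2) (simp add: power2_eq_square)
    also have "2 * \<tau> * \<kappa>\<^sup>2 / real n = 1 / 4"
      using n \<open>\<kappa> > 0\<close> by (simp add: \<tau>_def)
    finally have \<Psi>le: "\<Psi> g \<omega> \<le> c * X g \<omega> - c\<^sup>2 * w g / 2" for \<omega>
      by (simp add: \<Psi>_def c_def algebra_simps)
    have [measurable]: "\<Psi> g \<in> borel_measurable P" unfolding \<Psi>_def by measurable
    have le: "exp (\<Psi> g \<omega>) \<le> exp (c * X g \<omega> - c\<^sup>2 * w g / 2)" for \<omega> by (simp add: \<Psi>le)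
    have "integrable P (\<lambda>\<omega>. exp (\<Psi> g \<omega>))"
      by (rule Bochner_Integration.integrable_bound[OF int]) (auto simp: \<Psi>le)
    moreover from this have "expectation (\<lambda>\<omega>. exp (\<Psi> g \<omega>)) \<le> 1"
      unfolding one[symmetric] using int le by (intro integral_mono)
    ultimately show ?thesis ..
  qed
  \<comment> \<open>The selected \<open>g\<close> depends on the noise. The average over the whole
    net dominates the selected term at the price of \<open>ln (card N)\<close>, and
    \<open>1 + t \<le> exp t\<close> turns this into a bound for \<open>\<Psi>\<close> that is
    linear in \<open>S\<close>.\<close>
  define S where "S \<omega> = (\<Sum>g\<in>N. exp (\<Psi> g \<omega>)) / real (card N)" for \<omega>
  have Sint: "integrable P S"
    unfolding S_def[abs_def] using E\<Psi> by (intro integrable_divide Bochner_Integration.integrable_sum) auto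
  have "expectation S = (\<Sum>g\<in>N. expectation (\<lambda>\<omega>. exp (\<Psi> g \<omega>))) / real (card N)"
    unfolding S_def[abs_def] using E\<Psi> by simp
  also have "\<dots> \<le> (\<Sum>g\<in>N. 1) / real (card N)"
    using E\<Psi> by (intro divide_right_mono sum_mono) auto
  finally have ES: "expectation S \<le> 1" using cN by simp
  define R where "R \<omega> = 3 * \<delta>\<^sup>2 + 2 / \<tau> * (ln (real (card N)) - 1 + S \<omega>)" for \<omega>
  have loss: "(l2_norm (\<lambda>x. T (observation a W n f \<omega>) x - f x))\<^sup>2 \<le> R \<omega>" if "\<omega> \<in> space P" for \<omega>
  proof -
    define y where "y = observation a W n f \<omega>"
    define g where "g = T y"
    have "is_arg_min (emp_risk a y) (\<lambda>g. g \<in> N) g"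
      using T observation_space[OF that] by (simp add: delta_net_estimator_def y_def g_def)
    then have g: "g \<in> N" and min: "emp_risk a y g \<le> emp_risk a y g0"
      using g0 by (auto simp: is_arg_min_def not_less)
    have emp: "emp_risk a y h = (l2_norm (\<lambda>x. h x - f x))\<^sup>2 - (l2_norm f)\<^sup>2 - 2 * \<sigma> * W (u h) \<omega>" if "h \<in> N" for h
      using that us[OF that] uf[OF that] f Ns[OF that]
      by (simp add: emp_risk_def y_def u_def[symmetric] observation_apply l2_norm_diff_sq
          l2_inner_commute[of h f] \<sigma>_def)
    define D2 where "D2 = (l2_norm (\<lambda>x. g x - f x))\<^sup>2"
    have d: "(l2_norm (\<lambda>x. g0 x - f x))\<^sup>2 \<le> \<delta>\<^sup>2"
      unfolding l2_norm_minus_commute[of g0 f] by (intro power_mono g0) simp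
    have 1: "D2 \<le> \<delta>\<^sup>2 + 2 * \<sigma> * X g \<omega>"
      using min d unfolding emp[OF g] emp[OF g0(1)] D2_def X_def by (simp add: algebra_simps)
    have "r2 g \<le> 2 * D2 + 2 * (l2_norm (\<lambda>x. g0 x - f x))\<^sup>2"
      using l2_norm_triangle_sq[of "\<lambda>x. g x - f x" "\<lambda>x. g0 x - f x"] Ns[OF g] Ns[OF g0(1)] f(2)
      by (simp add: r2_def D2_def sq_int_diff)
    with d have 2: "r2 g \<le> 2 * D2 + 2 * \<delta>\<^sup>2" by simp
    have 3: "2 * \<sigma> * X g \<omega> = \<Psi> g \<omega> / \<tau> + r2 g / 4" using \<tau> by (simp add: \<Psi>_def)
    from 1 2 3 have D2: "D2 \<le> 3 * \<delta>\<^sup>2 + 2 / \<tau> * \<Psi> g \<omega>" by simp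
    have "exp (\<Psi> g \<omega>) \<le> (\<Sum>g\<in>N. exp (\<Psi> g \<omega>))"
      using finN g by (intro member_le_sum) auto
    then have "exp (\<Psi> g \<omega> - ln (real (card N))) \<le> S \<omega>"
      using cN by (simp add: S_def exp_diff divide_right_mono)
    moreover have "1 + (\<Psi> g \<omega> - ln (real (card N))) \<le> exp (\<Psi> g \<omega> - ln (real (card N)))"
      by (rule exp_ge_add_one_self)
    ultimately have "\<Psi> g \<omega> \<le> ln (real (card N)) - 1 + S \<omega>" by linarith
    then have "2 / \<tau> * \<Psi> g \<omega> \<le> 2 / \<tau> * (ln (real (card N)) - 1 + S \<omega>)"
      using \<tau> by (intro mult_left_mono) auto
    with D2 show ?thesis by (simp add: R_def D2_def g_def y_def)
  qed
  have "risk P W a n T f \<le> (\<integral>\<^sup>+\<omega>. ennreal (R \<omega>) \<partial>P)"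
    unfolding risk_def using loss by (intro nn_integral_mono ennreal_leI)
  also have "\<dots> = ennreal (expectation R)"
  proof (rule nn_integral_eq_integral)
    show "integrable P R"
      unfolding R_def[abs_def] using Sint by simp
    show "AE \<omega> in P. 0 \<le> R \<omega>"
      using loss by (intro AE_I2) (meson order_trans zero_le_power2)
  qed
  also have "expectation R = 3 * \<delta>\<^sup>2 + 2 / \<tau> * (ln (real (card N)) - 1 + expectation S)"
    unfolding R_def[abs_def] using Sint by (simp add: prob_space)
  also have "\<dots> \<le> 3 * \<delta>\<^sup>2 + 2 / \<tau> * ln (real (card N))"
    using ES \<tau> by (intro add_left_mono mult_left_mono) auto
  also have "\<dots> = 3 * \<delta>\<^sup>2 + 16 * \<kappa>\<^sup>2 * ln (real (card N)) / real n"
    by (simp add: \<tau>_def)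
  finally show ?thesis by (simp add: ennreal_leI)
qed

section \<open>Lower bound by Assouad's method\<close>

text \<open>\<open>W v\<close> and its negative have the same law, and the two closed half-lines
  cover the line. An inequality also fits the degenerate case, in which \<open>W v\<close> vanishes
  almost surely.\<close>

lemma prob_noise_nonneg:
  assumes v: "v \<in> sq_int"
  shows "1 / 2 \<le> prob {\<omega> \<in> space P. 0 \<le> W v \<omega>}"
proof -
  note [measurable] = borel_measurable_noise[OF v]
  have G: "centered_gaussian P (\<lambda>\<omega>. t * W v \<omega>) ((l2_norm (\<lambda>x. t * v x))\<^sup>2)" for t
    using gaussian_lin_comb[OF v v, of t 0] by simp
  have "distr P borel (W v) = distr P borel (\<lambda>\<omega>. - W v \<omega>)"
  proof (rule distr_eq_of_cos)
    fix t \<phi> :: real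
    show "expectation (\<lambda>\<omega>. cos (t * W v \<omega> + \<phi>)) = expectation (\<lambda>\<omega>. cos (t * - W v \<omega> + \<phi>))"
      using integral_cos_gaussian[OF prob_space_axioms G zero_le_power2, of t \<phi>]
        integral_cos_gaussian[OF prob_space_axioms G zero_le_power2, of "- t" \<phi>]
      by (simp add: l2_norm_cmult l2_norm_cmult[of "- t", simplified])
  qed (auto intro: finite_measure_axioms)
  from arg_cong[OF this, of "\<lambda>\<mu>. measure \<mu> {0..}"]
  have "prob (W v -` {0..} \<inter> space P) = prob ((\<lambda>\<omega>. - W v \<omega>) -` {0..} \<inter> space P)"
    by (simp add: measure_distr)
  moreover have "1 \<le> prob (W v -` {0..} \<inter> space P) + prob ((\<lambda>\<omega>. - W v \<omega>) -` {0..} \<inter> space P)"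
  proof -
    have "1 = prob (space P)" by (simp add: prob_space)
    also have "\<dots> \<le> prob ((W v -` {0..} \<inter> space P) \<union> ((\<lambda>\<omega>. - W v \<omega>) -` {0..} \<inter> space P))"
      by (intro finite_measure_mono) auto
    also have "\<dots> \<le> prob (W v -` {0..} \<inter> space P) + prob ((\<lambda>\<omega>. - W v \<omega>) -` {0..} \<inter> space P)"
      by (intro measure_Un_le) auto
    finally show ?thesis .
  qed
  moreover have "W v -` {0..} \<inter> space P = {\<omega> \<in> space P. 0 \<le> W v \<omega>}" by auto
  ultimately show ?thesis by simp
qed

text \<open>In units of the noise level the means differ by \<open>v\<close>: its factor
  \<open>sqrt (real n)\<close> compensates \<open>real n powr (-1/2)\<close> in the observation. A
  change of signal becomes a change of density on the same probability space.\<close>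

lemma nn_integral_observation_change:
  assumes f: "f1 \<in> sq_int" "f2 \<in> sq_int" and n: "n \<ge> 1"
    and [measurable]: "G \<in> borel_measurable data_space"
  defines "v \<equiv> \<lambda>x. sqrt (real n) * (conv a f1 x - conv a f2 x)"
  shows "(\<integral>\<^sup>+\<omega>. G (observation a W n f1 \<omega>) \<partial>P)
    = (\<integral>\<^sup>+\<omega>. ennreal (exp (W v \<omega> - (l2_norm v)\<^sup>2 / 2)) * G (observation a W n f2 \<omega>) \<partial>P)"
proof -
  have v: "v \<in> sq_int" unfolding v_def by (intro sq_int_cmult sq_int_diff sq_int_conv f)
  note [measurable] = borel_measurable_noise[OF v] measurable_observation
  let ?M = "density P (\<lambda>\<omega>. ennreal (exp (W v \<omega> - (l2_norm v)\<^sup>2 / 2)))"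
  let ?r = "real n powr (-1/2)"
  have r: "?r * sqrt (real n) = 1"
    using n by (simp add: powr_half_sqrt[symmetric] powr_add[symmetric])
  have "?r * l2_inner h v = l2_inner h (conv a f1) - l2_inner h (conv a f2)" if "h \<in> sq_int" for h
  proof -
    have "l2_inner h v = sqrt (real n) * (l2_inner h (conv a f1) - l2_inner h (conv a f2))"
      unfolding l2_inner_commute[of h] v_def
      by (simp add: l2_inner_cmult_left l2_inner_diff_left sq_int_conv f that)
    then show ?thesis using r by (simp flip: mult.assoc)
  qed
  then have f1: "observation a W n f1 = (\<lambda>\<omega>. \<lambda>h\<in>sq_int. l2_inner h (conv a f2) + ?r * l2_inner h v + ?r * W h \<omega>)"
    by (intro ext) (auto simp: observation_def restrict_def)
  have f2: "observation a W n f2 = (\<lambda>\<omega>. \<lambda>h\<in>sq_int. l2_inner h (conv a f2) + ?r * W h \<omega>)"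
    by (intro ext) (simp add: observation_def)
  have "(\<integral>\<^sup>+\<omega>. G (observation a W n f1 \<omega>) \<partial>P) = (\<integral>\<^sup>+y. G y \<partial>distr P data_space (observation a W n f1))"
    by (subst nn_integral_distr) auto
  also have "\<dots> = (\<integral>\<^sup>+y. G y \<partial>distr ?M data_space (observation a W n f2))"
    unfolding f1 f2 Cameron_Martin[OF v] ..
  also have "\<dots> = (\<integral>\<^sup>+\<omega>. G (observation a W n f2 \<omega>) \<partial>?M)"
    by (subst nn_integral_distr) auto
  also have "\<dots> = (\<integral>\<^sup>+\<omega>. ennreal (exp (W v \<omega> - (l2_norm v)\<^sup>2 / 2)) * G (observation a W n f2 \<omega>) \<partial>P)"
    by (subst nn_integral_density) auto
  finally show ?thesis .
qed

text \<open>On the event \<open>0 \<le> W v \<omega>\<close>, of probability at least 1/2, the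
  likelihood ratio is at least \<open>exp (-1/2)\<close> because \<open>v\<close> has norm at most
  1. At the same data the two squared errors sum to at least
  \<open>2 * \<epsilon>\<^sup>2\<close>.\<close>

lemma two_point_bound:
  assumes f: "f1 \<in> sq_int" "f2 \<in> sq_int" and n: "n \<ge> 1"
    and t[measurable]: "t \<in> borel_measurable data_space"
    and small: "real n * (l2_norm (\<lambda>x. conv a f1 x - conv a f2 x))\<^sup>2 \<le> 1"
  shows "ennreal (exp (-1/2) * \<epsilon>\<^sup>2)
    \<le> (\<integral>\<^sup>+\<omega>. ennreal ((t (observation a W n f1 \<omega>) - \<epsilon>)\<^sup>2) \<partial>P)
      + (\<integral>\<^sup>+\<omega>. ennreal ((t (observation a W n f2 \<omega>) - - \<epsilon>)\<^sup>2) \<partial>P)"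
proof -
  define v where "v = (\<lambda>x. sqrt (real n) * (conv a f1 x - conv a f2 x))"
  have v: "v \<in> sq_int" unfolding v_def by (intro sq_int_cmult sq_int_diff sq_int_conv f)
  note [measurable] = borel_measurable_noise[OF v] measurable_observation
  have v1: "(l2_norm v)\<^sup>2 \<le> 1"
    unfolding v_def l2_norm_cmult using small by (simp add: power_mult_distrib)
  define \<Lambda> where "\<Lambda> \<omega> = exp (W v \<omega> - (l2_norm v)\<^sup>2 / 2)" for \<omega>
  define y where "y = observation a W n f2"
  have [measurable]: "\<Lambda> \<in> borel_measurable P" "y \<in> measurable P data_space"
    unfolding \<Lambda>_def y_def by measurable
  define A where "A = {\<omega> \<in> space P. 0 \<le> W v \<omega>}"
  have [measurable]: "A \<in> sets P" unfolding A_def by measurable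
  define c where "c = (exp (-1/2) :: real)"
  have c: "0 < c" "c \<le> 1" by (simp_all add: c_def)
  have pt: "2 * c * \<epsilon>\<^sup>2 * indicator A \<omega> \<le> \<Lambda> \<omega> * (t (y \<omega>) - \<epsilon>)\<^sup>2 + (t (y \<omega>) - - \<epsilon>)\<^sup>2" for \<omega>
  proof (cases "\<omega> \<in> A")
    case True
    then have "c \<le> \<Lambda> \<omega>" using v1 by (simp add: A_def \<Lambda>_def c_def)
    then have "c * (t (y \<omega>) - \<epsilon>)\<^sup>2 + c * (t (y \<omega>) - - \<epsilon>)\<^sup>2 \<le> \<Lambda> \<omega> * (t (y \<omega>) - \<epsilon>)\<^sup>2 + 1 * (t (y \<omega>) - - \<epsilon>)\<^sup>2"
      using c by (intro add_mono mult_right_mono) auto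
    moreover have "c * (t (y \<omega>) - \<epsilon>)\<^sup>2 + c * (t (y \<omega>) - - \<epsilon>)\<^sup>2 = 2 * c * \<epsilon>\<^sup>2 + 2 * c * (t (y \<omega>))\<^sup>2"
      by (simp add: power2_eq_square algebra_simps)
    moreover have "0 \<le> 2 * c * (t (y \<omega>))\<^sup>2" using c by simp
    ultimately show ?thesis using True by simp
  next
    case False
    then show ?thesis by (simp add: \<Lambda>_def)
  qed
  have "ennreal (c * \<epsilon>\<^sup>2) = ennreal (2 * c * \<epsilon>\<^sup>2) * ennreal (1 / 2)"
    using c by (subst ennreal_mult[symmetric]) auto
  also have "\<dots> \<le> ennreal (2 * c * \<epsilon>\<^sup>2) * emeasure P A"
    unfolding A_def emeasure_eq_measure by (intro mult_left_mono ennreal_leI prob_noise_nonneg v) simp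
  also have "\<dots> = (\<integral>\<^sup>+\<omega>. ennreal (2 * c * \<epsilon>\<^sup>2) * indicator A \<omega> \<partial>P)"
    by (simp add: nn_integral_cmult)
  also have "\<dots> \<le> (\<integral>\<^sup>+\<omega>. ennreal (\<Lambda> \<omega>) * ennreal ((t (y \<omega>) - \<epsilon>)\<^sup>2) + ennreal ((t (y \<omega>) - - \<epsilon>)\<^sup>2) \<partial>P)"
  proof (rule nn_integral_mono)
    fix \<omega>
    have "ennreal (2 * c * \<epsilon>\<^sup>2) * indicator A \<omega> = ennreal (2 * c * \<epsilon>\<^sup>2 * indicator A \<omega>)"
      by (simp split: split_indicator)
    also have "\<dots> \<le> ennreal (\<Lambda> \<omega> * (t (y \<omega>) - \<epsilon>)\<^sup>2 + (t (y \<omega>) - - \<epsilon>)\<^sup>2)"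
      by (intro ennreal_leI pt)
    also have "\<dots> = ennreal (\<Lambda> \<omega>) * ennreal ((t (y \<omega>) - \<epsilon>)\<^sup>2) + ennreal ((t (y \<omega>) - - \<epsilon>)\<^sup>2)"
      by (simp add: \<Lambda>_def ennreal_mult)
    finally show "ennreal (2 * c * \<epsilon>\<^sup>2) * indicator A \<omega> \<le> ennreal (\<Lambda> \<omega>) * ennreal ((t (y \<omega>) - \<epsilon>)\<^sup>2) + ennreal ((t (y \<omega>) - - \<epsilon>)\<^sup>2)" .
  qed
  also have "\<dots> = (\<integral>\<^sup>+\<omega>. ennreal (\<Lambda> \<omega>) * ennreal ((t (y \<omega>) - \<epsilon>)\<^sup>2) \<partial>P) + (\<integral>\<^sup>+\<omega>. ennreal ((t (y \<omega>) - - \<epsilon>)\<^sup>2) \<partial>P)"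
    by (rule nn_integral_add) measurable
  also have "(\<integral>\<^sup>+\<omega>. ennreal (\<Lambda> \<omega>) * ennreal ((t (y \<omega>) - \<epsilon>)\<^sup>2) \<partial>P)
    = (\<integral>\<^sup>+\<omega>. ennreal ((t (observation a W n f1 \<omega>) - \<epsilon>)\<^sup>2) \<partial>P)"
    unfolding \<Lambda>_def y_def v_def
    by (rule nn_integral_observation_change[OF f n, symmetric]) measurable
  finally show ?thesis by (simp add: c_def y_def)
qed

end

lemma Bessel_orthonormal:
  assumes "finite B" and \<psi>: "\<And>m. m \<in> B \<Longrightarrow> \<psi> m \<in> sq_int"
    and orth: "\<And>m k. m \<in> B \<Longrightarrow> k \<in> B \<Longrightarrow> l2_inner (\<psi> m) (\<psi> k) = (if m = k then 1 else 0)"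
    and h: "h \<in> sq_int"
  shows "(\<Sum>m\<in>B. (l2_inner h (\<psi> m))\<^sup>2) \<le> (l2_norm h)\<^sup>2"
proof -
  define c where "c m = l2_inner h (\<psi> m)" for m
  define g where "g = (\<lambda>x. \<Sum>m\<in>B. c m * \<psi> m x)"
  have cs: "(\<lambda>x. c m * \<psi> m x) \<in> sq_int" if "m \<in> B" for m using \<psi>[OF that] by (rule sq_int_cmult)
  have g: "g \<in> sq_int" unfolding g_def using cs by (rule sq_int_sum)
  have inner: "l2_inner g k = (\<Sum>m\<in>B. c m * l2_inner (\<psi> m) k)" if "k \<in> sq_int" for k
    unfolding g_def using cs that by (simp add: l2_inner_sum_left l2_inner_cmult_left)
  have gh: "l2_inner h g = (\<Sum>m\<in>B. (c m)\<^sup>2)"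
    unfolding l2_inner_commute[of h] inner[OF h] c_def by (simp add: l2_inner_commute[of h] power2_eq_square)
  have "l2_inner g (\<psi> k) = c k" if "k \<in> B" for k
    using that assms(1) by (simp add: inner \<psi> orth if_distrib cong: if_cong)
  then have gg: "l2_inner g g = (\<Sum>m\<in>B. (c m)\<^sup>2)"
    unfolding inner[OF g] by (simp add: l2_inner_commute[of _ g] power2_eq_square)
  have "0 \<le> (l2_norm (\<lambda>x. h x - g x))\<^sup>2" by simp
  also have "\<dots> = (l2_norm h)\<^sup>2 - (\<Sum>m\<in>B. (c m)\<^sup>2)"
    unfolding l2_norm_diff_sq[OF h g] by (simp add: gh l2_norm_sq_inner[of g] gg)
  finally show ?thesis by (simp add: c_def)
qed

text \<open>Pairs the sign patterns that differ at \<open>m\<close> only; Assouad's argument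
  compares the two members of each pair.\<close>

lemma sum_Pow_split:
  fixes Q :: "'a set \<Rightarrow> ennreal"
  assumes "finite B" "m \<in> B"
  shows "(\<Sum>S\<in>Pow B. Q S) = (\<Sum>S\<in>Pow (B - {m}). Q (insert m S) + Q S)"
proof -
  have "Pow B = Pow (B - {m}) \<union> insert m ` Pow (B - {m})"
    using assms(2) Pow_insert[of m "B - {m}"] by (simp add: insert_absorb)
  moreover have "Pow (B - {m}) \<inter> insert m ` Pow (B - {m}) = {}" by auto
  moreover have "inj_on (insert m) (Pow (B - {m}))" by (auto simp: inj_on_def)
  ultimately show ?thesis
    using assms(1) by (simp add: sum.union_disjoint sum.reindex sum.distrib add.commute)
qed

context deconvolution
begin

text \<open>Measurability of an estimator is given through distances to fixed functions;
  polarization recovers the inner product from the distances to \<open>\<psi>\<close> and to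
  zero.\<close>

lemma borel_measurable_estimator_coeff:
  assumes T: "T \<in> estimators" and \<psi>: "\<psi> \<in> sq_int"
  shows "(\<lambda>y. l2_inner (T y) \<psi>) \<in> borel_measurable data_space"
proof -
  have T': "\<forall>g\<in>sq_int. (\<lambda>y. l2_norm (\<lambda>x. T y x - g x)) \<in> borel_measurable data_space"
    using T by (simp add: estimators_def)
  note [measurable] = bspec[OF T' \<psi>] bspec[OF T' sq_int_zero]
  have "(\<lambda>y. ((l2_norm (\<lambda>x. T y x - 0))\<^sup>2 + (l2_norm \<psi>)\<^sup>2 - (l2_norm (\<lambda>x. T y x - \<psi> x))\<^sup>2) / 2) \<in> borel_measurable data_space"
    by measurable
  also have "?this \<longleftrightarrow> ?thesis"
    using T \<psi> by (intro measurable_cong) (simp add: estimators_def l2_norm_diff_sq)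
  finally show ?thesis .
qed

text \<open>The supremum dominates the average over all sign patterns, and Bessel's inequality
  splits the loss into coordinates. In each coordinate there are half as many pairs of neighbours as
  patterns, each contributing at least \<open>exp (-1/2) * \<epsilon>\<^sup>2\<close>, whence the
  factor 1/2. Neighbours differ by \<open>2 * \<epsilon> * \<psi> m\<close>, whence the 4 in
  \<open>small\<close>.\<close>

theorem assouad:
  fixes \<psi> :: "'b \<Rightarrow> real^'d \<Rightarrow> real"
  assumes T: "T \<in> estimators" and n: "n \<ge> 1" and B: "finite B"
    and \<psi>: "\<And>m. m \<in> B \<Longrightarrow> \<psi> m \<in> sq_int"
    and orth: "\<And>m k. m \<in> B \<Longrightarrow> k \<in> B \<Longrightarrow> l2_inner (\<psi> m) (\<psi> k) = (if m = k then 1 else 0)"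
    and small: "\<And>m. m \<in> B \<Longrightarrow> 4 * real n * \<epsilon>\<^sup>2 * (l2_norm (conv a (\<psi> m)))\<^sup>2 \<le> 1"
    and F: "\<And>S. S \<subseteq> B \<Longrightarrow> (\<lambda>x. \<Sum>m\<in>B. (if m \<in> S then \<epsilon> else - \<epsilon>) * \<psi> m x) \<in> F"
  shows "ennreal (exp (-1/2) / 2 * (real (card B) * \<epsilon>\<^sup>2)) \<le> (SUP f\<in>F. risk P W a n T f)"
proof -
  define e where "e S m = (if m \<in> S then \<epsilon> else - \<epsilon>)" for S :: "'b set" and m
  define f where "f S = (\<lambda>x. \<Sum>m\<in>B. e S m * \<psi> m x)" for S
  have fs: "f S \<in> sq_int" for S unfolding f_def using \<psi> by (intro sq_int_sum sq_int_cmult)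
  define t where "t m y = l2_inner (T y) (\<psi> m)" for m y
  have t[measurable]: "t m \<in> borel_measurable data_space" if "m \<in> B" for m
    unfolding t_def using T \<psi>[OF that] by (rule borel_measurable_estimator_coeff)
  note [measurable] = measurable_observation
  define Q where "Q m S = (\<integral>\<^sup>+\<omega>. ennreal ((t m (observation a W n (f S) \<omega>) - e S m)\<^sup>2) \<partial>P)" for m S
  define c where "c = (exp (-1/2) :: real)"
  have fcoeff: "l2_inner (f S) (\<psi> m) = e S m" if "m \<in> B" for S m
  proof -
    have "l2_inner (f S) (\<psi> m) = (\<Sum>k\<in>B. e S k * l2_inner (\<psi> k) (\<psi> m))"
      unfolding f_def using \<psi> that by (simp add: l2_inner_sum_left l2_inner_cmult_left sq_int_cmult)
    also have "\<dots> = (\<Sum>k\<in>B. if k = m then e S m else 0)"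
      using that by (intro sum.cong) (auto simp: orth)
    finally show ?thesis using that B by simp
  qed
  have risk: "(\<Sum>m\<in>B. Q m S) \<le> risk P W a n T (f S)" for S
  proof -
    have "(\<Sum>m\<in>B. Q m S) = (\<integral>\<^sup>+\<omega>. (\<Sum>m\<in>B. ennreal ((t m (observation a W n (f S) \<omega>) - e S m)\<^sup>2)) \<partial>P)"
      unfolding Q_def by (rule nn_integral_sum[symmetric]) measurable
    also have "\<dots> \<le> risk P W a n T (f S)"
      unfolding risk_def
    proof (rule nn_integral_mono)
      fix \<omega> assume "\<omega> \<in> space P"
      define y where "y = observation a W n (f S) \<omega>"
      have Ty: "T y \<in> sq_int"
        using T observation_space[OF \<open>\<omega> \<in> space P\<close>] by (simp add: estimators_def y_def)
      have "(\<Sum>m\<in>B. (t m y - e S m)\<^sup>2) = (\<Sum>m\<in>B. (l2_inner (\<lambda>x. T y x - f S x) (\<psi> m))\<^sup>2)"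
        using Ty fs \<psi> by (intro sum.cong) (auto simp: t_def l2_inner_diff_left fcoeff)
      also have "\<dots> \<le> (l2_norm (\<lambda>x. T y x - f S x))\<^sup>2"
        by (rule Bessel_orthonormal[OF B \<psi> orth sq_int_diff[OF Ty fs]])
      finally show "(\<Sum>m\<in>B. ennreal ((t m (observation a W n (f S) \<omega>) - e S m)\<^sup>2))
        \<le> ennreal ((l2_norm (\<lambda>x. T (observation a W n (f S) \<omega>) x - f S x))\<^sup>2)"
        by (simp add: y_def ennreal_leI sum_ennreal)
    qed
    finally show ?thesis .
  qed
  have pair: "ennreal (c * \<epsilon>\<^sup>2) \<le> Q m (insert m S) + Q m S" if m: "m \<in> B" and S: "S \<subseteq> B - {m}" for m S
  proof -
    have diff: "conv a (f (insert m S)) x - conv a (f S) x = 2 * \<epsilon> * conv a (\<psi> m) x" for x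
    proof -
      have "f (insert m S) z - f S z = (\<Sum>k\<in>B. if k = m then 2 * \<epsilon> * \<psi> m z else 0)" for z
        unfolding f_def sum_subtractf[symmetric] using S by (intro sum.cong) (auto simp: e_def)
      then have "(\<lambda>z. f (insert m S) z - f S z) = (\<lambda>z. 2 * \<epsilon> * \<psi> m z)" using B m by simp
      then show ?thesis
        using conv_diff[OF fs[of "insert m S"] fs[of S], of x] conv_cmult[of "2 * \<epsilon>" "\<psi> m" x] by simp
    qed
    have "real n * (l2_norm (\<lambda>x. conv a (f (insert m S)) x - conv a (f S) x))\<^sup>2 \<le> 1"
      unfolding diff l2_norm_cmult using small[OF m] by (simp add: power_mult_distrib algebra_simps)
    moreover have "e (insert m S) m = \<epsilon>" "e S m = - \<epsilon>" using S by (auto simp: e_def)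
    ultimately show ?thesis
      using two_point_bound[OF fs[of "insert m S"] fs[of S] n t[OF m], of \<epsilon>] by (simp add: Q_def c_def)
  qed
  define U where "U = (SUP f\<in>F. risk P W a n T f)"
  have cardP: "card (Pow B) = 2 * 2 ^ (card B - 1)" if "m \<in> B" for m
    using that B by (metis card_Pow card_gt_0_iff empty_iff power_Suc Suc_diff_1)
  have "of_nat (card (Pow B)) * ennreal (c / 2 * (real (card B) * \<epsilon>\<^sup>2)) \<le> (\<Sum>m\<in>B. \<Sum>S\<in>Pow B. Q m S)"
  proof -
    have "of_nat (card (Pow B)) * ennreal (c / 2 * \<epsilon>\<^sup>2) \<le> (\<Sum>S\<in>Pow B. Q m S)" if m: "m \<in> B" for m
    proof -
      have "of_nat (card (Pow B)) * ennreal (c / 2 * \<epsilon>\<^sup>2) = ennreal (real (card (Pow B)) * (c / 2 * \<epsilon>\<^sup>2))"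
        by (simp add: ennreal_of_nat_eq_real_of_nat c_def flip: ennreal_mult)
      also have "\<dots> = ennreal (real (2 ^ (card B - 1)) * (c * \<epsilon>\<^sup>2))"
        by (simp add: cardP[OF m])
      also have "\<dots> = of_nat (card (Pow (B - {m}))) * ennreal (c * \<epsilon>\<^sup>2)"
        using B m by (simp add: card_Pow ennreal_of_nat_eq_real_of_nat c_def flip: ennreal_mult)
      also have "\<dots> = (\<Sum>S\<in>Pow (B - {m}). ennreal (c * \<epsilon>\<^sup>2))" by simp
      also have "\<dots> \<le> (\<Sum>S\<in>Pow (B - {m}). Q m (insert m S) + Q m S)"
        using pair m by (intro sum_mono) auto
      also have "\<dots> = (\<Sum>S\<in>Pow B. Q m S)" by (rule sum_Pow_split[OF B m, symmetric])
      finally show ?thesis .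
    qed
    then have "(\<Sum>m\<in>B. of_nat (card (Pow B)) * ennreal (c / 2 * \<epsilon>\<^sup>2)) \<le> (\<Sum>m\<in>B. \<Sum>S\<in>Pow B. Q m S)"
      by (intro sum_mono)
    also have "(\<Sum>m\<in>B. of_nat (card (Pow B)) * ennreal (c / 2 * \<epsilon>\<^sup>2))
      = of_nat (card (Pow B)) * ennreal (c / 2 * (real (card B) * \<epsilon>\<^sup>2))"
      by (simp add: ennreal_of_nat_eq_real_of_nat c_def algebra_simps flip: ennreal_mult)
    finally show ?thesis .
  qed
  also have "\<dots> = (\<Sum>S\<in>Pow B. \<Sum>m\<in>B. Q m S)" by (rule sum.swap)
  also have "\<dots> \<le> (\<Sum>S\<in>Pow B. U)"
  proof (rule sum_mono)
    fix S assume "S \<in> Pow B"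
    then have "f S \<in> F" using F by (simp add: f_def e_def)
    then have "risk P W a n T (f S) \<le> U" unfolding U_def by (rule SUP_upper)
    then show "(\<Sum>m\<in>B. Q m S) \<le> U" using risk order_trans by blast
  qed
  also have "\<dots> = of_nat (card (Pow B)) * U" by simp
  finally have "of_nat (card (Pow B)) * ennreal (c / 2 * (real (card B) * \<epsilon>\<^sup>2)) \<le> of_nat (card (Pow B)) * U" .
  moreover have "(of_nat (card (Pow B)) :: ennreal) \<noteq> 0" "(of_nat (card (Pow B)) :: ennreal) \<noteq> top"
    using B by (simp_all only: ennreal_of_nat_eq_real_of_nat card_Pow) simp_all
  ultimately show ?thesis
    by (simp add: ennreal_mult_le_mult_iff c_def U_def)
qed

end

section \<open>Rates\<close>

text \<open>Everything is measured in the bandwidth \<open>x\<close>: net radius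
  \<open>x powr (- s)\<close>, noise amplification \<open>x powr q\<close>, entropy
  \<open>x powr d\<close>. At sample size \<open>x powr (2 * s + 2 * q + d)\<close> both terms of
  the risk are of order \<open>x powr (- 2 * s)\<close>.\<close>

lemma upper_rate_arith:
  fixes x :: real
  assumes x: "x \<ge> 1" and \<delta>: "0 \<le> \<delta>" "\<delta> \<le> c1 * x powr (- s)"
    and \<kappa>: "0 \<le> \<kappa>" "\<kappa> \<le> k1 * x powr q" and l: "0 \<le> l" "l \<le> k2 * x powr d"
  shows "x powr (2 * s) * (3 * \<delta>\<^sup>2 + 16 * \<kappa>\<^sup>2 * l / x powr (2 * s + 2 * q + d)) \<le> 3 * c1\<^sup>2 + 16 * k1\<^sup>2 * k2"
proof -
  have sq: "(x powr t)\<^sup>2 = x powr (2 * t)" for t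
    by (simp add: power2_eq_square flip: powr_add)
  have "\<delta>\<^sup>2 \<le> (c1 * x powr (- s))\<^sup>2" using \<delta> by (intro power_mono)
  then have "x powr (2 * s) * \<delta>\<^sup>2 \<le> x powr (2 * s) * (c1\<^sup>2 * x powr (2 * (- s)))"
    by (intro mult_left_mono) (simp_all only: power_mult_distrib sq powr_ge_zero)
  also have "\<dots> = c1\<^sup>2 * (x powr (2 * s) * x powr (2 * (- s)))" by simp
  also have "\<dots> = c1\<^sup>2" unfolding powr_add[symmetric] using x by simp
  finally have 1: "x powr (2 * s) * \<delta>\<^sup>2 \<le> c1\<^sup>2" .
  have "\<kappa>\<^sup>2 \<le> (k1 * x powr q)\<^sup>2" using \<kappa> by (intro power_mono)
  then have "\<kappa>\<^sup>2 * l \<le> (k1 * x powr q)\<^sup>2 * (k2 * x powr d)"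
    using l by (intro mult_mono) auto
  also have "\<dots> = k1\<^sup>2 * k2 * x powr (2 * q + d)"
    by (simp add: power_mult_distrib sq powr_add)
  finally have "x powr (2 * s) * (\<kappa>\<^sup>2 * l / x powr (2 * s + 2 * q + d))
    \<le> x powr (2 * s) * (k1\<^sup>2 * k2 * x powr (2 * q + d) / x powr (2 * s + 2 * q + d))"
    by (intro mult_left_mono divide_right_mono) auto
  also have "\<dots> = k1\<^sup>2 * k2"
    using x by (simp add: powr_add)
  finally have 2: "x powr (2 * s) * (\<kappa>\<^sup>2 * l / x powr (2 * s + 2 * q + d)) \<le> k1\<^sup>2 * k2" .
  have "x powr (2 * s) * (3 * \<delta>\<^sup>2 + 16 * \<kappa>\<^sup>2 * l / x powr (2 * s + 2 * q + d))
    = 3 * (x powr (2 * s) * \<delta>\<^sup>2) + 16 * (x powr (2 * s) * (\<kappa>\<^sup>2 * l / x powr (2 * s + 2 * q + d)))"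
    by (simp add: algebra_simps)
  then show ?thesis using 1 2 by linarith
qed

context deconvolution
begin

lemma delta_net_upper_bound:
  assumes "s > 0" "q \<ge> 0" and "c > 0"
    and a0: "c \<le> cmod (fcoef a 0)"
    and ac: "\<And>m. m \<noteq> 0 \<Longrightarrow> c * real (deg (abs_freq m)) powr (-q) \<le> cmod (fcoef a m)"
    and nets: "admissible_nets \<alpha> L s q \<delta> N"
    and est: "\<And>n. n \<ge> 1 \<Longrightarrow> delta_net_estimator a (N n) (fhat n)"
  shows "limsup (\<lambda>n. ennreal (real n powr (2 * s / (2 * s + 2 * q + real CARD('d)))) *
           (SUP f\<in>fun_class \<alpha> L. risk P W a n (fhat n) f)) < \<infinity>"
proof -
  define d where "d = real CARD('d)"
  have d: "d > 0" by (simp add: d_def)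
  define D where "D = 2 * s + 2 * q + d"
  have D: "D > 0" using \<open>s > 0\<close> \<open>q \<ge> 0\<close> d by (simp add: D_def)
  have \<delta>pos: "\<delta> n > 0" if "n \<ge> 1" for n using nets that by (simp add: admissible_nets_def)
  have \<delta>\<Theta>: "\<delta> \<in> \<Theta>(\<lambda>n. real n powr (- s / D))"
    using nets by (simp add: admissible_nets_def D_def d_def)
  have net: "delta_net (\<delta> n) (fun_class \<alpha> L) (N n)" if "n \<ge> 1" for n
    using nets that by (simp add: admissible_nets_def)
  obtain m where m\<Theta>: "(\<lambda>n. real (m n)) \<in> \<Theta>(\<lambda>n. \<delta> n powr (- 1 / s))"
    and bl: "\<And>n g. n \<ge> 1 \<Longrightarrow> g \<in> N n \<Longrightarrow> band_limited (m n) g"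
    using nets by (auto simp: admissible_nets_def)
  obtain C where C: "\<And>n. n \<ge> 1 \<Longrightarrow> ln (real (card (N n))) \<le> C * \<delta> n powr (- d / s)"
    using nets by (auto simp: admissible_nets_def d_def)
  obtain c1 where c1: "c1 > 0" "eventually (\<lambda>n. norm (\<delta> n) \<le> c1 * norm (real n powr (- s / D))) sequentially"
    using landau_o.bigE[OF bigthetaD1[OF \<delta>\<Theta>]] by blast
  \<comment> \<open>Bandwidth and entropy are bounded by negative powers of \<open>\<delta>\<close>,
    so they are controlled by a lower bound on \<open>\<delta>\<close>.\<close>
  obtain c2 where c2: "c2 > 0" "eventually (\<lambda>n. norm (\<delta> n) \<ge> c2 * norm (real n powr (- s / D))) sequentially"
    using landau_omega.bigE[OF bigthetaD2[OF \<delta>\<Theta>]] by blast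
  obtain c3 where c3: "c3 > 0" "eventually (\<lambda>n. norm (real (m n)) \<le> c3 * norm (\<delta> n powr (- 1 / s))) sequentially"
    using landau_o.bigE[OF bigthetaD1[OF m\<Theta>]] by blast
  define E where "E = d * (c3 * c2 powr (- 1 / s)) + 1"
  have E: "E \<ge> 1" using d c3 by (simp add: E_def)
  define k2 where "k2 = \<bar>C\<bar> * c2 powr (- d / s)"
  define k1 where "k1 = E powr q / c"
  define bound where "bound = 3 * c1\<^sup>2 + 16 * k1\<^sup>2 * k2"
  have nz: "fcoef a m \<noteq> 0" for m
  proof (cases "m = 0")
    case False
    have "0 < c * real (deg (abs_freq m)) powr (-q)"
      using \<open>c > 0\<close> deg_abs_freq_pos[OF False] by simp
    then show ?thesis using ac[OF False] by auto
  qed (use a0 \<open>c > 0\<close> in auto)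
  have "eventually (\<lambda>n. ennreal (real n powr (2 * s / D)) *
           (SUP f\<in>fun_class \<alpha> L. risk P W a n (fhat n) f) \<le> ennreal bound) sequentially"
    using c1(2) c2(2) c3(2) eventually_ge_at_top[of 1]
  proof eventually_elim
    case (elim n)
    then have n: "n \<ge> 1" by simp
    define x where "x = real n powr (1 / D)"
    have x: "x \<ge> 1" unfolding x_def using n D by (intro ge_one_powr_ge_zero) auto
    have xp: "x powr t = real n powr (t / D)" for t
      by (simp add: x_def powr_powr)
    have nx: "real n = x powr (2 * s + 2 * q + d)"
      using n D by (simp add: xp flip: D_def)
    have \<delta>1: "\<delta> n \<le> c1 * x powr (- s)" using elim \<delta>pos[OF n] by (simp add: xp)
    have \<delta>2: "c2 * x powr (- s) \<le> \<delta> n" using elim \<delta>pos[OF n] by (simp add: xp)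
    have \<delta>powr: "\<delta> n powr (- t / s) \<le> c2 powr (- t / s) * x powr t" if "t > 0" for t
    proof -
      have "\<delta> n powr (- t / s) \<le> (c2 * x powr (- s)) powr (- t / s)"
        using \<delta>2 c2(1) x that \<open>s > 0\<close> by (intro powr_mono2') auto
      also have "\<dots> = c2 powr (- t / s) * x powr t"
        using c2(1) x \<open>s > 0\<close> by (simp add: powr_mult powr_powr)
      finally show ?thesis .
    qed
    define M where "M = m n"
    \<comment> \<open>The added 1 keeps \<open>R\<close> at least 1 even for \<open>M = 0\<close>,
      so that \<open>R powr (-q)\<close> is at most 1 and frequency zero obeys the same bound.
      \<open>E\<close> absorbs it because \<open>x \<ge> 1\<close>.\<close>
    define R where "R = d * real M + 1"
    have R1: "R \<ge> 1" using d by (simp add: R_def)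
    have "real M \<le> c3 * \<delta> n powr (- 1 / s)" using elim by (simp add: M_def)
    also have "\<dots> \<le> c3 * (c2 powr (- 1 / s) * x powr 1)"
      using \<delta>powr[of 1] c3(1) by (intro mult_left_mono) auto
    finally have "real M \<le> c3 * c2 powr (- 1 / s) * x" using x by simp
    then have "R \<le> d * (c3 * c2 powr (- 1 / s) * x) + 1 * x"
      unfolding R_def using d x by (intro add_mono mult_left_mono) auto
    then have RE: "R \<le> E * x" by (simp add: E_def algebra_simps)
    define \<kappa> where "\<kappa> = R powr q / c"
    have \<kappa>pos: "\<kappa> > 0" using R1 \<open>c > 0\<close> by (simp add: \<kappa>_def)
    have "R powr q \<le> (E * x) powr q" using RE R1 \<open>q \<ge> 0\<close> by (intro powr_mono2) auto
    also have "\<dots> = E powr q * x powr q" using E x by (simp add: powr_mult)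
    finally have \<kappa>k1: "\<kappa> \<le> k1 * x powr q"
      using \<open>c > 0\<close> by (simp add: \<kappa>_def k1_def divide_right_mono)
    have \<kappa>a: "1 \<le> \<kappa> * cmod (fcoef a k)" if k: "k \<in> freqs M" for k
    proof -
      have "c * R powr (-q) \<le> cmod (fcoef a k)"
      proof (cases "k = 0")
        case True
        have "R powr (-q) \<le> R powr 0" using R1 \<open>q \<ge> 0\<close> by (intro powr_mono) auto
        then have "c * R powr (-q) \<le> c * 1" using R1 \<open>c > 0\<close> by (intro mult_left_mono) auto
        then show ?thesis using a0 True by simp
      next
        case False
        have "deg (abs_freq k) \<le> CARD('d) * M" by (rule deg_abs_freq_le[OF k])
        then have "real (deg (abs_freq k)) \<le> real (CARD('d) * M)" by (simp only: of_nat_le_iff)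
        then have "real (deg (abs_freq k)) \<le> R" by (simp add: R_def d_def)
        then have "R powr (-q) \<le> real (deg (abs_freq k)) powr (-q)"
          using deg_abs_freq_pos[OF False] \<open>q \<ge> 0\<close> by (intro powr_mono2') auto
        then have "c * R powr (-q) \<le> c * real (deg (abs_freq k)) powr (-q)"
          using \<open>c > 0\<close> by (intro mult_left_mono) auto
        then show ?thesis using ac[OF False] by linarith
      qed
      then have "\<kappa> * (c * R powr (-q)) \<le> \<kappa> * cmod (fcoef a k)"
        using \<kappa>pos by (intro mult_left_mono) auto
      moreover have "\<kappa> * (c * R powr (-q)) = 1"
        using R1 \<open>c > 0\<close> by (simp add: \<kappa>_def powr_minus)
      ultimately show ?thesis by simp
    qed
    define l where "l = ln (real (card (N n)))"
    have l2: "l \<le> k2 * x powr d"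
    proof -
      have "l \<le> C * \<delta> n powr (- d / s)" unfolding l_def by (rule C[OF n])
      also have "\<dots> \<le> \<bar>C\<bar> * (c2 powr (- d / s) * x powr d)"
        using \<delta>powr[OF d] by (intro mult_mono) auto
      finally show ?thesis by (simp add: k2_def mult.assoc)
    qed
    have "risk P W a n (fhat n) f \<le> ennreal (3 * (\<delta> n)\<^sup>2 + 16 * \<kappa>\<^sup>2 * l / real n)"
      if f: "f \<in> fun_class \<alpha> L" for f
      unfolding l_def
    proof (rule risk_delta_net_estimator_le[OF est[OF n] net[OF n] f _ _ n \<kappa>pos nz])
      show "f \<in> sq_int" using f by (auto simp: fun_class_def has_expansion_def)
      show "band_limited M g" if "g \<in> N n" for g using bl[OF n that] by (simp add: M_def)
      show "1 \<le> \<kappa> * cmod (fcoef a k)" if "k \<in> freqs M" for k using \<kappa>a[OF that] .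
    qed
    then have "(SUP f\<in>fun_class \<alpha> L. risk P W a n (fhat n) f) \<le> ennreal (3 * (\<delta> n)\<^sup>2 + 16 * \<kappa>\<^sup>2 * l / real n)"
      by (rule SUP_least)
    then have "ennreal (real n powr (2 * s / D)) * (SUP f\<in>fun_class \<alpha> L. risk P W a n (fhat n) f)
      \<le> ennreal (real n powr (2 * s / D)) * ennreal (3 * (\<delta> n)\<^sup>2 + 16 * \<kappa>\<^sup>2 * l / real n)"
      by (rule mult_left_mono) simp
    also have "\<dots> = ennreal (real n powr (2 * s / D) * (3 * (\<delta> n)\<^sup>2 + 16 * \<kappa>\<^sup>2 * l / real n))"
      by (rule ennreal_mult'[symmetric]) simp
    also have "real n powr (2 * s / D) = x powr (2 * s)" by (simp add: xp)
    also have "x powr (2 * s) * (3 * (\<delta> n)\<^sup>2 + 16 * \<kappa>\<^sup>2 * l / real n) \<le> bound"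
    proof -
      have "l \<ge> 0"
        unfolding l_def by (cases "card (N n) = 0") auto
      then show ?thesis
        unfolding bound_def nx using \<delta>pos[OF n] \<kappa>pos
        by (intro upper_rate_arith[OF x _ \<delta>1 _ \<kappa>k1 _ l2]) auto
    qed
    finally show ?case by (simp add: ennreal_leI xp)
  qed
  then have "limsup (\<lambda>n. ennreal (real n powr (2 * s / D)) *
           (SUP f\<in>fun_class \<alpha> L. risk P W a n (fhat n) f)) \<le> ennreal bound"
    by (rule Limsup_bounded)
  also have "\<dots> < \<infinity>" by simp
  finally show ?thesis by (simp add: D_def d_def)
qed

end

text \<open>A dyadic block in every coordinate gives \<open>M ^ CARD('d)\<close> frequencies whose
  degrees are all of order \<open>M\<close>, so that weights and filter bounds are of one size.
  Positive entries prevent one frequency from being the negative of another.\<close>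

definition cos_freqs :: "nat \<Rightarrow> (nat^'d) set" where
  "cos_freqs M = {j. \<forall>i. j $ i \<in> {M + 1..2 * M}}"

definition int_freq :: "nat^'d \<Rightarrow> int^'d" where
  "int_freq j = (\<chi> i. int (j $ i))"

text \<open>Plane waves, unlike the product functions \<open>trig j k\<close>, stay plane waves
  under convolution, with amplitude multiplied by exactly the modulus of a Fourier coefficient; the
  factor sqrt 2 normalizes.\<close>

definition cos_wave :: "nat^'d \<Rightarrow> real^'d \<Rightarrow> real" where
  "cos_wave j x = Re (of_real (sqrt 2) * expo (int_freq j) x)"

lemma finite_cos_freqs: "finite (cos_freqs M)"
  unfolding cos_freqs_def by (rule finite_vecs) simp

lemma card_cos_freqs: "card (cos_freqs M :: (nat^'d) set) = M ^ CARD('d)"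
  unfolding cos_freqs_def by (subst card_vecs) simp_all

lemma abs_freq_int_freq [simp]: "abs_freq (int_freq j) = j"
  by (simp add: int_freq_def vec_eq_iff)

lemma deg_cos_freqs:
  assumes "j \<in> cos_freqs M"
  shows "M + 1 \<le> deg j" and "deg (j :: nat^'d) \<le> CARD('d) * (2 * M)"
proof -
  have j: "M + 1 \<le> j $ i" "j $ i \<le> 2 * M" for i using assms by (auto simp: cos_freqs_def)
  have "j $ undefined \<le> deg j" unfolding deg_def by (rule member_le_sum) auto
  then show "M + 1 \<le> deg j" using j(1)[of undefined] by linarith
  show "deg j \<le> CARD('d) * (2 * M)"
    unfolding deg_def using sum_bounded_above[of UNIV "\<lambda>i. j $ i" "2 * M"] j(2) by simp
qed

lemma cos_freqs_nonzero:
  assumes "j \<in> cos_freqs M"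
  shows "j \<noteq> 0" "int_freq j \<noteq> 0"
proof -
  have "j $ undefined \<noteq> 0" using assms by (auto simp: cos_freqs_def dest!: spec[of _ undefined])
  then show "j \<noteq> 0" "int_freq j \<noteq> 0"
    unfolding vec_eq_iff int_freq_def by (auto intro!: exI[of _ undefined])
qed

lemma cos_wave_sq_int: "cos_wave j \<in> sq_int"
  unfolding cos_wave_def[abs_def] by (rule sq_int_Re_expo)

lemma l2_inner_cos_wave:
  assumes "j \<in> cos_freqs M" "k \<in> cos_freqs M"
  shows "l2_inner (cos_wave j) (cos_wave k) = (if j = k then 1 else 0)"
proof -
  have "int_freq k \<noteq> - int_freq j"
  proof
    assume "int_freq k = - int_freq j"
    then have "int (k $ undefined) = - int (j $ undefined)" by (simp add: int_freq_def vec_eq_iff)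
    moreover have "j $ undefined \<ge> 1" "k $ undefined \<ge> 1" using assms by (auto simp: cos_freqs_def dest!: spec[of _ undefined])
    ultimately show False by simp
  qed
  moreover have "int_freq k = int_freq j \<longleftrightarrow> k = j" by (auto simp: int_freq_def vec_eq_iff)
  ultimately show ?thesis
    unfolding cos_wave_def[abs_def] l2_inner_Re_expo[OF sq_int_Re_expo] fcoef_Re_expo
    by (auto simp flip: of_real_mult)
qed

lemma l2_norm_conv_cos_wave:
  assumes "periodic_filter a" "j \<in> cos_freqs M"
  shows "l2_norm (conv a (cos_wave j)) = cmod (fcoef a (int_freq j))"
proof -
  interpret periodic_filter a by fact
  have "conv a (cos_wave j) = (\<lambda>x. Re (of_real (sqrt 2) * fcoef a (int_freq j) * expo (int_freq j) x))"
    unfolding cos_wave_def[abs_def] by (rule ext) (rule conv_Re_expo)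
  then show ?thesis
    using l2_norm_Re_expo[OF cos_freqs_nonzero(2)[OF assms(2)]] by (simp only: norm_mult) simp
qed

text \<open>A count: \<open>M ^ CARD('d)\<close> waves, each with at most
  \<open>2 ^ CARD('d)\<close> coefficients of square at most \<open>2 * \<epsilon>\<^sup>2\<close>,
  and weights at most \<open>C1 * (2 * CARD('d) * M) powr s\<close> because no degree exceeds
  \<open>2 * CARD('d) * M\<close>.\<close>

lemma cos_wave_comb_in_fun_class:
  fixes \<alpha> :: "nat^'d \<Rightarrow> nat^'d \<Rightarrow> real"
  assumes "s > 0" "C0 > 0" "C1 > 0" "L > 0" and M: "M \<ge> 1"
    and \<alpha>: "\<And>j k. j \<noteq> 0 \<Longrightarrow> k \<in> K j \<Longrightarrow>
           C0 * real (deg j) powr s \<le> \<alpha> j k \<and> \<alpha> j k \<le> C1 * real (deg j) powr s"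
    and e: "\<And>j. \<bar>e j\<bar> \<le> \<epsilon>"
    and small: "2 ^ (CARD('d) + 1) * C1\<^sup>2 * (2 * real CARD('d)) powr (2 * s) *
      (\<epsilon>\<^sup>2 * real M powr (2 * s + real CARD('d))) \<le> L\<^sup>2"
  shows "(\<lambda>x. \<Sum>j\<in>cos_freqs M. e j * cos_wave j x) \<in> fun_class \<alpha> L"
proof -
  let ?B = "cos_freqs M :: (nat^'d) set"
  define S where "S = Sigma ?B K"
  have S: "finite S" "S \<subseteq> idx"
    unfolding S_def idx_def by (auto intro: finite_cos_freqs finite_K)
  define \<theta> where "\<theta> j k = (if j \<in> ?B \<and> k \<in> K j then e j * (sqrt 2 * Re (expo_coeff (int_freq j) k)) else 0)" for j k
  have \<theta>0: "\<theta> j k = 0" if "(j, k) \<in> idx" "(j, k) \<notin> S" for j k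
    using that by (auto simp: S_def \<theta>_def)
  have exp: "has_expansion \<theta> (\<lambda>x. \<Sum>j\<in>?B. e j * cos_wave j x)"
  proof (rule has_expansion_finite[OF S])
    show "\<theta> j k = 0" if "(j, k) \<in> idx" "(j, k) \<notin> S" for j k using \<theta>0 that .
    fix x :: "real^'d"
    have "(\<Sum>(j, k)\<in>S. \<theta> j k * trig j k x) = (\<Sum>j\<in>?B. \<Sum>k\<in>K j. \<theta> j k * trig j k x)"
      unfolding S_def by (subst sum.Sigma) (auto intro: finite_cos_freqs finite_K)
    also have "\<dots> = (\<Sum>j\<in>?B. e j * cos_wave j x)"
    proof (intro sum.cong refl)
      fix j assume j: "j \<in> ?B"
      have "cos_wave j x = sqrt 2 * Re (expo (int_freq j) x)" by (simp add: cos_wave_def)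
      also have "\<dots> = sqrt 2 * (\<Sum>k\<in>K j. Re (expo_coeff (int_freq j) k) * trig j k x)"
        by (simp add: Re_expo_eq_sum_trig)
      finally show "(\<Sum>k\<in>K j. \<theta> j k * trig j k x) = e j * cos_wave j x"
        using j by (simp add: \<theta>_def sum_distrib_left mult.assoc)
    qed
    finally show "(\<Sum>j\<in>?B. e j * cos_wave j x) = (\<Sum>(j, k)\<in>S. \<theta> j k * trig j k x)" by simp
  qed
  define h where "h = (\<lambda>(j, k). (\<alpha> j k)\<^sup>2 * (\<theta> j k)\<^sup>2)"
  have h0: "h p = 0" if "p \<in> idx - S" for p
    using that \<theta>0 by (cases p) (auto simp: h_def)
  have "h summable_on idx \<longleftrightarrow> h summable_on S"
    by (rule summable_on_cong_neutral) (use S h0 in auto)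
  then have summ: "h summable_on idx" using S by simp
  have "infsum h idx = infsum h S"
    using S h0 by (intro infsum_cong_neutral) auto
  also have "\<dots> = sum h S" using S by simp
  also have "\<dots> = (\<Sum>j\<in>?B. \<Sum>k\<in>K j. (\<alpha> j k)\<^sup>2 * (\<theta> j k)\<^sup>2)"
    unfolding S_def h_def by (subst sum.Sigma) (auto intro: finite_cos_freqs finite_K)
  also have "\<dots> \<le> (\<Sum>j\<in>?B. \<Sum>k\<in>K j. (C1 * (2 * real CARD('d) * real M) powr s)\<^sup>2 * (2 * \<epsilon>\<^sup>2))"
  proof (intro sum_mono mult_mono)
    fix j k assume j: "j \<in> ?B" and k: "k \<in> K j"
    note \<alpha>jk = \<alpha>[OF cos_freqs_nonzero(1)[OF j] k]
    have "0 \<le> C0 * real (deg j) powr s" using \<open>C0 > 0\<close> by simp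
    then have \<alpha>0: "0 \<le> \<alpha> j k" using \<alpha>jk by linarith
    have "real (deg j) \<le> real (CARD('d) * (2 * M))" using deg_cos_freqs(2)[OF j] by (simp only: of_nat_le_iff)
    then have "real (deg j) powr s \<le> (2 * real CARD('d) * real M) powr s"
      using \<open>s > 0\<close> by (intro powr_mono2) (auto simp: algebra_simps)
    then have "C1 * real (deg j) powr s \<le> C1 * (2 * real CARD('d) * real M) powr s"
      using \<open>C1 > 0\<close> by (intro mult_left_mono) auto
    with \<alpha>jk have "\<alpha> j k \<le> C1 * (2 * real CARD('d) * real M) powr s" by linarith
    then show "(\<alpha> j k)\<^sup>2 \<le> (C1 * (2 * real CARD('d) * real M) powr s)\<^sup>2"
      using \<alpha>0 by (intro power_mono)
    have "\<bar>Re (expo_coeff (int_freq j) k)\<bar> \<le> 1"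
      using abs_Re_le_cmod[of "expo_coeff (int_freq j) k"] norm_expo_coeff_le[of "int_freq j" k] by linarith
    then have "\<bar>e j\<bar> * (sqrt 2 * \<bar>Re (expo_coeff (int_freq j) k)\<bar>) \<le> \<epsilon> * (sqrt 2 * 1)"
      using e[of j] order_trans[OF abs_ge_zero e[of j]] by (intro mult_mono) auto
    then have "\<bar>\<theta> j k\<bar> \<le> \<epsilon> * (sqrt 2 * 1)"
      using j k by (simp add: \<theta>_def abs_mult)
    then have "\<bar>\<theta> j k\<bar>\<^sup>2 \<le> (\<epsilon> * (sqrt 2 * 1))\<^sup>2" by (intro power_mono) auto
    then show "(\<theta> j k)\<^sup>2 \<le> 2 * \<epsilon>\<^sup>2" by (simp add: power_mult_distrib)
  qed auto
  also have "\<dots> \<le> (\<Sum>j\<in>?B. 2 ^ CARD('d) * ((C1 * (2 * real CARD('d) * real M) powr s)\<^sup>2 * (2 * \<epsilon>\<^sup>2)))"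
  proof (intro sum_mono)
    fix j :: "nat^'d"
    have "real (card (K j)) \<le> 2 ^ CARD('d)"
      using card_K_le[of j] by (metis of_nat_le_iff of_nat_numeral of_nat_power)
    then show "(\<Sum>k\<in>K j. (C1 * (2 * real CARD('d) * real M) powr s)\<^sup>2 * (2 * \<epsilon>\<^sup>2))
      \<le> 2 ^ CARD('d) * ((C1 * (2 * real CARD('d) * real M) powr s)\<^sup>2 * (2 * \<epsilon>\<^sup>2))"
      by (simp add: mult_right_mono)
  qed
  also have "\<dots> = real M ^ CARD('d) * (2 ^ CARD('d) * ((C1 * (2 * real CARD('d) * real M) powr s)\<^sup>2 * (2 * \<epsilon>\<^sup>2)))"
    by (simp add: card_cos_freqs)
  also have "\<dots> = 2 ^ (CARD('d) + 1) * C1\<^sup>2 * (2 * real CARD('d)) powr (2 * s) *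
      (\<epsilon>\<^sup>2 * real M powr (2 * s + real CARD('d)))"
  proof -
    have "((2 * real CARD('d) * real M) powr s)\<^sup>2 = (2 * real CARD('d)) powr (2 * s) * real M powr (2 * s)"
    proof -
      have "((2 * real CARD('d) * real M) powr s)\<^sup>2 = (2 * real CARD('d) * real M) powr (2 * s)"
        by (simp add: power2_eq_square flip: powr_add)
      then show ?thesis by (simp only: powr_mult)
    qed
    moreover have "real M powr (2 * s + real CARD('d)) = real M powr (2 * s) * real M ^ CARD('d)"
      using M by (simp add: powr_add powr_realpow)
    ultimately show ?thesis by (simp add: power_mult_distrib algebra_simps)
  qed
  also have "\<dots> \<le> L\<^sup>2" by (rule small)
  finally have "\<theta> \<in> ellipsoid \<alpha> L"
    using summ by (simp add: ellipsoid_def h_def)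
  then show ?thesis using exp by (auto simp: fun_class_def)
qed

context deconvolution
begin

lemma minimax_lower_bound:
  assumes pos: "s > 0" "q \<ge> 0" "C0 > 0" "C1 > 0" "C3 > 0" "L > 0"
    and \<alpha>: "\<And>j k. j \<noteq> 0 \<Longrightarrow> k \<in> K j \<Longrightarrow>
           C0 * real (deg j) powr s \<le> \<alpha> j k \<and> \<alpha> j k \<le> C1 * real (deg j) powr s"
    and exp: "has_expansion b a"
    and b: "\<And>j k. j \<noteq> 0 \<Longrightarrow> k \<in> K j \<Longrightarrow> \<bar>b j k\<bar> \<le> C3 * real (deg j) powr (-q)"
  shows "liminf (\<lambda>n. ennreal (real n powr (2 * s / (2 * s + 2 * q + real CARD('d)))) *
           (INF ghat\<in>estimators. SUP f\<in>fun_class \<alpha> L. risk P W a n ghat f)) > 0"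
proof -
  define d where "d = real CARD('d)"
  have d: "d > 0" by (simp add: d_def)
  define D where "D = 2 * s + 2 * q + d"
  have D: "D > 0" using pos d by (simp add: D_def)
  \<comment> \<open>\<open>G1\<close> collects the constants of the testing condition in
    \<open>assouad\<close>, \<open>G2\<close> those of membership in the ellipsoid;
    \<open>\<gamma>\<close> is the largest constant that meets both.\<close>
  define G1 where "G1 = 4 * (4 ^ CARD('d) * C3)\<^sup>2"
  define G2 where "G2 = 2 ^ (CARD('d) + 1) * C1\<^sup>2 * (2 * d) powr (2 * s)"
  define \<gamma> where "\<gamma> = min (1 / G1) (L\<^sup>2 / G2)"
  have G: "G1 > 0" "G2 > 0" using pos d by (simp_all add: G1_def G2_def)
  have \<gamma>: "\<gamma> > 0" "\<gamma> * G1 \<le> 1" "\<gamma> * G2 \<le> L\<^sup>2"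
    using G pos by (simp_all add: \<gamma>_def min_def field_simps)
  define c where "c = exp (-1/2) / 2 * \<gamma> * 2 powr (- 2 * s)"
  have c: "c > 0" using \<gamma> by (simp add: c_def)
  have "ennreal c \<le> ennreal (real n powr (2 * s / D)) *
      (INF ghat\<in>estimators. SUP f\<in>fun_class \<alpha> L. risk P W a n ghat f)" if n: "n \<ge> 1" for n
  proof -
    define x where "x = real n powr (1 / D)"
    have x: "x \<ge> 1" unfolding x_def using n D by (intro ge_one_powr_ge_zero) auto
    have xp: "x powr t = real n powr (t / D)" for t by (simp add: x_def powr_powr)
    \<comment> \<open>Rounding up ensures \<open>real n \<le> real M powr D\<close>, which the
      testing condition needs; overshooting by at most a factor 2 costs the factor
      \<open>2 powr (- 2 * s)\<close> in \<open>c\<close>.\<close>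
    define M where "M = nat \<lceil>x\<rceil>"
    have M: "x \<le> real M" "real M \<le> 2 * x" "M \<ge> 1"
      using x by (auto simp: M_def) linarith+
    define \<epsilon> where "\<epsilon> = sqrt (\<gamma> * real M powr (- (2 * s + d)))"
    have \<epsilon>: "\<epsilon> \<ge> 0" using \<gamma> by (simp add: \<epsilon>_def)
    have \<epsilon>2: "\<epsilon>\<^sup>2 = \<gamma> * real M powr (- (2 * s + d))" using \<gamma> by (simp add: \<epsilon>_def)
    have lower: "ennreal (c * x powr (- (2 * s))) \<le> (SUP f\<in>fun_class \<alpha> L. risk P W a n T f)"
      if T: "T \<in> estimators" for T
    proof -
      have "ennreal (exp (-1/2) / 2 * (real (card (cos_freqs M :: (nat^'d) set)) * \<epsilon>\<^sup>2))
        \<le> (SUP f\<in>fun_class \<alpha> L. risk P W a n T f)"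
      proof (rule assouad[OF T n finite_cos_freqs])
        show "cos_wave j \<in> sq_int" for j :: "nat^'d" by (rule cos_wave_sq_int)
        show "l2_inner (cos_wave j) (cos_wave k) = (if j = k then 1 else 0)"
          if "j \<in> cos_freqs M" "k \<in> cos_freqs M" for j k :: "nat^'d"
          using that by (rule l2_inner_cos_wave)
        show "(\<lambda>y. \<Sum>j\<in>cos_freqs M. (if j \<in> S then \<epsilon> else - \<epsilon>) * cos_wave j y) \<in> fun_class \<alpha> L"
          for S :: "(nat^'d) set"
        proof (rule cos_wave_comb_in_fun_class[OF pos(1,3,4,6) M(3) \<alpha>])
          show "\<bar>if j \<in> S then \<epsilon> else - \<epsilon>\<bar> \<le> \<epsilon>" for j using \<epsilon> by simp
          have "\<epsilon>\<^sup>2 * real M powr (2 * s + real CARD('d)) = \<gamma>"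
            using M(3) by (simp add: \<epsilon>2 d_def mult.assoc flip: powr_add)
          then show "2 ^ (CARD('d) + 1) * C1\<^sup>2 * (2 * real CARD('d)) powr (2 * s) *
              (\<epsilon>\<^sup>2 * real M powr (2 * s + real CARD('d))) \<le> L\<^sup>2"
            using \<gamma>(3) by (simp add: G2_def d_def mult.commute)
        qed
        fix j :: "nat^'d" assume j: "j \<in> cos_freqs M"
        have "cmod (fcoef a (int_freq j)) \<le> 4 ^ CARD('d) * (C3 * real (deg j) powr (-q))"
          using b[OF cos_freqs_nonzero(1)[OF j]] by (intro cmod_fcoef_le[OF exp]) simp
        also have "real (deg j) powr (-q) \<le> real M powr (-q)"
          using deg_cos_freqs(1)[OF j] M(3) pos(2) by (intro powr_mono2') auto
        finally have "cmod (fcoef a (int_freq j)) \<le> 4 ^ CARD('d) * (C3 * real M powr (-q))"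
          using pos(5) by (simp add: mult_left_mono)
        then have "(cmod (fcoef a (int_freq j)))\<^sup>2 \<le> (4 ^ CARD('d) * (C3 * real M powr (-q)))\<^sup>2"
          by (intro power_mono) auto
        then have "4 * real n * \<epsilon>\<^sup>2 * (cmod (fcoef a (int_freq j)))\<^sup>2
          \<le> 4 * real n * \<epsilon>\<^sup>2 * (4 ^ CARD('d) * (C3 * real M powr (-q)))\<^sup>2"
          by (intro mult_left_mono) auto
        also have "\<dots> = \<gamma> * G1 * (real n * (real M powr (- (2 * s + d)) * (real M powr (-q))\<^sup>2))"
          by (simp add: \<epsilon>2 G1_def power_mult_distrib)
        also have "real M powr (- (2 * s + d)) * (real M powr (-q))\<^sup>2 = real M powr (- D)"
          unfolding power2_eq_square powr_add[symmetric]
          by (rule arg_cong[of _ _ "(powr) (real M)"]) (simp add: D_def)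
        also have "real n * real M powr (- D) \<le> 1"
        proof -
          have "real n = x powr D" using n D by (simp add: xp)
          also have "\<dots> \<le> real M powr D" using x M(1) D by (intro powr_mono2) auto
          finally show ?thesis using M(3) by (simp add: powr_minus field_simps)
        qed
        then have "\<gamma> * G1 * (real n * real M powr (- D)) \<le> 1 * 1"
          using \<gamma> G by (intro mult_mono) auto
        finally show "4 * real n * \<epsilon>\<^sup>2 * (l2_norm (conv a (cos_wave j)))\<^sup>2 \<le> 1"
          by (simp add: l2_norm_conv_cos_wave[OF periodic_filter_axioms j])
      qed
      moreover have "c * x powr (- (2 * s)) \<le> exp (-1/2) / 2 * (real (card (cos_freqs M :: (nat^'d) set)) * \<epsilon>\<^sup>2)"
      proof -
        have "real (card (cos_freqs M :: (nat^'d) set)) * \<epsilon>\<^sup>2 = \<gamma> * (real M powr d * real M powr (- (2 * s + d)))"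
          using M(3) by (simp add: card_cos_freqs \<epsilon>2 d_def powr_realpow)
        also have "real M powr d * real M powr (- (2 * s + d)) = real M powr (- (2 * s))"
          by (simp flip: powr_add)
        finally have eq: "real (card (cos_freqs M :: (nat^'d) set)) * \<epsilon>\<^sup>2 = \<gamma> * real M powr (- (2 * s))" .
        have "(2 * x) powr (- (2 * s)) \<le> real M powr (- (2 * s))"
          using x M pos by (intro powr_mono2') auto
        then have "exp (-1/2) / 2 * (\<gamma> * (2 * x) powr (- (2 * s))) \<le> exp (-1/2) / 2 * (\<gamma> * real M powr (- (2 * s)))"
          using \<gamma> by (intro mult_left_mono) auto
        moreover have "c * x powr (- (2 * s)) = exp (-1/2) / 2 * (\<gamma> * (2 * x) powr (- (2 * s)))"
          using x by (simp add: c_def powr_mult)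
        ultimately show ?thesis unfolding eq by simp
      qed
      ultimately show ?thesis by (meson ennreal_leI order_trans)
    qed
    have "ennreal c = ennreal (x powr (2 * s)) * ennreal (c * x powr (- (2 * s)))"
    proof -
      have "x powr (2 * s) * (c * x powr (- (2 * s))) = c * (x powr (2 * s) * x powr (- (2 * s)))" by simp
      also have "\<dots> = c" unfolding powr_add[symmetric] using x by simp
      finally show ?thesis using c by (subst ennreal_mult[symmetric]) auto
    qed
    also have "\<dots> \<le> ennreal (x powr (2 * s)) * (INF ghat\<in>estimators. SUP f\<in>fun_class \<alpha> L. risk P W a n ghat f)"
      by (intro mult_left_mono INF_greatest lower) auto
    finally show ?thesis by (simp add: xp)
  qed
  then have "eventually (\<lambda>n. ennreal c \<le> ennreal (real n powr (2 * s / D)) *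
      (INF ghat\<in>estimators. SUP f\<in>fun_class \<alpha> L. risk P W a n ghat f)) sequentially"
    by (rule eventually_sequentiallyI[of 1])
  then have "ennreal c \<le> liminf (\<lambda>n. ennreal (real n powr (2 * s / D)) *
      (INF ghat\<in>estimators. SUP f\<in>fun_class \<alpha> L. risk P W a n ghat f))"
    by (rule Liminf_bounded)
  then show ?thesis
    unfolding D_def d_def by (rule less_le_trans[rotated]) (simp add: c)
qed

end

theorem corollary1:
  fixes a :: "real^'d \<Rightarrow> real"
    and \<alpha> b :: "nat^'d \<Rightarrow> nat^'d \<Rightarrow> real"
    and L s q C0 C1 C2 C3 :: real
    and P :: "'w measure"
    and W :: "(real^'d \<Rightarrow> real) \<Rightarrow> 'w \<Rightarrow> real"
  assumes "white_noise P W"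
    and "L > 0" and "s > 0" and "q \<ge> 0"
    and "C0 > 0" and "C1 > 0" and "C2 > 0" and "C3 > 0"
    and "\<And>j k. j \<noteq> 0 \<Longrightarrow> k \<in> K j \<Longrightarrow>
           C0 * real (deg j) powr s \<le> \<alpha> j k \<and> \<alpha> j k \<le> C1 * real (deg j) powr s"
    and "\<alpha> 0 0 > 0"
    and "one_periodic a" and "a \<in> sq_int" and "has_expansion b a"
    and "\<And>j k. j \<noteq> 0 \<Longrightarrow> k \<in> K j \<Longrightarrow>
           C2 * real (deg j) powr (-q) \<le> b j k \<and> b j k \<le> C3 * real (deg j) powr (-q)"
    and "b 0 0 > 0"
  shows "((CARD('d) \<ge> 3 \<longrightarrow> singular_values_ge a q) \<longrightarrow>
      (\<forall>\<delta> N fhat. admissible_nets \<alpha> L s q \<delta> N \<and>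
           (\<forall>n\<ge>1. delta_net_estimator a (N n) (fhat n)) \<longrightarrow>
         limsup (\<lambda>n. ennreal (real n powr (2 * s / (2 * s + 2 * q + real CARD('d)))) *
           (SUP f\<in>fun_class \<alpha> L. risk P W a n (fhat n) f)) < \<infinity>))
    \<and> liminf (\<lambda>n. ennreal (real n powr (2 * s / (2 * s + 2 * q + real CARD('d)))) *
           (INF ghat\<in>estimators. SUP f\<in>fun_class \<alpha> L. risk P W a n ghat f)) > 0"
proof -
  note \<alpha> = assms(9) and exp = \<open>has_expansion b a\<close> and b = assms(14)
  interpret deconvolution P W a
    using assms one_periodic_imp_periodic
    by (simp add: deconvolution_def noise_def periodic_filter_def)
  have upper: "limsup (\<lambda>n. ennreal (real n powr (2 * s / (2 * s + 2 * q + real CARD('d)))) *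
           (SUP f\<in>fun_class \<alpha> L. risk P W a n (fhat n) f)) < \<infinity>"
    if sv: "CARD('d) \<ge> 3 \<longrightarrow> singular_values_ge a q" and nets: "admissible_nets \<alpha> L s q \<delta> N"
      and est: "\<forall>n\<ge>1. delta_net_estimator a (N n) (fhat n)" for \<delta> N fhat
  proof -
    \<comment> \<open>In dimensions 1 and 2 the signs of the coefficients rule out cancellation;
      from dimension 3 on the bound is supplied by the singular values.\<close>
    obtain c' where c': "c' > 0"
      "\<And>m. m \<noteq> 0 \<Longrightarrow> c' * real (deg (abs_freq m)) powr (-q) \<le> cmod (fcoef a m)"
    proof (cases "CARD('d) \<ge> 3")
      case True
      then show ?thesis using cmod_fcoef_ge_singular[of q] sv that by blast
    next
      case False
      have "C2 / 2 * real (deg (abs_freq m)) powr (-q) \<le> cmod (fcoef a m)" if "m \<noteq> 0" for m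
      proof -
        have "C2 * real (deg (abs_freq m)) powr (-q) / 2 \<le> cmod (fcoef a m)"
        proof (rule cmod_fcoef_ge_low_dim[OF exp _ that])
          show "CARD('d) \<le> 2" using False by simp
          show "C2 * real (deg (abs_freq m)) powr (-q) \<le> b (abs_freq m) k" if "k \<in> K (abs_freq m)" for k
            using b[of "abs_freq m" k] that \<open>m \<noteq> 0\<close> by (simp add: abs_freq_eq_0_iff)
        qed (use \<open>C2 > 0\<close> in simp)
        then show ?thesis by simp
      qed
      then show ?thesis using that[of "C2 / 2"] \<open>C2 > 0\<close> by simp
    qed
    have a0: "cmod (fcoef a 0) > 0"
      using cmod_fcoef_0[OF exp] trig_weight_pos[of "0 :: nat^'d"] \<open>b 0 0 > 0\<close> by simp
    \<comment> \<open>One constant for all frequencies: the decay bound starts at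
      \<open>m \<noteq> 0\<close>, and the mean of the filter is covered by the minimum.\<close>
    define c where "c = min c' (cmod (fcoef a 0))"
    show ?thesis
    proof (rule delta_net_upper_bound[OF \<open>s > 0\<close> \<open>q \<ge> 0\<close> _ _ _ nets])
      show "c > 0" "c \<le> cmod (fcoef a 0)" using c' a0 by (simp_all add: c_def)
      show "c * real (deg (abs_freq m)) powr (-q) \<le> cmod (fcoef a m)" if "m \<noteq> 0" for m
      proof -
        have "c * real (deg (abs_freq m)) powr (-q) \<le> c' * real (deg (abs_freq m)) powr (-q)"
          by (intro mult_right_mono) (auto simp: c_def)
        then show ?thesis using c'(2)[OF that] by linarith
      qed
    qed (use est in simp)
  qed
  have "\<bar>b j k\<bar> \<le> C3 * real (deg j) powr (-q)" if "j \<noteq> 0" "k \<in> K j" for j k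
  proof -
    have "0 \<le> C2 * real (deg j) powr (-q)" using \<open>C2 > 0\<close> by simp
    then show ?thesis using b[OF that] by linarith
  qed
  then have "liminf (\<lambda>n. ennreal (real n powr (2 * s / (2 * s + 2 * q + real CARD('d)))) *
           (INF ghat\<in>estimators. SUP f\<in>fun_class \<alpha> L. risk P W a n ghat f)) > 0"
    by (intro minimax_lower_bound[OF \<open>s > 0\<close> \<open>q \<ge> 0\<close> \<open>C0 > 0\<close> \<open>C1 > 0\<close> \<open>C3 > 0\<close> \<open>L > 0\<close> \<alpha> exp])
  then show ?thesis using upper by blast
qed

end
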